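(* Let $d\ge 2$ and let $(f_k)$ be a sequence of complex rational functions of degree $d$ that diverges in the space $\mathrm{Rat}_d$ of complex rational functions of degree $d$. Let $\mu_k$ be the measure of maximal entropy of $f_k$, and assume that the measures $\mu_k$ converge weakly to a probability measure $\mu$ on the Riemann sphere $\hat{\mathbb{C}}$. Then $\mu$ is equal to a countable sum of atoms; that is, $\mu=\sum_i c_i\delta_{x_i}$ for an at most countable set of points $x_i\in\hat{\mathbb{C}}$ and weights $c_i> 0$.
   Context: $\mathrm{Rat}_d$ is the set of complex rational functions $f(z)=\frac{a_0z^d+\cdots+a_d}{b_0z^d+\cdots+b_d}$ of degree exactly $d$, identified with an open subset of $\overline{\mathrm{Rat}}_d=\mathbb{P}^{2d+1}(\mathbb{C})$ via the coefficients $(a_0:\cdots:a_d:b_0:\cdots:b_d)$; it is the complement of the resultant hypersurface. A sequence in $\mathrm{Rat}_d$ diverges if it eventually leaves every compact subset of $\mathrm{Rat}_d$ (equivalently, all its accumulation points in $\overline{\mathrm{Rat}}_d$ lie in $\partial\mathrm{Rat}_d=\overline{\mathrm{Rat}}_d\smallsetminus\mathrm{Rat}_d$). The measure of maximal entropy of a rational function $f$ of degree $d\geq2$ is the unique Borel probability measure $\mu_f$ on $\hat{\mathbb{C}}$ satisfying $\frac1d f^*\mu_f=\mu_f$ and not charging exceptional points (points with finite grand orbit); here $\int\psi\,d(f^*\mu)=\int f_*\psi\,d\mu$ with $f_*\psi(y)=\sum_{f(x)=y}\psi(x)$, preimages counted with multiplicity. *)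

theory Defs
  imports
    "HOL-Probability.Probability"
    "HOL-Computational_Algebra.Computational_Algebra"
    "HOL-Computational_Algebra.Field_as_Ring"
begin

section \<open>The Riemann sphere\<close>

datatype rsphere = Fin complex | Infty

instantiation rsphere :: topological_space
begin

definition open_rsphere_def:
  "open U \<longleftrightarrow> open (Fin -` U) \<and> (Infty \<in> U \<longrightarrow> compact (- (Fin -` U)))"

instance
proof
  show "open (UNIV :: rsphere set)"
    by (simp add: open_rsphere_def)
next
  fix S T :: "rsphere set"
  assume "open S" "open T"
  then show "open (S \<inter> T)"
    by (auto simp: open_rsphere_def vimage_Int Compl_Int)
next
  fix K :: "rsphere set set"
  assume K: "\<forall>S\<in>K. open S"
  then have op: "open (Fin -` \<Union> K)"
    by (auto simp: open_rsphere_def vimage_Union)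
  moreover have "compact (- (Fin -` \<Union> K))" if "Infty \<in> \<Union> K"
  proof -
    from that obtain S where S: "S \<in> K" "Infty \<in> S" by blast
    with K have "compact (- (Fin -` S))"
      by (auto simp: open_rsphere_def)
    moreover have "- (Fin -` \<Union> K) = - (Fin -` S) \<inter> - (Fin -` \<Union> K)"
      using S by blast
    ultimately show ?thesis
      using op compact_Int_closed closed_Compl by metis
  qed
  ultimately show "open (\<Union> K)"
    by (simp add: open_rsphere_def)
qed

end

lemma rsphere_homeomorphic_Alexandroff:
  "homeomorphic_map (Alexandroff_compactification (euclidean :: complex topology)) euclidean
     (case_option Infty Fin)"
proof -
  let ?h = "case_option Infty Fin"
  have inj: "inj ?h"
    by (auto simp: inj_on_def split: option.splits)
  have surj: "range ?h = UNIV"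
  proof -
    have "y \<in> range ?h" for y
    proof (cases y)
      case (Fin z)
      then show ?thesis by (intro image_eqI[of _ _ "Some z"]) auto
    next
      case Infty
      then show ?thesis by (intro image_eqI[of _ _ None]) auto
    qed
    then show ?thesis by blast
  qed
  have UN: "insert None (range Some) = (UNIV :: complex option set)"
    by (auto simp: notin_range_Some)
  have "openin (Alexandroff_compactification euclidean) (?h -` U) \<longleftrightarrow> open U"
    for U :: "rsphere set"
  proof (cases "Infty \<in> U")
    case True
    have eq: "?h -` U = insert None (Some ` (UNIV - (- (Fin -` U))))"
    proof (rule set_eqI)
      show "x \<in> ?h -` U \<longleftrightarrow> x \<in> insert None (Some ` (UNIV - (- (Fin -` U))))" for x
        using True by (cases x) auto
    qed
    have "openin (Alexandroff_compactification euclidean) (?h -` U)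
            \<longleftrightarrow> compact (- (Fin -` U))"
    proof
      assume "openin (Alexandroff_compactification euclidean) (?h -` U)"
      then obtain C where "compact C" "?h -` U = insert None (Some ` (UNIV - C))"
        using True by (auto simp: openin_Alexandroff_compactification)
      then have "Some ` (UNIV - C) = Some ` (Fin -` U)"
        using eq by (metis Compl_eq_Diff_UNIV None_notin_image_Some double_compl insert_ident)
      then have "C = - (Fin -` U)"
        by (metis Compl_eq_Diff_UNIV double_compl inj_Some inj_image_eq_iff)
      with \<open>compact C\<close> show "compact (- (Fin -` U))" by simp
    next
      assume "compact (- (Fin -` U))"
      then show "openin (Alexandroff_compactification euclidean) (?h -` U)"
        unfolding openin_Alexandroff_compactification
        by (intro disjI2 exI[of _ "- (Fin -` U)"] conjI)
           (simp_all only: compactin_euclidean_iff closed_closedin[symmetric] topspace_euclidean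
              eq compact_imp_closed)
    qed
    moreover have "open (Fin -` U)" if "compact (- (Fin -` U))"
      using compact_imp_closed[OF that] by (simp add: closed_def)
    ultimately show ?thesis
      using True unfolding open_rsphere_def by blast
  next
    case False
    then have eq: "?h -` U = Some ` (Fin -` U)"
    proof (intro set_eqI)
      show "x \<in> ?h -` U \<longleftrightarrow> x \<in> Some ` (Fin -` U)" for x
        using False by (cases x) auto
    qed
    show ?thesis
      unfolding eq using False by (simp add: open_rsphere_def)
  qed
  then have "quotient_map (Alexandroff_compactification euclidean) euclidean ?h"
    unfolding quotient_map_def topspace_Alexandroff_compactification topspace_euclidean UN
    by (simp add: surj vimage_def)
  then show ?thesis
    unfolding homeomorphic_map_def topspace_Alexandroff_compactification topspace_euclidean UN
    using inj by blast
qed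


section \<open>Complex projective space\<close>

text \<open>Vectors with \<open>n + 1\<close> complex coordinates are functions \<open>nat \<Rightarrow> complex\<close> supported on \<open>{..n}\<close>; a point of the
  projective space is the set of all its homogeneous coordinate vectors.\<close>

definition nonzero_vecs :: "nat \<Rightarrow> (nat \<Rightarrow> complex) set" where
  "nonzero_vecs n = {v. (\<forall>i>n. v i = 0) \<and> (\<exists>i\<le>n. v i \<noteq> 0)}"

definition proj_point :: "(nat \<Rightarrow> complex) \<Rightarrow> (nat \<Rightarrow> complex) set" where
  "proj_point v = {(\<lambda>i. c * v i) | c. c \<noteq> 0}"

definition proj_space :: "nat \<Rightarrow> (nat \<Rightarrow> complex) set topology" where
  "proj_space n = topology (\<lambda>U. U \<subseteq> proj_point ` nonzero_vecs n \<and>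
     openin (top_of_set (nonzero_vecs n)) {v \<in> nonzero_vecs n. proj_point v \<in> U})"

lemma openin_proj_space:
  "openin (proj_space n) U \<longleftrightarrow> U \<subseteq> proj_point ` nonzero_vecs n \<and>
     openin (top_of_set (nonzero_vecs n)) {v \<in> nonzero_vecs n. proj_point v \<in> U}"
proof -
  let ?V = "nonzero_vecs n"
  have "istopology (\<lambda>U. U \<subseteq> proj_point ` ?V \<and>
          openin (top_of_set ?V) {v \<in> ?V. proj_point v \<in> U})"
    unfolding istopology_def
  proof (intro conjI allI impI)
    fix S T
    assume "S \<subseteq> proj_point ` ?V \<and> openin (top_of_set ?V) {v \<in> ?V. proj_point v \<in> S}"
      and "T \<subseteq> proj_point ` ?V \<and> openin (top_of_set ?V) {v \<in> ?V. proj_point v \<in> T}"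
    moreover have "{v \<in> ?V. proj_point v \<in> S \<inter> T}
        = {v \<in> ?V. proj_point v \<in> S} \<inter> {v \<in> ?V. proj_point v \<in> T}"
      by blast
    ultimately show "S \<inter> T \<subseteq> proj_point ` ?V"
      and "openin (top_of_set ?V) {v \<in> ?V. proj_point v \<in> S \<inter> T}"
      by (auto simp: openin_Int)
  next
    fix K
    assume K: "\<forall>S\<in>K. S \<subseteq> proj_point ` ?V \<and>
      openin (top_of_set ?V) {v \<in> ?V. proj_point v \<in> S}"
    then show "\<Union> K \<subseteq> proj_point ` ?V" by blast
    have "{v \<in> ?V. proj_point v \<in> \<Union> K} = (\<Union>S\<in>K. {v \<in> ?V. proj_point v \<in> S})"
      by blast
    then show "openin (top_of_set ?V) {v \<in> ?V. proj_point v \<in> \<Union> K}"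
      using K by (auto intro!: openin_Union)
  qed
  then show ?thesis
    by (simp add: proj_space_def)
qed

lemma topspace_proj_space: "topspace (proj_space n) = proj_point ` nonzero_vecs n"
proof -
  have "{v \<in> nonzero_vecs n. proj_point v \<in> proj_point ` nonzero_vecs n} = nonzero_vecs n"
    by blast
  then have "openin (proj_space n) (proj_point ` nonzero_vecs n)"
    by (simp add: openin_proj_space)
  then show ?thesis
    by (metis openin_proj_space openin_subset openin_topspace subset_antisym)
qed

lemma quotient_map_proj_point:
  "quotient_map (top_of_set (nonzero_vecs n)) (proj_space n) proj_point"
  by (auto simp: quotient_map_def topspace_proj_space openin_proj_space)


section \<open>Rational functions\<close>

text \<open>Rational functions are elements of the field \<open>\<complex>(z)\<close>. The constant \<open>\<infinity>\<close> is thereby left out,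
  but it has degree 0. The representatives below are coprime, with monic denominator.\<close>

definition rat_num :: "complex poly fract \<Rightarrow> complex poly" where
  "rat_num f = fst (quot_of_fract f)"

definition rat_den :: "complex poly fract \<Rightarrow> complex poly" where
  "rat_den f = snd (quot_of_fract f)"

definition rat_degree :: "complex poly fract \<Rightarrow> nat" where
  "rat_degree f = max (degree (rat_num f)) (degree (rat_den f))"

fun rat_map :: "complex poly fract \<Rightarrow> rsphere \<Rightarrow> rsphere" where
  "rat_map f (Fin z) =
     (if poly (rat_den f) z = 0 then Infty
      else Fin (poly (rat_num f) z / poly (rat_den f) z))"
| "rat_map f Infty =
     (if coeff (rat_den f) (rat_degree f) = 0 then Infty
      else Fin (coeff (rat_num f) (rat_degree f) / coeff (rat_den f) (rat_degree f)))"


subsection \<open>The space of rational functions of degree \<open>d\<close>\<close>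

definition Rat_set :: "nat \<Rightarrow> complex poly fract set" where
  "Rat_set d = {f. rat_degree f = d}"

text \<open>The vector \<open>(a\<^sub>0, \<dots>, a\<^sub>d, b\<^sub>0, \<dots>, b\<^sub>d)\<close>, where \<open>a\<^sub>i\<close> and \<open>b\<^sub>i\<close> are the coefficients of
  \<open>z ^ (d - i)\<close>.\<close>

definition rat_coeffs :: "nat \<Rightarrow> complex poly fract \<Rightarrow> nat \<Rightarrow> complex" where
  "rat_coeffs d f i =
     (if i \<le> d then coeff (rat_num f) (d - i)
      else if i \<le> 2 * d + 1 then coeff (rat_den f) (2 * d + 1 - i)
      else 0)"

definition Rat_topology :: "nat \<Rightarrow> complex poly fract topology" where
  "Rat_topology d =
     pullback_topology (Rat_set d) (\<lambda>f. proj_point (rat_coeffs d f)) (proj_space (2 * d + 1))"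

definition diverges_in_Rat :: "nat \<Rightarrow> (nat \<Rightarrow> complex poly fract) \<Rightarrow> bool" where
  "diverges_in_Rat d f \<longleftrightarrow>
     (\<forall>K. compactin (Rat_topology d) K \<longrightarrow> (\<forall>\<^sub>F k in sequentially. f k \<notin> K))"


section \<open>The measure of maximal entropy\<close>

text \<open>The equation \<open>f(x) = y\<close> is the vanishing at \<open>x\<close> of the polynomial below, viewed as a binary
  form of degree \<open>rat_degree f\<close>; such a form vanishes at infinity to the order by which
  the degree of the polynomial drops.\<close>

fun fiber_poly :: "complex poly fract \<Rightarrow> rsphere \<Rightarrow> complex poly" where
  "fiber_poly f (Fin w) = rat_num f - smult w (rat_den f)"
| "fiber_poly f Infty = rat_den f"

fun rat_mult :: "complex poly fract \<Rightarrow> rsphere \<Rightarrow> nat" where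
  "rat_mult f (Fin z) = order z (fiber_poly f (rat_map f (Fin z)))"
| "rat_mult f Infty = rat_degree f - degree (fiber_poly f (rat_map f Infty))"

definition push_fun :: "complex poly fract \<Rightarrow> (rsphere \<Rightarrow> real) \<Rightarrow> rsphere \<Rightarrow> real" where
  "push_fun f \<psi> y = (\<Sum>x | rat_map f x = y. real (rat_mult f x) * \<psi> x)"

definition is_pullback_measure ::
    "complex poly fract \<Rightarrow> rsphere measure \<Rightarrow> rsphere measure \<Rightarrow> bool" where
  "is_pullback_measure f \<mu> \<nu> \<longleftrightarrow>
     sets \<nu> = sets borel \<and> finite_measure \<nu> \<and>
     (\<forall>\<psi>. continuous_on UNIV \<psi> \<longrightarrow> (\<integral>x. \<psi> x \<partial>\<nu>) = (\<integral>y. push_fun f \<psi> y \<partial>\<mu>))"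

definition grand_orbit :: "complex poly fract \<Rightarrow> rsphere \<Rightarrow> rsphere set" where
  "grand_orbit f x = {y. \<exists>m n. (rat_map f ^^ m) x = (rat_map f ^^ n) y}"

definition exceptional_points :: "complex poly fract \<Rightarrow> rsphere set" where
  "exceptional_points f = {x. finite (grand_orbit f x)}"

definition is_max_entropy_measure :: "complex poly fract \<Rightarrow> rsphere measure \<Rightarrow> bool" where
  "is_max_entropy_measure f \<mu> \<longleftrightarrow>
     sets \<mu> = sets borel \<and> prob_space \<mu> \<and>
     (\<exists>\<nu>. is_pullback_measure f \<mu> \<nu> \<and> \<mu> = scale_measure (ennreal (1 / real (rat_degree f))) \<nu>) \<and>
     (\<forall>x\<in>exceptional_points f. emeasure \<mu> {x} = 0)"

text \<open>As the sphere is compact, continuous test functions are automatically bounded.\<close>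

definition weakly_converges :: "(nat \<Rightarrow> rsphere measure) \<Rightarrow> rsphere measure \<Rightarrow> bool" where
  "weakly_converges M \<mu> \<longleftrightarrow>
     (\<forall>\<psi> :: rsphere \<Rightarrow> real. continuous_on UNIV \<psi> \<longrightarrow>
        (\<lambda>k. \<integral>x. \<psi> x \<partial>M k) \<longlonglongrightarrow> (\<integral>x. \<psi> x \<partial>\<mu>))"

end

theory Submission
  imports Defs
begin

text \<open>
  Along an ultrafilter on the indices \<open>k\<close>, choose matrices \<open>A\<^sub>0 = 1, A\<^sub>1, A\<^sub>2, \<dots>\<close> of determinant one
  (depending on \<open>k\<close>) such that \<open>A\<^sub>n\<^sub>+\<^sub>1 \<circ> f\<^sub>k \<circ> A\<^sub>n\<inverse>\<close> converges, as a pair of binary forms of degree \<open>d\<close>, to a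
  pair with nonconstant quotient; its common zeros are the holes. Let \<open>\<delta> n\<close> be the mass that
  the measures \<open>(A\<^sub>n)\<^sub>*\<mu>\<^sub>k\<close> keep outside small neighbourhoods of every finite set. The invariance of
  \<open>\<mu>\<^sub>k\<close> gives \<open>\<delta> n \<le> \<delta> (n + 1)\<close>, and even \<open>\<delta> n \<le> (1 - 1/d) \<delta> (n + 1)\<close> if there is a hole, because
  then one of the \<open>d\<close> preimages of each point lies near the hole.

  If \<open>A\<^sub>n A\<^sub>m\<inverse>\<close> tends to infinity, then \<open>A\<^sub>n\<close> and \<open>A\<^sub>m\<close> see disjoint parts of \<open>\<mu>\<^sub>k\<close>. Hence \<open>\<delta> 0 > 0\<close> forces
  \<open>A\<^sub>n A\<^sub>m\<inverse>\<close> to stay bounded for some \<open>n < m\<close>; then there is no hole between \<open>n\<close> and \<open>m\<close>, which allows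
  one to go back to \<open>n = 0\<close>. Without holes the maps expand the logarithmic distances between the \<open>A\<^sub>i\<close>
  by the factor \<open>d\<close>, so all the \<open>A\<^sub>i\<close> of the cycle stay at bounded distance from \<open>A\<^sub>0 = 1\<close>, and \<open>f\<^sub>k\<close>
  converges in \<open>Rat\<^sub>d\<close> along the ultrafilter. So divergence gives \<open>\<delta> 0 = 0\<close>: the limit \<open>\<mu>\<close> has no
  mass outside a countable set.
\<close>

section \<open>Ultrafilters\<close>

text \<open>Degenerating maps may converge to a constant, and near a hole nothing is known about
  images. The first defect is cured by the target coordinates \<open>A (n + 1)\<close>, chosen to
  keep a minor of the coefficients equal to one. Holes cannot be removed, so mass is followed only
  outside neighbourhoods of finite sets, where the convergence is uniform. Enlarging these sets is
  free, since the conclusion allows atoms. Working in \<open>\<complex>\<^sup>2\<close> with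
  determinant one makes the norm of a quotient \<open>A n (A m)\<inverse>\<close> the single measure
  of how far two coordinate systems are apart. Along an ultrafilter this norm is either bounded or
  tends to infinity, and the limits at all levels exist at once. If \<open>\<delta> 0 > 0\<close>,
  every level sees diffuse mass at least \<open>\<delta> 0\<close>, while the total mass is one; so
  the levels cannot all drift apart pairwise. Along a return \<open>\<delta>\<close> is constant and
  positive, which is incompatible with the factor \<open>1 - 1/d\<close> of a hole. In the resulting
  cycle the largest norm \<open>t\<close> of a quotient satisfies \<open>t ^ d \<le> K * t\<close>,
  and \<open>d \<ge> 2\<close> bounds it.\<close>

definition ultra :: "'a filter \<Rightarrow> bool" where
  "ultra F \<longleftrightarrow> F \<noteq> bot \<and> (\<forall>P. eventually P F \<or> eventually (\<lambda>x. \<not> P x) F)"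

lemma ultra_not_eventually:
  "ultra F \<Longrightarrow> \<not> eventually P F \<longleftrightarrow> eventually (\<lambda>x. \<not> P x) F"
  unfolding ultra_def using eventually_elim2[of P F "\<lambda>x. \<not> P x" "\<lambda>_. False"] eventually_False[of F] by blast

lemma ultra_not_bot: "ultra F \<Longrightarrow> F \<noteq> bot"
  by (simp add: ultra_def)

lemma ultrafilter_exists:
  assumes "F0 \<noteq> (bot :: 'a filter)"
  shows "\<exists>F\<le>F0. ultra F"
proof -
  define S where "S = {F :: 'a filter. F \<noteq> bot \<and> F \<le> F0}"
  \<comment> \<open>The order is reversed: a maximal element for \<open>r\<close> is a minimal
    proper filter below \<open>F0\<close>.\<close>
  define r where "r = {(F, G). F \<in> S \<and> G \<in> S \<and> G \<le> F}"
  have "\<exists>m\<in>Field r. \<forall>a\<in>Field r. (m, a) \<in> r \<longrightarrow> a = m"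
  proof (rule Zorns_po_lemma)
    show "Partial_order r"
    proof -
      have "Field r = S" by (auto simp: Field_def r_def)
      moreover have "r \<subseteq> S \<times> S" by (auto simp: r_def)
      moreover have "trans r" "antisym r"
        unfolding trans_def antisym_def by (auto simp: r_def)
      ultimately show ?thesis
        unfolding partial_order_on_def preorder_on_def refl_on_def by (simp add: r_def)
    qed
    fix C assume C: "C \<in> Chains r"
    have CS: "C \<subseteq> S" using C by (auto simp: Chains_def r_def)
    have ch: "G \<le> H \<or> H \<le> G" if "G \<in> C" "H \<in> C" for G H
      using C that by (auto simp: Chains_def r_def)
    show "\<exists>u\<in>Field r. \<forall>a\<in>C. (a, u) \<in> r"
    proof (cases "C = {}")
      case True
      then show ?thesis using assms by (auto simp: Field_def r_def S_def)
    next
      case False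
      have "Inf C \<noteq> bot"
      proof -
        have "eventually P (Inf C) \<longleftrightarrow> (\<exists>b\<in>C. eventually P b)" for P
        proof (rule eventually_Inf_base[OF False])
          fix G H assume "G \<in> C" "H \<in> C"
          with ch[OF this] show "\<exists>x\<in>C. x \<le> inf G H"
            by (metis inf.absorb_iff1 inf.absorb_iff2 order_refl)
        qed
        then show ?thesis
          using CS by (auto simp: trivial_limit_def S_def)
      qed
      moreover have "Inf C \<le> F0"
        using False CS by (auto simp: S_def intro: Inf_lower2)
      ultimately have "Inf C \<in> S" by (simp add: S_def)
      then show ?thesis using CS by (auto simp: Field_def r_def intro: Inf_lower)
    qed
  qed
  then obtain F where F: "F \<in> S" "\<And>G. G \<in> S \<Longrightarrow> G \<le> F \<Longrightarrow> G = F"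
    by (auto simp: Field_def r_def)
  have "eventually P F \<or> eventually (\<lambda>x. \<not> P x) F" for P
  proof (rule ccontr)
    assume *: "\<not> ?thesis"
    \<comment> \<open>If neither \<open>P\<close> nor its negation held eventually, adding
      \<open>P\<close> would give a strictly finer proper filter.\<close>
    let ?G = "inf F (principal {x. P x})"
    have "?G \<noteq> bot"
      using * by (auto simp: trivial_limit_def eventually_inf_principal)
    then have "?G \<in> S" using F(1) by (auto simp: S_def intro: le_infI1)
    then have "?G = F" using F(2) by simp
    moreover have "eventually P ?G"
      by (simp add: eventually_inf_principal)
    ultimately have "eventually P F"
      by simp
    then show False using * by simp
  qed
  then show ?thesis using F(1) by (auto simp: ultra_def S_def)
qed

text \<open>Compactness gives a cluster point of \<open>X\<close> along \<open>F\<close>. For an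
  ultrafilter it is a limit: a neighbourhood that \<open>X\<close> did not eventually enter would be
  eventually avoided. This takes the place of passing to subsequences.\<close>

lemma ultra_compact:
  fixes K :: "'b :: topological_space set"
  assumes "ultra F" "compact K" "eventually (\<lambda>k. X k \<in> K) F"
  obtains x where "x \<in> K" "(X \<longlongrightarrow> x) F"
proof -
  have "filtermap X F \<noteq> bot"
    using ultra_not_bot[OF assms(1)] by (simp add: filtermap_bot_iff)
  moreover have "eventually (\<lambda>y. y \<in> K) (filtermap X F)"
    using assms(3) by (simp add: eventually_filtermap)
  ultimately obtain x where x: "x \<in> K" "inf (nhds x) (filtermap X F) \<noteq> bot"
    using assms(2) unfolding compact_filter by blast
  have "filtermap X F \<le> nhds x"
  proof (rule filter_leI, rule ccontr)
    fix P assume P: "eventually P (nhds x)" and "\<not> eventually P (filtermap X F)"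
    then have "eventually (\<lambda>y. \<not> P y) (filtermap X F)"
      using ultra_not_eventually[OF assms(1)] by (simp add: eventually_filtermap)
    with P have "eventually (\<lambda>_. False) (inf (nhds x) (filtermap X F))"
      unfolding eventually_inf by (intro exI[of _ P] exI[of _ "\<lambda>y. \<not> P y"]) auto
    then show False using x(2) by (simp add: trivial_limit_def)
  qed
  then show ?thesis using x(1) that by (simp add: filterlim_def)
qed

lemma ultra_bounded:
  fixes X :: "'a \<Rightarrow> 'b :: heine_borel"
  assumes "ultra F" "eventually (\<lambda>k. dist a (X k) \<le> R) F"
  obtains x where "(X \<longlongrightarrow> x) F"
proof -
  have "eventually (\<lambda>k. X k \<in> cball a R) F"
    using assms(2) by simp
  with assms(1) obtain x where "(X \<longlongrightarrow> x) F"
    by (rule ultra_compact[OF _ compact_cball])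
  then show ?thesis by (rule that)
qed

lemma ultra_at_top:
  fixes X :: "'a \<Rightarrow> real"
  assumes "ultra F" "\<And>R. \<not> eventually (\<lambda>k. X k \<le> R) F"
  shows "filterlim X at_top F"
  unfolding filterlim_at_top
proof
  fix Z
  have "eventually (\<lambda>k. \<not> X k \<le> Z) F"
    using assms ultra_not_eventually by blast
  then show "eventually (\<lambda>k. Z \<le> X k) F" by eventually_elim simp
qed

section \<open>The complex plane \<open>\<complex>\<^sup>2\<close>\<close>

type_synonym C2 = "complex \<times> complex"

text \<open>Divided by both norms, the modulus of this determinant is, up to normalisation, the
  chordal distance of the two points of the sphere. It treats infinity like any other point.\<close>

definition wedge :: "C2 \<Rightarrow> C2 \<Rightarrow> complex" where
  "wedge u v = fst u * snd v - snd u * fst v"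

definition cscale :: "complex \<Rightarrow> C2 \<Rightarrow> C2" where
  "cscale c v = (c * fst v, c * snd v)"

text \<open>A matrix is the pair of its columns.\<close>

definition lin :: "C2 \<times> C2 \<Rightarrow> C2 \<Rightarrow> C2" where
  "lin M v = cscale (fst v) (fst M) + cscale (snd v) (snd M)"

definition mmul :: "C2 \<times> C2 \<Rightarrow> C2 \<times> C2 \<Rightarrow> C2 \<times> C2" where
  "mmul M N = (lin M (fst N), lin M (snd N))"

definition mdet :: "C2 \<times> C2 \<Rightarrow> complex" where
  "mdet M = wedge (fst M) (snd M)"

text \<open>The adjugate, which is the inverse for determinant one. Being linear in the entries and
  norm preserving, it passes to limits without any division.\<close>

definition madj :: "C2 \<times> C2 \<Rightarrow> C2 \<times> C2" where
  "madj M = ((snd (snd M), - snd (fst M)), (- fst (snd M), fst (fst M)))"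

definition mone :: "C2 \<times> C2" where "mone = ((1, 0), (0, 1))"

lemmas C2_defs = wedge_def cscale_def lin_def mmul_def mdet_def madj_def mone_def

lemma lin_mmul: "lin (mmul M N) v = lin M (lin N v)"
  by (simp add: C2_defs algebra_simps)

lemma mmul_assoc: "mmul (mmul M N) L = mmul M (mmul N L)"
  by (simp add: C2_defs algebra_simps)

lemma mdet_mmul: "mdet (mmul M N) = mdet M * mdet N"
  by (simp add: C2_defs algebra_simps)

lemma mdet_madj [simp]: "mdet (madj M) = mdet M"
  by (simp add: C2_defs algebra_simps)

lemma mdet_mone [simp]: "mdet mone = 1"
  by (simp add: C2_defs)

lemma lin_mone [simp]: "lin mone v = v"
  by (simp add: C2_defs)

lemma mmul_mone [simp]: "mmul M mone = M" "mmul mone M = M"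
  by (cases M; cases "fst M"; cases "snd M"; simp add: C2_defs)+

lemma madj_mone [simp]: "madj mone = mone"
  by (simp add: C2_defs)

lemma madj_madj [simp]: "madj (madj M) = M"
  by (simp add: C2_defs)

lemma madj_mmul: "madj (mmul M N) = mmul (madj N) (madj M)"
  by (simp add: C2_defs algebra_simps)

lemma mmul_madj: "mdet M = 1 \<Longrightarrow> mmul (madj M) M = mone"
  and mmul_madj': "mdet M = 1 \<Longrightarrow> mmul M (madj M) = mone"
  by (simp_all add: C2_defs mult.commute)

lemma lin_madj: "mdet M = 1 \<Longrightarrow> lin (madj M) (lin M v) = v"
  and lin_madj': "mdet M = 1 \<Longrightarrow> lin M (lin (madj M) v) = v"
  by (simp_all add: mmul_madj mmul_madj' flip: lin_mmul)

lemma wedge_lin: "wedge (lin M u) (lin M v) = mdet M * wedge u v"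
  by (simp add: C2_defs algebra_simps)

lemma lin_cscale: "lin M (cscale c v) = cscale c (lin M v)"
  by (simp add: C2_defs algebra_simps)

lemma cscale_cscale [simp]: "cscale a (cscale b v) = cscale (a * b) v"
  by (simp add: cscale_def)

lemma wedge_cscale [simp]: "wedge (cscale c u) v = c * wedge u v"
  "wedge u (cscale c v) = c * wedge u v"
  by (simp_all add: C2_defs algebra_simps)

lemma wedge_self [simp]: "wedge u u = 0"
  by (simp add: wedge_def)

lemma wedge_zero [simp]: "wedge 0 u = 0" "wedge u 0 = 0"
  by (simp_all add: wedge_def)

lemma wedge_commute: "wedge u v = - wedge v u"
  by (simp add: wedge_def)

lemma cscale_eq_0_iff [simp]: "cscale c v = 0 \<longleftrightarrow> c = 0 \<or> v = 0"
  by (cases v) (auto simp: cscale_def zero_prod_def)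

lemma scaleR_eq_cscale: "r *\<^sub>R v = cscale (of_real r) v"
  by (cases v) (simp add: cscale_def scaleR_conv_of_real)

lemma wedge_eq_0D:
  assumes "wedge u v = 0" "v \<noteq> 0"
  obtains c where "u = cscale c v"
proof (cases "fst v = 0")
  case True
  then have "snd v \<noteq> 0" using assms(2) by (auto simp: prod_eq_iff)
  then have "u = cscale (snd u / snd v) v"
    using assms True by (auto simp: wedge_def cscale_def prod_eq_iff)
  then show ?thesis by (rule that)
next
  case False
  then have "u = cscale (fst u / fst v) v"
    using assms by (auto simp: wedge_def cscale_def prod_eq_iff field_simps)
  then show ?thesis by (rule that)
qed

lemma wedge_parallel:
  assumes "wedge u v = 0" "wedge w v = 0" "v \<noteq> 0"
  shows "wedge u w = 0"
  using wedge_eq_0D[OF assms(1,3)] wedge_eq_0D[OF assms(2,3)]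
  by (metis mult_zero_right wedge_cscale wedge_self)

lemma norm_cscale [simp]: "norm (cscale c v) = cmod c * norm v"
proof -
  have "norm (cscale c v) = sqrt ((cmod c)\<^sup>2 * ((cmod (fst v))\<^sup>2 + (cmod (snd v))\<^sup>2))"
    by (simp add: cscale_def norm_Pair norm_mult power_mult_distrib distrib_left)
  then show ?thesis
    by (cases v) (simp add: real_sqrt_mult norm_Pair)
qed

lemma norm_wedge_le: "cmod (wedge u v) \<le> norm u * norm v"
proof -
  have "cmod (wedge u v) \<le> cmod (fst u) * cmod (snd v) + cmod (snd u) * cmod (fst v)"
    by (metis norm_mult norm_triangle_ineq4 wedge_def)
  also have "\<dots> = (cmod (fst u), cmod (snd u)) \<bullet> (cmod (snd v), cmod (fst v))"
    by simp
  also have "\<dots> \<le> norm (cmod (fst u), cmod (snd u)) * norm (cmod (snd v), cmod (fst v))"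
    by (rule norm_cauchy_schwarz)
  also have "\<dots> = norm u * norm v"
    by (cases u; cases v) (simp add: norm_Pair add.commute)
  finally show ?thesis .
qed

lemma norm_lin_le: "norm (lin M v) \<le> norm M * norm v"
proof -
  have "norm (lin M v) \<le> cmod (fst v) * norm (fst M) + cmod (snd v) * norm (snd M)"
    unfolding lin_def by (metis norm_cscale norm_triangle_ineq)
  also have "\<dots> = (cmod (fst v), cmod (snd v)) \<bullet> (norm (fst M), norm (snd M))"
    by simp
  also have "\<dots> \<le> norm (cmod (fst v), cmod (snd v)) * norm (norm (fst M), norm (snd M))"
    by (rule norm_cauchy_schwarz)
  also have "\<dots> = norm M * norm v"
    by (cases v; cases M) (simp add: norm_Pair)
  finally show ?thesis .
qed

lemma norm_madj [simp]: "norm (madj M) = norm M"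
  by (cases M) (auto simp: madj_def norm_Pair)

lemma norm_mmul_le: "norm (mmul M N) \<le> norm M * norm N"
proof -
  have "norm (mmul M N) \<le> norm (norm M * norm (fst N), norm M * norm (snd N))"
    unfolding mmul_def norm_Pair
    by (intro real_sqrt_le_mono add_mono power_mono) (auto simp: norm_lin_le)
  also have "(norm M * norm (fst N), norm M * norm (snd N)) = norm M *\<^sub>R (norm (fst N), norm (snd N))"
    by simp
  also have "norm \<dots> = norm M * norm N"
    unfolding norm_scaleR by (cases N) (simp add: norm_Pair)
  finally show ?thesis .
qed

text \<open>The inverse \<open>madj M\<close> has the same norm as \<open>M\<close>, so one number
  controls both expansion and contraction.\<close>

lemma norm_lin_ge:
  assumes "mdet M = 1"
  shows "norm v \<le> norm M * norm (lin M v)"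
  using norm_lin_le[of "madj M" "lin M v"] lin_madj[OF assms, of v] by simp

text \<open>The longer column has at least half the norm, so a basis vector serves. The factor 2
  returns as \<open>2 ^ d\<close> in \<open>norm_power_le\<close>.\<close>

lemma unit_vector_norm_lin_ge:
  obtains e where "norm e = 1" "norm M \<le> 2 * norm (lin M e)"
proof -
  have "norm M \<le> norm (fst M) + norm (snd M)"
    by (metis norm_Pair_le prod.collapse)
  then consider "norm M \<le> 2 * norm (fst M)" | "norm M \<le> 2 * norm (snd M)"
    by linarith
  then show ?thesis
  proof cases
    case 1
    then show ?thesis by (intro that[of "(1, 0)"]) (auto simp: lin_def cscale_def norm_Pair zero_prod_def[symmetric])
  next
    case 2
    then show ?thesis by (intro that[of "(0, 1)"]) (auto simp: lin_def cscale_def norm_Pair zero_prod_def[symmetric])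
  qed
qed

lemma lin_eq_0_iff: "mdet M = 1 \<Longrightarrow> lin M v = 0 \<longleftrightarrow> v = 0"
  by (metis lin_madj cscale_eq_0_iff lin_cscale)

lemma tendsto_cscale [tendsto_intros]:
  "(f \<longlongrightarrow> a) F \<Longrightarrow> (g \<longlongrightarrow> b) F \<Longrightarrow> ((\<lambda>x. cscale (f x) (g x)) \<longlongrightarrow> cscale a b) F"
  unfolding cscale_def by (intro tendsto_intros)

lemma tendsto_wedge [tendsto_intros]:
  "(f \<longlongrightarrow> a) F \<Longrightarrow> (g \<longlongrightarrow> b) F \<Longrightarrow> ((\<lambda>x. wedge (f x) (g x)) \<longlongrightarrow> wedge a b) F"
  unfolding wedge_def by (intro tendsto_intros)

lemma tendsto_lin [tendsto_intros]:
  "(f \<longlongrightarrow> a) F \<Longrightarrow> (g \<longlongrightarrow> b) F \<Longrightarrow> ((\<lambda>x. lin (f x) (g x)) \<longlongrightarrow> lin a b) F"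
  unfolding lin_def by (intro tendsto_intros)

lemma tendsto_madj [tendsto_intros]:
  "(f \<longlongrightarrow> a) F \<Longrightarrow> ((\<lambda>x. madj (f x)) \<longlongrightarrow> madj a) F"
  unfolding madj_def by (intro tendsto_intros)

lemma tendsto_mdet [tendsto_intros]:
  "(f \<longlongrightarrow> a) F \<Longrightarrow> ((\<lambda>x. mdet (f x)) \<longlongrightarrow> mdet a) F"
  unfolding mdet_def by (intro tendsto_intros)

lemma lin_scaleR_left: "lin (r *\<^sub>R M) v = r *\<^sub>R lin M v"
  by (simp add: lin_def scaleR_eq_cscale cscale_def algebra_simps)

lemma mdet_scaleR: "mdet (r *\<^sub>R M) = (of_real r)\<^sup>2 * mdet M"
  by (simp add: mdet_def scaleR_eq_cscale power2_eq_square)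

text \<open>Rescaled to norm 1, the matrices accumulate at a matrix of rank one.\<close>

lemma blowup_limit:
  assumes "ultra F" "\<And>k. mdet (D k) = 1" "filterlim (\<lambda>k. norm (D k)) at_top F"
  obtains a b :: C2 and r :: "'k \<Rightarrow> real"
  where "a \<noteq> 0" "b \<noteq> 0" "\<And>k. r k > 0"
    "\<And>u U. (u \<longlongrightarrow> U) F \<Longrightarrow> ((\<lambda>k. r k *\<^sub>R lin (D k) (u k)) \<longlongrightarrow> cscale (wedge U b) a) F"
proof -
  define r where "r k = 1 / norm (D k)" for k
  have D0: "D k \<noteq> 0" for k
    using assms(2)[of k] by (auto simp: mdet_def)
  have n1: "norm (r k *\<^sub>R D k) = 1" for k
    using D0[of k] by (simp add: r_def)
  obtain L where L: "L \<in> sphere 0 1" "((\<lambda>k. r k *\<^sub>R D k) \<longlongrightarrow> L) F"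
    by (rule ultra_compact[OF assms(1), of "sphere 0 1" "\<lambda>k. r k *\<^sub>R D k"]) (use n1 in auto)
  have "((\<lambda>k. mdet (r k *\<^sub>R D k)) \<longlongrightarrow> mdet L) F"
    by (intro tendsto_intros L)
  moreover have "((\<lambda>k. mdet (r k *\<^sub>R D k)) \<longlongrightarrow> 0) F"
  proof -
    have "(r \<longlongrightarrow> 0) F"
      unfolding r_def using tendsto_divide_0[OF tendsto_const, of "\<lambda>k. norm (D k)" F]
        assms(3) filterlim_at_top_imp_at_infinity by blast
    then have "((\<lambda>k. (of_real (r k))\<^sup>2 :: complex) \<longlongrightarrow> (of_real 0)\<^sup>2) F"
      by (intro tendsto_intros)
    then show ?thesis by (simp add: mdet_scaleR assms(2))
  qed
  ultimately have det0: "mdet L = 0"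
    using tendsto_unique ultra_not_bot[OF assms(1)] by blast
  have "L \<noteq> 0" using L(1) by auto
  \<comment> \<open>A nonzero singular matrix has rank one: \<open>b\<close> spans its kernel and
    \<open>a\<close> its image.\<close>
  have "\<exists>a b. a \<noteq> 0 \<and> b \<noteq> 0 \<and> (\<forall>v. lin L v = cscale (wedge v b) a)"
  proof (cases "fst L = 0")
    case True
    then have "snd L \<noteq> 0" using \<open>L \<noteq> 0\<close> by (auto simp: prod_eq_iff)
    then have "snd L \<noteq> 0 \<and> (- 1, 0) \<noteq> (0 :: C2) \<and> (\<forall>v. lin L v = cscale (wedge v (- 1, 0)) (snd L))"
      using True by (auto simp: lin_def wedge_def cscale_def zero_prod_def)
    then show ?thesis by blast
  next
    case False
    obtain c where c: "snd L = cscale c (fst L)"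
      using wedge_eq_0D[of "snd L" "fst L"] det0 False wedge_commute[of "fst L" "snd L"] by (auto simp: mdet_def)
    have "fst L \<noteq> 0 \<and> (- c, 1) \<noteq> (0 :: C2) \<and> (\<forall>v. lin L v = cscale (wedge v (- c, 1)) (fst L))"
      using False by (auto simp: lin_def c wedge_def cscale_def zero_prod_def algebra_simps)
    then show ?thesis by blast
  qed
  then obtain a b where ab: "a \<noteq> 0" "b \<noteq> 0" "\<And>v. lin L v = cscale (wedge v b) a" by blast
  show ?thesis
  proof (rule that[OF ab(1,2), of r])
    show "r k > 0" for k using D0 by (simp add: r_def)
    fix u and U :: C2 assume "(u \<longlongrightarrow> U) F"
    from tendsto_lin[OF L(2) this]
    show "((\<lambda>k. r k *\<^sub>R lin (D k) (u k)) \<longlongrightarrow> cscale (wedge U b) a) F"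
      by (simp add: lin_scaleR_left ab(3))
  qed
qed

section \<open>Binary forms\<close>

declare split_paired_All [simp del] split_paired_Ex [simp del]

definition hform :: "nat \<Rightarrow> (nat \<Rightarrow> complex) \<Rightarrow> C2 \<Rightarrow> complex" where
  "hform d c v = (\<Sum>i\<le>d. c i * fst v ^ i * snd v ^ (d - i))"

definition pform :: "nat \<Rightarrow> (nat \<Rightarrow> complex) \<Rightarrow> (nat \<Rightarrow> complex) \<Rightarrow> C2 \<Rightarrow> C2" where
  "pform d p q v = (hform d p v, hform d q v)"

text \<open>For pairs of forms this says that their quotient is nonconstant; common factors, hence
  holes, are allowed.\<close>

definition nondeg :: "(C2 \<Rightarrow> C2) \<Rightarrow> bool" where
  "nondeg G \<longleftrightarrow> (\<exists>v w. wedge (G v) (G w) \<noteq> 0)"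

definition nohole :: "(C2 \<Rightarrow> C2) \<Rightarrow> bool" where
  "nohole G \<longleftrightarrow> (\<forall>v. v \<noteq> 0 \<longrightarrow> G v \<noteq> 0)"

lemma hform_cscale: "hform d c (cscale t v) = t ^ d * hform d c v"
proof -
  have "c i * (t * fst v) ^ i * (t * snd v) ^ (d - i) = t ^ d * (c i * fst v ^ i * snd v ^ (d - i))"
    if "i \<le> d" for i
  proof -
    have "t ^ d = t ^ i * t ^ (d - i)"
      using that by (simp flip: power_add)
    then show ?thesis by (simp add: power_mult_distrib mult_ac)
  qed
  then show ?thesis
    unfolding hform_def sum_distrib_left by (intro sum.cong) (auto simp: cscale_def)
qed

lemma pform_cscale: "pform d p q (cscale t v) = cscale (t ^ d) (pform d p q v)"
  unfolding pform_def hform_cscale by (simp add: cscale_def)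

lemma hform_linear:
  "hform d (\<lambda>i. a * p i + b * q i) v = a * hform d p v + b * hform d q v"
  by (simp add: hform_def sum_distrib_left sum.distrib algebra_simps)

lemma wedge_pform: "wedge (pform d p q v) s = hform d (\<lambda>i. snd s * p i + (- fst s) * q i) v"
  unfolding hform_linear by (simp add: wedge_def pform_def)

lemma lin_pform:
  "lin M (pform d p q v) =
     pform d (\<lambda>i. fst (fst M) * p i + fst (snd M) * q i) (\<lambda>i. snd (fst M) * p i + snd (snd M) * q i) v"
  unfolding pform_def hform_linear by (simp add: lin_def cscale_def mult.commute)

lemma hform_affine: "hform d c (z, 1) = (\<Sum>i\<le>d. c i * z ^ i)"
  by (simp add: hform_def)

lemma hform_infty: "hform d c (1, 0) = c d"
proof -
  have "hform d c (1, 0) = (\<Sum>i\<le>d. if i = d then c d else 0)"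
    unfolding hform_def by (intro sum.cong) auto
  then show ?thesis by simp
qed

lemma hform_eq_0_iff: "(\<forall>v. hform d c v = 0) \<longleftrightarrow> (\<forall>i\<le>d. c i = 0)"
proof
  assume "\<forall>v. hform d c v = 0"
  then have "\<forall>z. (\<Sum>i\<le>d. c i * z ^ i) = 0"
    unfolding hform_affine[symmetric] by blast
  then show "\<forall>i\<le>d. c i = 0"
    using polyfun_eq_0[where c = c and n = d] by blast
qed (simp add: hform_def)

lemma wedge_pform_pform:
  "wedge (pform d p q v) (pform d p q w) =
     (\<Sum>i\<le>d. \<Sum>j\<le>d. (p i * q j - q i * p j) * (fst v ^ i * snd v ^ (d - i) * fst w ^ j * snd w ^ (d - j)))"
  unfolding wedge_def pform_def hform_def fst_conv snd_conv sum_product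
  by (simp add: algebra_simps flip: sum_subtractf)

text \<open>The minors are the coefficients of \<open>wedge (G v) (G w)\<close> as a form in
  \<open>v\<close> and \<open>w\<close>, so nondegeneracy is linear independence of the two
  coefficient vectors.\<close>

lemma nondeg_pform_iff:
  "nondeg (pform d p q) \<longleftrightarrow> (\<exists>i\<le>d. \<exists>j\<le>d. p i * q j - p j * q i \<noteq> 0)"
proof
  assume "nondeg (pform d p q)"
  then obtain v w where "wedge (pform d p q v) (pform d p q w) \<noteq> 0"
    by (auto simp: nondeg_def)
  then show "\<exists>i\<le>d. \<exists>j\<le>d. p i * q j - p j * q i \<noteq> 0"
    by (rule contrapos_np) (auto simp: wedge_pform_pform mult.commute intro!: sum.neutral)
next
  assume "\<exists>i\<le>d. \<exists>j\<le>d. p i * q j - p j * q i \<noteq> 0"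
  then obtain i j where ij: "i \<le> d" "j \<le> d" "p i * q j - p j * q i \<noteq> 0" by blast
  show "nondeg (pform d p q)"
  proof (rule ccontr)
    assume "\<not> nondeg (pform d p q)"
    then have *: "wedge (pform d p q v) (pform d p q w) = 0" for v w
      by (simp add: nondeg_def)
    have "hform d q w * p i + - hform d p w * q i = 0" for w
      using *[of _ w] hform_eq_0_iff[of d "\<lambda>i. hform d q w * p i + (- hform d p w) * q i"] ij(1)
      unfolding wedge_pform by (simp add: pform_def)
    then have "hform d (\<lambda>j. p i * q j + (- q i) * p j) w = 0" for w
      unfolding hform_linear by (simp add: algebra_simps)
    then have "p i * q j + (- q i) * p j = 0"
      using hform_eq_0_iff[of d "\<lambda>j. p i * q j + (- q i) * p j"] ij(2) by blast
    with ij(3) show False by (simp add: algebra_simps)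
  qed
qed

lemma hform_zeros:
  assumes "hform d c v0 \<noteq> 0"
  obtains S where "finite S" "0 \<notin> S" "\<And>v. v \<noteq> 0 \<Longrightarrow> hform d c v = 0 \<Longrightarrow> \<exists>s\<in>S. wedge v s = 0"
proof -
  obtain i where i: "i \<le> d" "c i \<noteq> 0"
    using assms hform_eq_0_iff by blast
  \<comment> \<open>The point at infinity is put in whether or not it is a zero: the set only has to
    cover the zeros.\<close>
  let ?S = "insert (1, 0) ((\<lambda>z. (z, 1)) ` {z. (\<Sum>i\<le>d. c i * z ^ i) = 0}) :: C2 set"
  show ?thesis
  proof (rule that[of ?S])
    show "finite ?S"
      using Transcendental.polyfun_rootbound[where c = c and k = i and n = d] i by (auto simp: conj_commute)
    show "0 \<notin> ?S" by (auto simp: zero_prod_def)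
    fix v assume v: "v \<noteq> 0" "hform d c v = 0"
    show "\<exists>s\<in>?S. wedge v s = 0"
    proof (cases "snd v = 0")
      case True
      then show ?thesis by (auto simp: wedge_def)
    next
      case False
      have "cscale (1 / snd v) v = (fst v / snd v, 1)"
        using False by (simp add: cscale_def)
      then have "(\<Sum>i\<le>d. c i * (fst v / snd v) ^ i) = 0"
        using v(2) hform_cscale[of d c "1 / snd v" v] by (simp add: hform_affine)
      then show ?thesis using False
        by (intro bexI[of _ "(fst v / snd v, 1)"]) (auto simp: wedge_def)
    qed
  qed
qed

text \<open>The zeros of \<open>wedge (G v) s\<close> are the preimages of the line of
  \<open>s\<close> together with the holes of \<open>G\<close>. The form does not vanish identically
  because a nondegenerate pair takes values outside any single line.\<close>

lemma nondeg_zeros: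
  assumes "nondeg (pform d p q)" "s \<noteq> 0"
  obtains S where "finite S" "0 \<notin> S"
    "\<And>v. v \<noteq> 0 \<Longrightarrow> wedge (pform d p q v) s = 0 \<Longrightarrow> \<exists>t\<in>S. wedge v t = 0"
proof -
  have "\<exists>v. wedge (pform d p q v) s \<noteq> 0"
  proof (rule ccontr)
    assume "\<not> ?thesis"
    then have z: "wedge (pform d p q v) s = 0" for v by blast
    have "wedge (pform d p q v) (pform d p q w) = 0" for v w
      by (rule wedge_parallel[OF z z assms(2)])
    then show False using assms(1) by (simp add: nondeg_def)
  qed
  then obtain v0 where v0: "hform d (\<lambda>i. snd s * p i + (- fst s) * q i) v0 \<noteq> 0"
    unfolding wedge_pform by blast
  obtain S where "finite S" "0 \<notin> S"
    "\<And>v. v \<noteq> 0 \<Longrightarrow> hform d (\<lambda>i. snd s * p i + (- fst s) * q i) v = 0 \<Longrightarrow> \<exists>t\<in>S. wedge v t = 0"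
    by (rule hform_zeros[OF v0]) blast
  then show ?thesis
    by (rule that[unfolded wedge_pform])
qed

section \<open>Linear substitutions in binary forms\<close>

definition is_form :: "nat \<Rightarrow> (C2 \<Rightarrow> complex) \<Rightarrow> bool" where
  "is_form d \<phi> \<longleftrightarrow> (\<exists>c. \<phi> = hform d c)"

lemma is_form_add:
  assumes "is_form d \<phi>" "is_form d \<psi>"
  shows "is_form d (\<lambda>v. \<phi> v + \<psi> v)"
proof -
  obtain p q where "\<phi> = hform d p" "\<psi> = hform d q" using assms by (auto simp: is_form_def)
  then have "(\<lambda>v. \<phi> v + \<psi> v) = hform d (\<lambda>i. 1 * p i + 1 * q i)"
    unfolding hform_linear by auto
  then show ?thesis by (auto simp: is_form_def)
qed

lemma is_form_cmult:
  assumes "is_form d \<phi>"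
  shows "is_form d (\<lambda>v. a * \<phi> v)"
proof -
  obtain p where "\<phi> = hform d p" using assms by (auto simp: is_form_def)
  then have "(\<lambda>v. a * \<phi> v) = hform d (\<lambda>i. a * p i + 0 * p i)"
    unfolding hform_linear by auto
  then show ?thesis by (auto simp: is_form_def)
qed

lemma is_form_sum:
  assumes "finite I" "\<And>i. i \<in> I \<Longrightarrow> is_form d (\<phi> i)"
  shows "is_form d (\<lambda>v. \<Sum>i\<in>I. \<phi> i v)"
  using assms
proof (induction rule: finite_induct)
  case empty
  have "(\<lambda>v. 0) = hform d (\<lambda>_. 0)" by (auto simp: hform_def)
  then show ?case by (auto simp: is_form_def)
qed (auto intro: is_form_add)

lemma is_form_mult_fst: "is_form d \<phi> \<Longrightarrow> is_form (Suc d) (\<lambda>v. fst v * \<phi> v)"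
proof -
  assume "is_form d \<phi>"
  then obtain c where c: "\<phi> = hform d c" by (auto simp: is_form_def)
  have "fst v * hform d c v = hform (Suc d) (\<lambda>i. if i = 0 then 0 else c (i - 1)) v" for v
    unfolding hform_def sum.atMost_Suc_shift by (simp add: sum_distrib_left mult_ac)
  then show ?thesis unfolding c is_form_def by blast
qed

lemma is_form_mult_snd: "is_form d \<phi> \<Longrightarrow> is_form (Suc d) (\<lambda>v. snd v * \<phi> v)"
proof -
  assume "is_form d \<phi>"
  then obtain c where c: "\<phi> = hform d c" by (auto simp: is_form_def)
  have "snd v * hform d c v = hform (Suc d) (\<lambda>i. if i \<le> d then c i else 0) v" for v
    unfolding hform_def sum.atMost_Suc
    by (simp add: sum_distrib_left) (intro sum.cong, auto simp: Suc_diff_le)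
  then show ?thesis unfolding c is_form_def by blast
qed

lemma is_form_mult_linear:
  "is_form d \<phi> \<Longrightarrow> is_form (Suc d) (\<lambda>v. (a * fst v + b * snd v) * \<phi> v)"
  using is_form_add[OF is_form_cmult[OF is_form_mult_fst, of d \<phi> a] is_form_cmult[OF is_form_mult_snd, of d \<phi> b]]
  by (simp add: algebra_simps)

lemma is_form_power_mult:
  "is_form d \<phi> \<Longrightarrow> is_form (n + d) (\<lambda>v. (a * fst v + b * snd v) ^ n * \<phi> v)"
proof (induction n)
  case (Suc n)
  from is_form_mult_linear[OF Suc.IH[OF Suc.prems], of a b] show ?case
    by (simp add: mult.assoc)
qed simp

lemma is_form_lin:
  assumes "is_form d \<phi>"
  shows "is_form d (\<lambda>v. \<phi> (lin M v))"
proof -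
  obtain c where c: "\<phi> = hform d c" using assms by (auto simp: is_form_def)
  obtain a b a' b' where M: "M = ((a, a'), (b, b'))" by (metis surj_pair)
  have one: "is_form 0 (\<lambda>v. 1)"
    unfolding is_form_def by (intro exI[of _ "\<lambda>_. 1"]) (auto simp: hform_def)
  have "is_form d (\<lambda>v. c i * ((a * fst v + b * snd v) ^ i * (a' * fst v + b' * snd v) ^ (d - i)))" if "i \<le> d" for i
    using is_form_power_mult[OF is_form_power_mult[OF one, of "d - i" a' b'], of i a b] that
    by (intro is_form_cmult) simp
  then have "is_form d (\<lambda>v. \<Sum>i\<le>d. c i * ((a * fst v + b * snd v) ^ i * (a' * fst v + b' * snd v) ^ (d - i)))"
    by (intro is_form_sum) auto
  moreover have "(\<lambda>v. \<phi> (lin M v)) =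
      (\<lambda>v. \<Sum>i\<le>d. c i * ((a * fst v + b * snd v) ^ i * (a' * fst v + b' * snd v) ^ (d - i)))"
    by (auto simp: c M hform_def lin_def cscale_def mult_ac)
  ultimately show ?thesis by simp
qed

lemma pform_lin:
  obtains p' q' where "\<And>v. pform d p q (lin M v) = pform d p' q' v"
proof -
  have "is_form d (hform d p)" "is_form d (hform d q)" by (auto simp: is_form_def)
  from this[THEN is_form_lin, of M] obtain p' q'
    where "(\<lambda>v. hform d p (lin M v)) = hform d p'" "(\<lambda>v. hform d q (lin M v)) = hform d q'"
    unfolding is_form_def by blast
  then show ?thesis by (intro that[of p' q']) (simp add: pform_def fun_eq_iff)
qed

text \<open>The matrix is the inverse of a largest \<open>2 \<times> 2\<close> minor of the coefficients.\<close>

lemma normalise_pform: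
  assumes "nondeg (pform d p q)"
  obtains B l p' q' where "mdet B = 1" "l \<noteq> 0"
    "\<And>v. pform d p' q' v = cscale l (lin B (pform d p q v))"
    "\<And>i. i \<le> d \<Longrightarrow> cmod (p' i) \<le> 1 \<and> cmod (q' i) \<le> 1"
    "\<exists>i\<le>d. \<exists>j\<le>d. p' i * q' j - p' j * q' i = 1"
proof -
  define m where "m i j = p i * q j - p j * q i" for i j
  let ?f = "\<lambda>(i, j). cmod (m i j)"
  have "finite (?f ` ({..d} \<times> {..d}))" "?f ` ({..d} \<times> {..d}) \<noteq> {}" by auto
  from Max_in[OF this] obtain i j where ij: "i \<le> d" "j \<le> d"
    and "Max (?f ` ({..d} \<times> {..d})) = cmod (m i j)" by (auto simp del: Max_in)
  then have mx: "cmod (m a b) \<le> cmod (m i j)" if "a \<le> d" "b \<le> d" for a b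
    using that by (metis (no_types, lifting) Max_ge SigmaI \<open>finite _\<close> atMost_iff case_prod_conv imageI)
  have m0: "m i j \<noteq> 0"
    using assms mx unfolding nondeg_pform_iff m_def[symmetric] by force
  \<comment> \<open>The inverse of the chosen minor has determinant \<open>1 / m i j\<close>;
    dividing by its square root makes the determinant one, and the scalar \<open>l = s\<close>
    restores the normalisation.\<close>
  define s where "s = csqrt (1 / m i j)"
  have s: "s * s = 1 / m i j" "s \<noteq> 0"
    using m0 power2_csqrt[of "1 / m i j"] unfolding s_def power2_eq_square by auto
  define B where "B = ((q j / m i j / s, - q i / m i j / s), (- p j / m i j / s, p i / m i j / s))"
  \<comment> \<open>The coefficient pairs at \<open>i\<close> and \<open>j\<close> become
    \<open>(1, 0)\<close> and \<open>(0, 1)\<close>; all others are ratios of minors, bounded by one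
    through maximality.\<close>
  let ?p = "\<lambda>l. m l j / m i j" and ?q = "\<lambda>l. m i l / m i j"
  show ?thesis
  proof (rule that[of B s ?p ?q])
    have "mdet B = m i j / (m i j * m i j * (s * s))"
      unfolding B_def mdet_def wedge_def fst_conv snd_conv
      using s(2) m0 by (simp add: divide_simps) (simp add: m_def algebra_simps)
    then show "mdet B = 1" using m0 unfolding s(1) by simp
    show "s \<noteq> 0" by (fact s)
    show "pform d ?p ?q v = cscale s (lin B (pform d p q v))" for v
    proof -
      have "?p = (\<lambda>l. (q j / m i j) * p l + (- p j / m i j) * q l)"
        "?q = (\<lambda>l. (- q i / m i j) * p l + (p i / m i j) * q l)"
        by (auto simp: m_def diff_divide_distrib fun_eq_iff algebra_simps)
      then have "pform d ?p ?q v = ((q j / m i j) * hform d p v + (- p j / m i j) * hform d q v,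
            (- q i / m i j) * hform d p v + (p i / m i j) * hform d q v)"
        unfolding pform_def by (simp only: hform_linear)
      also have "\<dots> = cscale s (lin B (pform d p q v))"
        using s(2) by (simp add: B_def lin_def cscale_def pform_def algebra_simps add_divide_distrib)
      finally show ?thesis .
    qed
    show "cmod (?p l) \<le> 1 \<and> cmod (?q l) \<le> 1" if "l \<le> d" for l
      using mx[of l j] mx[of i l] that ij m0 by (simp add: norm_divide)
    show "\<exists>a\<le>d. \<exists>b\<le>d. ?p a * ?q b - ?p b * ?q a = 1"
      using ij m0 by (intro exI[of _ i] conjI exI[of _ j]) (auto simp: m_def)
  qed
qed

section \<open>Convergence of forms along an ultrafilter\<close>

definition forms_conv ::
    "nat \<Rightarrow> nat filter \<Rightarrow> (nat \<Rightarrow> C2 \<Rightarrow> C2) \<Rightarrow> (C2 \<Rightarrow> C2) \<Rightarrow> bool" where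
  "forms_conv d F g G \<longleftrightarrow> (\<exists>p q P Q. (\<forall>k v. g k v = pform d (p k) (q k) v) \<and> G = pform d P Q \<and>
     (\<forall>i\<le>d. ((\<lambda>k. p k i) \<longlongrightarrow> P i) F \<and> ((\<lambda>k. q k i) \<longlongrightarrow> Q i) F))"

lemma tendsto_hform:
  assumes "\<And>i. i \<le> d \<Longrightarrow> ((\<lambda>k. p k i) \<longlongrightarrow> P i) F" "(u \<longlongrightarrow> U) F"
  shows "((\<lambda>k. hform d (p k) (u k)) \<longlongrightarrow> hform d P U) F"
  unfolding hform_def using assms by (intro tendsto_intros) auto

text \<open>The argument may move with \<open>k\<close>. Together with
  \<open>ultra_uniform_less\<close> this turns convergence of coefficients into estimates uniform on
  compact sets.\<close>

lemma forms_conv_tendsto: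
  assumes "forms_conv d F g G" "(u \<longlongrightarrow> U) F"
  shows "((\<lambda>k. g k (u k)) \<longlongrightarrow> G U) F"
proof -
  obtain p q P Q where *: "\<And>k v. g k v = pform d (p k) (q k) v" "G = pform d P Q"
     "\<And>i. i \<le> d \<Longrightarrow> ((\<lambda>k. p k i) \<longlongrightarrow> P i) F" "\<And>i. i \<le> d \<Longrightarrow> ((\<lambda>k. q k i) \<longlongrightarrow> Q i) F"
    using assms(1) unfolding forms_conv_def by blast
  show ?thesis
    unfolding *(1,2) pform_def using assms(2) *(3,4) by (intro tendsto_Pair tendsto_hform) auto
qed

lemma forms_conv_cscale:
  assumes "forms_conv d F g G"
  shows "g k (cscale t v) = cscale (t ^ d) (g k v)" "G (cscale t v) = cscale (t ^ d) (G v)"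
  using assms unfolding forms_conv_def by (auto simp: pform_cscale)

lemma forms_conv_continuous:
  assumes "forms_conv d F g G"
  shows "isCont G v"
proof -
  obtain P Q where "G = pform d P Q" using assms unfolding forms_conv_def by blast
  then show ?thesis
    unfolding isCont_def pform_def by (auto intro!: tendsto_Pair tendsto_hform)
qed

lemma forms_conv_scaleR:
  assumes "forms_conv d F g G"
  shows "g k (r *\<^sub>R v) = r ^ d *\<^sub>R g k v"
  using forms_conv_cscale(1)[OF assms, of k "of_real r" v] by (simp add: scaleR_eq_cscale)

text \<open>Points of \<open>K\<close> violating the bound would converge along the ultrafilter to a
  point of \<open>K\<close>, where the limit \<open>H\<close> violates it too.\<close>

lemma ultra_uniform_less:
  fixes h :: "'k \<Rightarrow> 'b :: topological_space \<Rightarrow> real"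
  assumes "ultra F" "compact K" "\<And>x. x \<in> K \<Longrightarrow> H x < c"
    and "\<And>u U. (u \<longlongrightarrow> U) F \<Longrightarrow> ((\<lambda>k. h k (u k)) \<longlongrightarrow> H U) F"
  shows "eventually (\<lambda>k. \<forall>v\<in>K. h k v < c) F"
proof (rule ccontr)
  assume "\<not> ?thesis"
  then have ev: "eventually (\<lambda>k. \<exists>v\<in>K. c \<le> h k v) F"
    using ultra_not_eventually[OF assms(1)] by (simp add: not_less)
  define u where "u k = (SOME v. v \<in> K \<and> c \<le> h k v)" for k
  have u: "eventually (\<lambda>k. u k \<in> K \<and> c \<le> h k (u k)) F"
    using ev
  proof eventually_elim
    case (elim k)
    then show ?case
      using someI_ex[of "\<lambda>v. v \<in> K \<and> c \<le> h k v"] unfolding u_def by blast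
  qed
  then have "eventually (\<lambda>k. u k \<in> K) F" by eventually_elim simp
  with assms(1,2) obtain U where U: "U \<in> K" "(u \<longlongrightarrow> U) F" by (rule ultra_compact)
  have "c \<le> H U"
    using u by (intro tendsto_lowerbound[OF assms(4)[OF U(2)]] ultra_not_bot[OF assms(1)]) (auto elim: eventually_mono)
  then show False using assms(3)[OF U(1)] by simp
qed

lemma unit_scaling:
  assumes "v \<noteq> (0 :: C2)"
  obtains u where "norm u = 1" "v = norm v *\<^sub>R u"
  using assms by (intro that[of "v /\<^sub>R norm v"]) auto

lemma forms_conv_bounded:
  assumes "ultra F" "forms_conv d F g G" "d > 0"
  obtains K where "K > 0" "eventually (\<lambda>k. \<forall>v. norm (g k v) \<le> K * norm v ^ d) F"
proof -
  have "continuous_on (sphere 0 1) (\<lambda>v. norm (G v))"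
    using forms_conv_continuous[OF assms(2)]
    by (intro continuous_intros continuous_at_imp_continuous_on) auto
  then have "compact ((\<lambda>v. norm (G v)) ` sphere (0::C2) 1)"
    by (intro compact_continuous_image) auto
  then obtain K where K: "K > 0" "\<And>v. norm v = 1 \<Longrightarrow> norm (G v) \<le> K"
    by (auto dest!: compact_imp_bounded simp: bounded_pos)
  have "eventually (\<lambda>k. \<forall>v\<in>sphere 0 1. norm (g k v) < K + 1) F"
    by (rule ultra_uniform_less[where H = "\<lambda>v. norm (G v)"])
       (use assms(1) K(2) in \<open>force intro: tendsto_norm forms_conv_tendsto[OF assms(2)]\<close>)+
  then have "eventually (\<lambda>k. \<forall>v. norm (g k v) \<le> (K + 1) * norm v ^ d) F"
  proof eventually_elim
    case (elim k)
    have "norm (g k v) \<le> (K + 1) * norm v ^ d" for v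
    proof (cases "v = 0")
      case True
      then show ?thesis
        using forms_conv_scaleR[OF assms(2), of k 0 v] assms(3) by (simp add: power_0_left)
    next
      case False
      then obtain u where u: "norm u = 1" "v = norm v *\<^sub>R u" by (rule unit_scaling)
      have "norm (g k v) = norm v ^ d * norm (g k u)"
        by (subst u(2), subst forms_conv_scaleR[OF assms(2)]) (simp add: norm_power)
      also have "\<dots> \<le> norm v ^ d * (K + 1)"
        using elim u(1) by (intro mult_left_mono) (auto intro: less_imp_le)
      finally show ?thesis by (simp add: mult.commute)
    qed
    then show ?case by blast
  qed
  then show ?thesis using that[of "K + 1"] K(1) by simp
qed

text \<open>Without holes \<open>G\<close> has a positive minimum on the unit sphere; half of it
  survives for \<open>g k\<close>, and homogeneity extends the bound to all vectors.\<close>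

lemma forms_conv_bounded_below:
  assumes "ultra F" "forms_conv d F g G" "nohole G" "d > 0"
  obtains c where "c > 0" "eventually (\<lambda>k. \<forall>v. c * norm v ^ d \<le> norm (g k v)) F"
proof -
  have "continuous_on (sphere 0 1) (\<lambda>v. norm (G v))"
    using forms_conv_continuous[OF assms(2)]
    by (intro continuous_intros continuous_at_imp_continuous_on) auto
  moreover have "(1, 0) \<in> sphere (0 :: C2) 1" by (simp add: norm_Pair)
  ultimately obtain x where x: "norm x = 1" "\<And>v. norm v = 1 \<Longrightarrow> norm (G x) \<le> norm (G v)"
    using continuous_attains_inf[of "sphere (0::C2) 1" "\<lambda>v. norm (G v)"] by auto
  define c where "c = norm (G x)"
  have "x \<noteq> 0" using x(1) by auto
  then have c: "c > 0" using assms(3) by (auto simp: c_def nohole_def)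
  have "eventually (\<lambda>k. \<forall>v\<in>sphere 0 1. - norm (g k v) < - (c / 2)) F"
  proof (rule ultra_uniform_less[where H = "\<lambda>v. - norm (G v)"])
    show "- norm (G v) < - (c / 2)" if "v \<in> sphere 0 1" for v
    proof -
      have "c \<le> norm (G v)" using x(2)[of v] that by (simp add: c_def)
      then show ?thesis using c by simp
    qed
  qed (use assms(1) in \<open>auto intro!: tendsto_minus tendsto_norm forms_conv_tendsto[OF assms(2)]\<close>)
  then have "eventually (\<lambda>k. \<forall>v. c / 2 * norm v ^ d \<le> norm (g k v)) F"
  proof eventually_elim
    case (elim k)
    have "c / 2 * norm v ^ d \<le> norm (g k v)" for v
    proof (cases "v = 0")
      case True
      then show ?thesis using assms(4) by (simp add: power_0_left)
    next
      case False
      then obtain u where u: "norm u = 1" "v = norm v *\<^sub>R u" by (rule unit_scaling)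
      have "norm v ^ d * (c / 2) \<le> norm v ^ d * norm (g k u)"
        using elim u(1) by (intro mult_left_mono) (auto intro: less_imp_le)
      also have "\<dots> = norm (g k v)"
        by (subst (2) u(2), subst forms_conv_scaleR[OF assms(2)]) (simp add: norm_power)
      finally show ?thesis by (simp add: mult.commute)
    qed
    then show ?case by blast
  qed
  then show ?thesis using that[of "c / 2"] c by simp
qed

text \<open>Even if the maps converge to a constant, a change of coordinates in the target recovers
  a nonconstant limit. This produces the next level of the tower.\<close>

lemma forms_conv_extract:
  assumes "ultra F" "\<And>k. nondeg (h k)" "\<And>k. \<exists>p q. h k = pform d p q"
  obtains B l G where "\<And>k. mdet (B k) = 1" "\<And>k. l k \<noteq> 0"
    "forms_conv d F (\<lambda>k v. cscale (l k) (lin (B k) (h k v))) G" "nondeg G"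
proof -
  have "\<exists>B l p' q'. mdet B = 1 \<and> l \<noteq> 0 \<and> (\<forall>v. pform d p' q' v = cscale l (lin B (h k v))) \<and>
      (\<forall>i\<le>d. cmod (p' i) \<le> 1 \<and> cmod (q' i) \<le> 1) \<and>
      (\<exists>i\<le>d. \<exists>j\<le>d. p' i * q' j - p' j * q' i = 1)" for k
  proof -
    obtain p q where h: "h k = pform d p q" using assms(3) by blast
    from normalise_pform[of d p q] assms(2)[of k] show ?thesis
      unfolding h by (metis (no_types, lifting))
  qed
  then obtain B l p q where *: "\<And>k. mdet (B k) = 1" "\<And>k. l k \<noteq> 0"
    "\<And>k v. pform d (p k) (q k) v = cscale (l k) (lin (B k) (h k v))"
    "\<And>k i. i \<le> d \<Longrightarrow> cmod (p k i) \<le> 1" "\<And>k i. i \<le> d \<Longrightarrow> cmod (q k i) \<le> 1"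
    "\<And>k. \<exists>i\<le>d. \<exists>j\<le>d. p k i * q k j - p k j * q k i = 1"
    by metis
  have lim1: "\<exists>x. (X \<longlongrightarrow> x) F" if "\<And>k. cmod (X k) \<le> 1" for X :: "nat \<Rightarrow> complex"
  proof -
    have "eventually (\<lambda>k. dist 0 (X k) \<le> 1) F" using that by simp
    with assms(1) obtain x where "(X \<longlongrightarrow> x) F" by (rule ultra_bounded)
    then show ?thesis by blast
  qed
  have "\<forall>i. \<exists>x. i \<le> d \<longrightarrow> ((\<lambda>k. p k i) \<longlongrightarrow> x) F"
    using lim1[of "\<lambda>k. p k i" for i] *(4) by blast
  then obtain P where P: "\<And>i. i \<le> d \<Longrightarrow> ((\<lambda>k. p k i) \<longlongrightarrow> P i) F"
    unfolding choice_iff by blast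
  have "\<forall>i. \<exists>x. i \<le> d \<longrightarrow> ((\<lambda>k. q k i) \<longlongrightarrow> x) F"
    using lim1[of "\<lambda>k. q k i" for i] *(5) by blast
  then obtain Q where Q: "\<And>i. i \<le> d \<Longrightarrow> ((\<lambda>k. q k i) \<longlongrightarrow> Q i) F"
    unfolding choice_iff by blast
  note PQ = P Q
  \<comment> \<open>The minor equal to one may change with \<open>k\<close>; the sum over all minors
    is at least one for every \<open>k\<close> and passes to the limit.\<close>
  have lim: "((\<lambda>k. \<Sum>i\<le>d. \<Sum>j\<le>d. cmod (p k i * q k j - p k j * q k i))
      \<longlongrightarrow> (\<Sum>i\<le>d. \<Sum>j\<le>d. cmod (P i * Q j - P j * Q i))) F"
    by (intro tendsto_intros PQ) auto
  have "1 \<le> (\<Sum>i\<le>d. \<Sum>j\<le>d. cmod (p k i * q k j - p k j * q k i))" for k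
  proof -
    obtain i j where ij: "i \<le> d" "j \<le> d" "p k i * q k j - p k j * q k i = 1" using *(6) by blast
    have "1 \<le> (\<Sum>j\<le>d. cmod (p k i * q k j - p k j * q k i))"
      using member_le_sum[of j "{..d}" "\<lambda>j. cmod (p k i * q k j - p k j * q k i)"] ij by simp
    also have "\<dots> \<le> (\<Sum>i\<le>d. \<Sum>j\<le>d. cmod (p k i * q k j - p k j * q k i))"
      using member_le_sum[of i "{..d}" "\<lambda>i. \<Sum>j\<le>d. cmod (p k i * q k j - p k j * q k i)"] ij
      by (simp add: sum_nonneg)
    finally show ?thesis .
  qed
  then have "1 \<le> (\<Sum>i\<le>d. \<Sum>j\<le>d. cmod (P i * Q j - P j * Q i))"
    by (intro tendsto_lowerbound[OF lim] ultra_not_bot[OF assms(1)]) simp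
  then have "\<exists>i\<le>d. \<exists>j\<le>d. P i * Q j - P j * Q i \<noteq> 0"
    by (rule contrapos_pp) auto
  then have "nondeg (pform d P Q)" by (simp add: nondeg_pform_iff)
  moreover have "forms_conv d F (\<lambda>k v. cscale (l k) (lin (B k) (h k v))) (pform d P Q)"
    unfolding forms_conv_def
    by (rule exI[of _ p], rule exI[of _ q], rule exI[of _ P], rule exI[of _ Q]) (use *(3) PQ in auto)
  ultimately show ?thesis using that *(1,2) by blast
qed

section \<open>Lifting rational maps to \<open>\<complex>\<^sup>2\<close>\<close>

definition rat_lift :: "complex poly fract \<Rightarrow> C2 \<Rightarrow> C2" where
  "rat_lift f = pform (rat_degree f) (coeff (rat_num f)) (coeff (rat_den f))"

text \<open>A homogeneous coordinate vector for each point. It jumps at infinity, so continuity is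
  derived only for functions that are constant on lines.\<close>

fun sg :: "rsphere \<Rightarrow> C2" where
  "sg (Fin z) = (z, 1)"
| "sg Infty = (1, 0)"

lemma sg_nonzero [simp]: "sg x \<noteq> 0"
  by (cases x) (auto simp: zero_prod_def)

lemma wedge_sg_eq_0_iff: "wedge (sg x) (sg y) = 0 \<longleftrightarrow> x = y"
  by (cases x; cases y) (auto simp: wedge_def)

lemma sg_representative:
  assumes "v \<noteq> 0"
  obtains c x where "c \<noteq> 0" "v = cscale c (sg x)"
proof (cases "snd v = 0")
  case True
  then have "fst v \<noteq> 0" using assms by (auto simp: prod_eq_iff)
  then show ?thesis
    using True by (intro that[of "fst v" Infty]) (auto simp: cscale_def prod_eq_iff)
next
  case False
  then show ?thesis
    by (intro that[of "snd v" "Fin (fst v / snd v)"]) (auto simp: cscale_def prod_eq_iff)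
qed

lemma hform_coeff:
  assumes "degree R \<le> d"
  shows "hform d (coeff R) (z, 1) = poly R z"
proof -
  have "(\<Sum>i\<le>d. coeff R i * z ^ i) = (\<Sum>i\<le>degree R. coeff R i * z ^ i)"
    using assms by (intro sum.mono_neutral_right) (auto simp: coeff_eq_0)
  then show ?thesis by (simp add: hform_affine poly_altdef)
qed

lemma rat_degree_ge: "degree (rat_num f) \<le> rat_degree f" "degree (rat_den f) \<le> rat_degree f"
  by (simp_all add: rat_degree_def)

lemma rat_den_nonzero [simp]: "rat_den f \<noteq> 0"
  by (simp add: rat_den_def)

lemma coprime_rat: "coprime (rat_num f) (rat_den f)"
  unfolding rat_num_def rat_den_def by (rule coprime_quot_of_fract)

lemma rat_lift_sg:
  "rat_lift f (sg (Fin z)) = (poly (rat_num f) z, poly (rat_den f) z)"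
  "rat_lift f (sg Infty) = (coeff (rat_num f) (rat_degree f), coeff (rat_den f) (rat_degree f))"
  using rat_degree_ge[of f] by (simp_all add: rat_lift_def pform_def hform_coeff hform_infty)

text \<open>At finite points this is coprimality; at infinity, one of the two polynomials attains
  the degree of \<open>f\<close>.\<close>

lemma rat_lift_sg_nonzero: "rat_lift f (sg x) \<noteq> 0"
proof (cases x)
  case (Fin z)
  have "\<not> (poly (rat_num f) z = 0 \<and> poly (rat_den f) z = 0)"
  proof
    assume "poly (rat_num f) z = 0 \<and> poly (rat_den f) z = 0"
    then have "[:- z, 1:] dvd rat_num f" "[:- z, 1:] dvd rat_den f"
      by (simp_all add: poly_eq_0_iff_dvd)
    then have "is_unit [:- z, 1:]"
      by (rule coprime_common_divisor[OF coprime_rat])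
    then show False by (simp add: is_unit_poly_iff)
  qed
  then show ?thesis unfolding Fin rat_lift_sg by (auto simp: zero_prod_def)
next
  case Infty
  have "coeff (rat_num f) (rat_degree f) \<noteq> 0 \<or> coeff (rat_den f) (rat_degree f) \<noteq> 0"
  proof (cases "degree (rat_num f) \<le> degree (rat_den f)")
    case True
    then show ?thesis by (simp add: rat_degree_def max_absorb2)
  next
    case False
    then have "rat_num f \<noteq> 0" by auto
    then show ?thesis using False by (simp add: rat_degree_def max_absorb1)
  qed
  then show ?thesis unfolding Infty rat_lift_sg by (auto simp: zero_prod_def)
qed

text \<open>One homogeneous equation replaces the case distinctions of \<open>rat_map\<close>: the
  lift sends \<open>sg x\<close> to a nonzero multiple of \<open>sg (rat_map f x)\<close>.\<close>

lemma rat_map_eq_iff: "rat_map f x = y \<longleftrightarrow> wedge (rat_lift f (sg x)) (sg y) = 0"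
proof -
  have "\<exists>c. c \<noteq> 0 \<and> rat_lift f (sg x) = cscale c (sg (rat_map f x))"
  proof (cases x)
    case (Fin z)
    show ?thesis
    proof (cases "poly (rat_den f) z = 0")
      case True
      then show ?thesis using rat_lift_sg_nonzero[of f x] unfolding Fin rat_lift_sg
        by (intro exI[of _ "poly (rat_num f) z"]) (auto simp: cscale_def zero_prod_def)
    next
      case False
      then show ?thesis unfolding Fin rat_lift_sg
        by (intro exI[of _ "poly (rat_den f) z"]) (auto simp: cscale_def)
    qed
  next
    case Infty
    show ?thesis
    proof (cases "coeff (rat_den f) (rat_degree f) = 0")
      case True
      then show ?thesis using rat_lift_sg_nonzero[of f x] unfolding Infty rat_lift_sg
        by (intro exI[of _ "coeff (rat_num f) (rat_degree f)"]) (auto simp: cscale_def zero_prod_def)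
    next
      case False
      then show ?thesis unfolding Infty rat_lift_sg
        by (intro exI[of _ "coeff (rat_den f) (rat_degree f)"]) (auto simp: cscale_def)
    qed
  qed
  then obtain c where "c \<noteq> 0" "rat_lift f (sg x) = cscale c (sg (rat_map f x))" by blast
  then show ?thesis by (simp add: wedge_sg_eq_0_iff)
qed

lemma fiber_poly_nonzero:
  assumes "rat_degree f > 0"
  shows "fiber_poly f y \<noteq> 0"
proof (cases y)
  case (Fin w)
  show ?thesis
  proof
    assume "fiber_poly f y = 0"
    then have eq: "rat_num f = smult w (rat_den f)" by (simp add: Fin)
    then have "rat_den f dvd rat_num f" by (simp add: dvd_smult)
    then have "is_unit (rat_den f)"
      by (rule coprime_common_divisor[OF coprime_rat]) simp
    then have "degree (rat_den f) = 0" by (auto simp: is_unit_poly_iff)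
    moreover from this have "degree (rat_num f) = 0" by (simp add: eq)
    ultimately show False using assms by (simp add: rat_degree_def)
  qed
qed simp

lemma degree_fiber_poly: "degree (fiber_poly f y) \<le> rat_degree f"
  by (cases y) (auto intro!: degree_diff_le order_trans[OF degree_smult_le] simp: rat_degree_ge)

lemma wedge_rat_lift:
  obtains c where "c \<noteq> 0"
    "\<And>v. wedge (rat_lift f v) (sg y) = c * hform (rat_degree f) (coeff (fiber_poly f y)) v"
proof (cases y)
  case (Fin w)
  have "(\<lambda>i. 1 * coeff (rat_num f) i + - w * coeff (rat_den f) i) = coeff (fiber_poly f y)"
    by (auto simp: Fin)
  then show ?thesis
    using that[of 1] by (simp add: Fin rat_lift_def wedge_pform del: fiber_poly.simps)
next
  case Infty
  show ?thesis
    by (rule that[of "- 1"]) (simp_all add: Infty rat_lift_def wedge_def pform_def)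
qed

lemma sum_order_roots:
  fixes R :: "complex poly"
  assumes "R \<noteq> 0"
  shows "(\<Sum>z | poly R z = 0. order z R) = degree R"
proof -
  have "degree R = size (proots R)" by (simp add: size_proots_complex)
  also have "\<dots> = (\<Sum>z\<in>set_mset (proots R). count (proots R) z)"
    by (simp add: size_multiset_overloaded_eq)
  also have "\<dots> = (\<Sum>z | poly R z = 0. order z R)"
    using assms by simp
  finally show ?thesis by simp
qed

text \<open>The fiber form splits into linear factors, one for each preimage with multiplicity, and
  the drop in degree of the fiber polynomial counts infinity. The factorisation is what later
  compares the size of the form at a hole with its size elsewhere.\<close>

lemma rat_fiber:
  assumes "rat_degree f > 0"
  shows "finite {x. rat_map f x = y}"
    and "(\<Sum>x | rat_map f x = y. rat_mult f x) = rat_degree f"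
    and "\<exists>c. \<forall>v. wedge (rat_lift f v) (sg y) = c * (\<Prod>x | rat_map f x = y. wedge v (sg x) ^ rat_mult f x)"
proof -
  define R where "R = fiber_poly f y"
  define d where "d = rat_degree f"
  define Z where "Z = {z. poly R z = 0}"
  define I where "I = (if degree R < d then {Infty} else {})"
  have R0: "R \<noteq> 0" using fiber_poly_nonzero[OF assms] by (simp add: R_def)
  have dR: "degree R \<le> d" using degree_fiber_poly by (simp add: R_def d_def)
  obtain c where c: "c \<noteq> 0" "\<And>v. wedge (rat_lift f v) (sg y) = c * hform d (coeff R) v"
    unfolding R_def d_def by (rule wedge_rat_lift) blast
  have "finite Z" unfolding Z_def using R0 by (rule poly_roots_finite)
  have cd: "coeff R d = 0 \<longleftrightarrow> degree R < d"
    using dR R0 by (cases "degree R = d") (auto simp: coeff_eq_0)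
  have fib: "{x. rat_map f x = y} = Fin ` Z \<union> I"
  proof -
    have "rat_map f x = y \<longleftrightarrow> x \<in> Fin ` Z \<union> I" for x
      unfolding rat_map_eq_iff c(2)
      by (cases x) (use c(1) dR cd in \<open>auto simp: Z_def I_def hform_coeff hform_infty\<close>)
    then show ?thesis by blast
  qed
  show fin: "finite {x. rat_map f x = y}"
    unfolding fib using \<open>finite Z\<close> by (simp add: I_def)
  have multF: "rat_mult f (Fin z) = order z R" if "z \<in> Z" for z
  proof -
    have "rat_map f (Fin z) = y" using fib that by blast
    then show ?thesis by (simp add: R_def del: rat_map.simps)
  qed
  have multI: "rat_mult f x = d - degree R" "x = Infty" if "x \<in> I" for x
  proof -
    show x: "x = Infty" using that by (auto simp: I_def split: if_splits)
    have "rat_map f Infty = y" using fib that x by blast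
    then show "rat_mult f x = d - degree R" unfolding x by (simp add: R_def d_def del: rat_map.simps)
  qed
  have disj: "Fin ` Z \<inter> I = {}" by (auto simp: I_def)
  have finI: "finite I" by (simp add: I_def)
  have injF: "inj_on Fin Z" by (auto simp: inj_on_def)
  have "(\<Sum>x | rat_map f x = y. rat_mult f x) = (\<Sum>z\<in>Z. order z R) + (\<Sum>x\<in>I. d - degree R)"
    unfolding fib using \<open>finite Z\<close> finI disj
    by (simp add: sum.union_disjoint sum.reindex[OF injF] multF multI del: rat_mult.simps rat_map.simps)
  also have "(\<Sum>z\<in>Z. order z R) = degree R"
    using sum_order_roots[OF R0] by (simp add: Z_def)
  also have "(\<Sum>x\<in>I. d - degree R) = d - degree R"
    using dR by (simp add: I_def)
  finally show total: "(\<Sum>x | rat_map f x = y. rat_mult f x) = rat_degree f"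
    using dR by (simp add: d_def)
  let ?\<Pi> = "\<lambda>v. \<Prod>x | rat_map f x = y. wedge v (sg x) ^ rat_mult f x"
  have \<Pi>: "?\<Pi> v = (\<Prod>z\<in>Z. wedge v (z, 1) ^ order z R) * (\<Prod>x\<in>I. wedge v (1, 0) ^ (d - degree R))" for v
  proof -
    have "(\<Prod>x\<in>I. wedge v (sg x) ^ rat_mult f x) = (\<Prod>x\<in>I. wedge v (1, 0) ^ (d - degree R))"
    proof (intro prod.cong refl)
      fix x assume "x \<in> I"
      from multI[OF this] show "wedge v (sg x) ^ rat_mult f x = wedge v (1, 0) ^ (d - degree R)"
        by (simp del: rat_mult.simps)
    qed
    then show ?thesis
      unfolding fib using \<open>finite Z\<close> finI disj
      by (simp add: prod.union_disjoint prod.reindex[OF injF] multF del: rat_mult.simps rat_map.simps)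
  qed
  \<comment> \<open>The sign comes from \<open>wedge (u, 1) (1, 0) = - 1\<close>, once for each
    order of vanishing at infinity.\<close>
  define k where "k = lead_coeff R * (- 1) ^ (d - degree R)"
  have sgeq: "hform d (coeff R) (sg x) = k * ?\<Pi> (sg x)" for x
  proof (cases x)
    case (Fin u)
    have "poly R u = lead_coeff R * (\<Prod>z\<in>Z. (u - z) ^ order z R)"
      by (subst complex_poly_decompose[of R, symmetric]) (simp add: poly_prod Z_def)
    moreover have "(\<Prod>x\<in>I. wedge (u, 1) (1, 0) ^ (d - degree R)) = (- 1) ^ (d - degree R)"
      using dR by (auto simp: I_def wedge_def)
    ultimately show ?thesis
      unfolding Fin \<Pi> sg.simps hform_coeff[OF dR] k_def
      by (simp add: wedge_def flip: power_mult_distrib)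
  next
    case Infty
    show ?thesis
      unfolding Infty \<Pi> sg.simps hform_infty k_def
      using dR cd by (auto simp: I_def wedge_def)
  qed
  have "hform d (coeff R) v = k * ?\<Pi> v" for v
  proof (cases "v = 0")
    case True
    have v: "v = cscale 0 (sg Infty)" by (simp add: True)
    \<comment> \<open>A positive exponent is needed to make the product vanish at \<open>0\<close>,
      since \<open>0 ^ 0 = 1\<close>.\<close>
    obtain x where "rat_map f x = y" "rat_mult f x > 0"
    proof -
      have "\<exists>x\<in>{x. rat_map f x = y}. rat_mult f x \<noteq> 0"
        by (rule ccontr) (use total assms in simp)
      then show ?thesis using that by blast
    qed
    then have "?\<Pi> v = 0"
      using fin True by (auto intro!: prod_zero)
    moreover have "hform d (coeff R) v = 0"
      unfolding v hform_cscale using assms by (simp add: d_def)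
    ultimately show ?thesis by simp
  next
    case False
    then obtain t x where v: "v = cscale t (sg x)" by (rule sg_representative)
    have "?\<Pi> v = t ^ d * ?\<Pi> (sg x)"
      unfolding v wedge_cscale power_mult_distrib prod.distrib
      by (simp add: d_def total flip: power_sum)
    then show ?thesis
      unfolding v hform_cscale sgeq by simp
  qed
  then show "\<exists>c. \<forall>v. wedge (rat_lift f v) (sg y) = c * ?\<Pi> v"
    unfolding c(2) by (intro exI[of _ "c * k"]) simp
qed

text \<open>Fibers are nonempty because their multiplicities add up to a positive degree; a point
  over infinity and a point over zero have independent lifts.\<close>

lemma nondeg_rat_lift:
  assumes "rat_degree f > 0"
  shows "nondeg (rat_lift f)"
proof -
  have "\<exists>x. rat_map f x = y" for y
    by (rule ccontr) (use rat_fiber(2)[OF assms, of y] assms in simp)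
  then obtain x x' where "rat_map f x = Infty" "rat_map f x' = Fin 0" by metis
  then have "wedge (rat_lift f (sg x)) (1, 0) = 0" "wedge (rat_lift f (sg x')) (0, 1) = 0"
    unfolding rat_map_eq_iff by auto
  then have "snd (rat_lift f (sg x)) = 0" "fst (rat_lift f (sg x')) = 0"
    by (simp_all add: wedge_def)
  moreover from this have "fst (rat_lift f (sg x)) \<noteq> 0" "snd (rat_lift f (sg x')) \<noteq> 0"
    using rat_lift_sg_nonzero[of f x] rat_lift_sg_nonzero[of f x'] by (auto simp: prod_eq_iff)
  ultimately have "wedge (rat_lift f (sg x)) (rat_lift f (sg x')) \<noteq> 0"
    by (simp add: wedge_def)
  then show ?thesis unfolding nondeg_def by blast
qed

section \<open>Test functions on the sphere\<close>

text \<open>A chordal distance condition in which the norm of \<open>s\<close> is not divided out;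
  this rescales \<epsilon>, which is harmless where every positive \<epsilon> is considered. A zero
  vector in \<open>S\<close> would exclude every nonzero \<open>w\<close> if \<epsilon> is positive,
  whence the conditions \<open>0 \<notin> S\<close>.\<close>

definition far :: "real \<Rightarrow> C2 set \<Rightarrow> C2 \<Rightarrow> bool" where
  "far \<epsilon> S w \<longleftrightarrow> (\<forall>s\<in>S. \<epsilon> * norm w \<le> cmod (wedge w s))"

definition far_set :: "C2 \<times> C2 \<Rightarrow> C2 set \<Rightarrow> real \<Rightarrow> rsphere set" where
  "far_set A S \<epsilon> = {x. far \<epsilon> S (lin A (sg x))}"

lemma far_cscale: "c \<noteq> 0 \<Longrightarrow> far \<epsilon> S (cscale c w) \<longleftrightarrow> far \<epsilon> S w"
  by (simp add: far_def norm_mult mult.left_commute[of \<epsilon>])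

lemma far_mono: "far \<epsilon> S w \<Longrightarrow> T \<subseteq> S \<Longrightarrow> \<delta> \<le> \<epsilon> \<Longrightarrow> far \<delta> T w"
  unfolding far_def by (meson mult_right_mono norm_ge_zero order_trans subsetD)

lemma far_set_mono: "T \<subseteq> S \<Longrightarrow> \<delta> \<le> \<epsilon> \<Longrightarrow> far_set A S \<epsilon> \<subseteq> far_set A T \<delta>"
  unfolding far_set_def using far_mono by blast

text \<open>Scale invariance rewrites \<open>h (z, 1)\<close> as \<open>h (1, 1 / z)\<close>, so
  continuity of \<open>h\<close> at \<open>(1, 0)\<close> gives continuity at infinity.\<close>

lemma continuous_on_rsphere_sg:
  fixes h :: "C2 \<Rightarrow> real"
  assumes "\<And>v. v \<noteq> 0 \<Longrightarrow> isCont h v" "\<And>t v. t \<noteq> 0 \<Longrightarrow> v \<noteq> 0 \<Longrightarrow> h (cscale t v) = h v"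
  shows "continuous_on UNIV (\<lambda>x. h (sg x))"
  unfolding continuous_on_open_vimage[OF open_UNIV]
proof (intro allI impI)
  fix B :: "real set" assume B: "open B"
  let ?U = "(\<lambda>x. h (sg x)) -` B \<inter> UNIV"
  have "isCont (\<lambda>z. h (z, 1)) z" for z
    by (rule continuous_within_compose3[OF assms(1)]) (auto simp: zero_prod_def intro!: continuous_intros)
  then have "continuous_on UNIV (\<lambda>z. h (z, 1))"
    by (simp add: continuous_at_imp_continuous_on)
  then have op: "open ((\<lambda>z. h (z, 1)) -` B)"
    using B by (simp add: open_vimage)
  have eq: "Fin -` ?U = (\<lambda>z. h (z, 1)) -` B" by auto
  have "compact (- (Fin -` ?U))" if "Infty \<in> ?U"
  proof -
    have "isCont (\<lambda>w. h (1, w)) 0"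
      by (rule continuous_within_compose3[OF assms(1)]) (auto simp: zero_prod_def intro!: continuous_intros)
    then have t: "((\<lambda>w. h (1, w)) \<longlongrightarrow> h (1, 0)) (nhds 0)"
      by (simp add: isCont_def tendsto_nhds_iff)
    have i: "h (1, 0) \<in> B" using that by simp
    have "eventually (\<lambda>w. h (1, w) \<in> B) (nhds 0)"
      by (rule topological_tendstoD[OF t B i])
    then obtain \<delta> where \<delta>: "\<delta> > 0" "\<And>w. dist w 0 < \<delta> \<Longrightarrow> h (1, w) \<in> B"
      unfolding eventually_nhds_metric by blast
    have "norm z \<le> 1 / \<delta>" if "h (z, 1) \<notin> B" for z
    proof (rule ccontr)
      assume "\<not> norm z \<le> 1 / \<delta>"
      then have z: "1 / \<delta> < norm z" by simp
      then have "norm z > 0" using \<delta>(1) by (meson divide_pos_pos less_trans zero_less_one)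
      then have "z \<noteq> 0" "norm (1 / z) < \<delta>"
        using z \<delta>(1) by (auto simp: norm_divide field_simps)
      then have "h (1, 1 / z) \<in> B" using \<delta>(2) by simp
      moreover have "cscale z (1, 1 / z) = (z, 1)" using \<open>z \<noteq> 0\<close> by (simp add: cscale_def)
      ultimately show False
        using that assms(2)[of z "(1, 1 / z)"] \<open>z \<noteq> 0\<close> by (auto simp: zero_prod_def)
    qed
    then have "bounded (- (Fin -` ?U))"
      unfolding eq bounded_iff by auto
    then show ?thesis
      using op unfolding eq by (simp add: compact_eq_bounded_closed closed_def)
  qed
  then show "open ?U"
    unfolding open_rsphere_def using op eq by auto
qed

lemma continuous_on_chord:
  assumes "mdet A = 1"
  shows "continuous_on UNIV (\<lambda>x. cmod (wedge (lin A (sg x)) s) / norm (lin A (sg x)))"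
proof (rule continuous_on_rsphere_sg[where h = "\<lambda>v. cmod (wedge (lin A v) s) / norm (lin A v)"])
  fix v :: C2 assume "v \<noteq> 0"
  then have "lin A v \<noteq> 0" using lin_eq_0_iff[OF assms] by blast
  then show "isCont (\<lambda>v. cmod (wedge (lin A v) s) / norm (lin A v)) v"
    unfolding isCont_def by (intro tendsto_intros) auto
  show "cmod (wedge (lin A (cscale t v)) s) / norm (lin A (cscale t v)) =
      cmod (wedge (lin A v) s) / norm (lin A v)" if "t \<noteq> 0" for t
    using that by (simp add: lin_cscale norm_mult)
qed

lemma far_set_chord:
  assumes "mdet A = 1"
  shows "x \<in> far_set A S \<epsilon> \<longleftrightarrow> (\<forall>s\<in>S. \<epsilon> \<le> cmod (wedge (lin A (sg x)) s) / norm (lin A (sg x)))"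
proof -
  have "norm (lin A (sg x)) > 0" using lin_eq_0_iff[OF assms] by simp
  then show ?thesis by (simp add: far_set_def far_def le_divide_eq)
qed

lemma closed_far_set:
  assumes "mdet A = 1"
  shows "closed (far_set A S \<epsilon>)"
proof -
  have "far_set A S \<epsilon> =
      (\<Inter>s\<in>S. {x. \<epsilon> \<le> cmod (wedge (lin A (sg x)) s) / norm (lin A (sg x))})"
    using far_set_chord[OF assms] by blast
  then show ?thesis
    by (simp only:) (intro closed_INT ballI closed_Collect_le continuous_on_const continuous_on_chord assms)
qed

lemma far_set_borel: "mdet A = 1 \<Longrightarrow> far_set A S \<epsilon> \<in> sets borel"
  by (intro borel_closed closed_far_set)

text \<open>Invariance and weak convergence can be tested only on continuous functions, so
  indicators of far sets are replaced by cutoffs; the price is passing from \<epsilon> to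
  \<epsilon>/2.\<close>

lemma cutoff_function:
  assumes "mdet A = 1" "finite S" "\<epsilon> > 0"
  obtains \<psi> :: "rsphere \<Rightarrow> real" where "continuous_on UNIV \<psi>" "\<And>x. 0 \<le> \<psi> x" "\<And>x. \<psi> x \<le> 1"
    "\<And>x. x \<in> far_set A S \<epsilon> \<Longrightarrow> \<psi> x = 1" "\<And>x. x \<notin> far_set A S (\<epsilon> / 2) \<Longrightarrow> \<psi> x = 0"
proof -
  define c where "c s x = cmod (wedge (lin A (sg x)) s) / norm (lin A (sg x))" for s x
  \<comment> \<open>Affine in the chord between the values 0 at \<epsilon>/2 and 1 at
    \<epsilon>.\<close>
  define t where "t s x = max 0 (min 1 (2 * c s x / \<epsilon> - 1))" for s x
  define \<psi> where "\<psi> x = (\<Prod>s\<in>S. t s x)" for x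
  have t: "0 \<le> t s x" "t s x \<le> 1" for s x by (auto simp: t_def)
  show ?thesis
  proof (rule that[of \<psi>])
    have "continuous_on UNIV (c s)" for s
      unfolding c_def by (rule continuous_on_chord[OF assms(1)])
    then show "continuous_on UNIV \<psi>"
      unfolding \<psi>_def t_def using assms(3) by (intro continuous_intros) auto
    show "0 \<le> \<psi> x" "\<psi> x \<le> 1" for x
      unfolding \<psi>_def by (auto intro!: prod_nonneg prod_le_1 t)
    show "\<psi> x = 1" if "x \<in> far_set A S \<epsilon>" for x
      unfolding \<psi>_def
    proof (rule prod.neutral, rule ballI)
      fix s assume "s \<in> S"
      then have "\<epsilon> \<le> c s x" using that far_set_chord[OF assms(1)] unfolding c_def by blast
      then show "t s x = 1" using assms(3) by (simp add: t_def field_simps)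
    qed
    show "\<psi> x = 0" if "x \<notin> far_set A S (\<epsilon> / 2)" for x
    proof -
      have "\<exists>s\<in>S. c s x < \<epsilon> / 2"
        using that unfolding far_set_chord[OF assms(1)] c_def by (meson not_le)
      then obtain s where s: "s \<in> S" "c s x < \<epsilon> / 2" by blast
      then have "t s x = 0" using assms(3) by (simp add: t_def field_simps)
      then show ?thesis unfolding \<psi>_def using s(1) assms(2) by (intro prod_zero) auto
    qed
  qed
qed

section \<open>Transport of mass by one step\<close>

lemma max_entropy_integral:
  assumes "is_max_entropy_measure f \<mu>" "rat_degree f > 0" "continuous_on UNIV \<psi>"
  shows "real (rat_degree f) * (\<integral>x. \<psi> x \<partial>\<mu>) = (\<integral>y. push_fun f \<psi> y \<partial>\<mu>)"
proof -
  let ?d = "real (rat_degree f)"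
  obtain \<nu> where \<nu>: "is_pullback_measure f \<mu> \<nu>" "\<mu> = scale_measure (ennreal (1 / ?d)) \<nu>"
    using assms(1) unfolding is_max_entropy_measure_def by blast
  have sets: "sets \<nu> = sets borel" using \<nu>(1) by (simp add: is_pullback_measure_def)
  have "\<mu> = density \<nu> (\<lambda>_. ennreal (1 / ?d))"
    unfolding \<nu>(2) by (rule measure_eqI) (auto simp: emeasure_density_const)
  moreover have "\<psi> \<in> borel_measurable \<nu>"
    unfolding measurable_cong_sets[OF sets refl] by (rule borel_measurable_continuous_onI[OF assms(3)])
  ultimately have "(\<integral>x. \<psi> x \<partial>\<mu>) = (\<integral>x. (1 / ?d) * \<psi> x \<partial>\<nu>)"
    by (simp add: integral_density)
  then have "?d * (\<integral>x. \<psi> x \<partial>\<mu>) = (\<integral>x. \<psi> x \<partial>\<nu>)"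
    using assms(2) by simp
  then show ?thesis
    using \<nu>(1) assms(3) by (simp add: is_pullback_measure_def)
qed

lemma max_entropy_measureD:
  assumes "is_max_entropy_measure f \<mu>"
  shows "sets \<mu> = sets borel" "prob_space \<mu>" "space \<mu> = UNIV"
  using assms sets_eq_imp_space_eq[of \<mu> borel] by (auto simp: is_max_entropy_measure_def)

text \<open>The invariance of the measure is applied to a cutoff function. Its push-forward vanishes
  off \<open>C\<close> and is at most the number of preimages, with multiplicity, in the far set. A
  bound \<open>q\<close> below the degree is a strict gain.\<close>

lemma max_entropy_far_set_le:
  assumes ent: "is_max_entropy_measure f \<mu>" and d: "rat_degree f > 0"
    and A: "mdet A = 1" "finite S" "\<epsilon> > 0" and C: "C \<in> sets borel" and q: "q \<ge> 0"
    and img: "\<And>x. x \<in> far_set A S (\<epsilon> / 2) \<Longrightarrow> rat_map f x \<in> C"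
    and cnt: "\<And>y. y \<in> C \<Longrightarrow>
      (\<Sum>x\<in>{x. rat_map f x = y} \<inter> far_set A S (\<epsilon> / 2). real (rat_mult f x)) \<le> q"
  shows "real (rat_degree f) * measure \<mu> (far_set A S \<epsilon>) \<le> q * measure \<mu> C"
proof -
  note \<mu> = max_entropy_measureD[OF ent]
  interpret prob_space \<mu> by (rule \<mu>(2))
  obtain \<psi> :: "rsphere \<Rightarrow> real" where \<psi>: "continuous_on UNIV \<psi>" "\<And>x. 0 \<le> \<psi> x" "\<And>x. \<psi> x \<le> 1"
    "\<And>x. x \<in> far_set A S \<epsilon> \<Longrightarrow> \<psi> x = 1" "\<And>x. x \<notin> far_set A S (\<epsilon> / 2) \<Longrightarrow> \<psi> x = 0"
    by (rule cutoff_function[OF A]) blast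
  have \<psi>m: "\<psi> \<in> borel_measurable \<mu>"
    unfolding measurable_cong_sets[OF \<mu>(1) refl] by (rule borel_measurable_continuous_onI[OF \<psi>(1)])
  have E: "far_set A S \<epsilon> \<in> sets \<mu>" "C \<in> sets \<mu>"
    using far_set_borel[OF A(1)] C by (simp_all add: \<mu>(1))
  have "measure \<mu> (far_set A S \<epsilon>) = (\<integral>x. indicator (far_set A S \<epsilon>) x \<partial>\<mu>)"
    using E by simp
  also have "\<dots> \<le> (\<integral>x. \<psi> x \<partial>\<mu>)"
  proof (rule integral_mono)
    show "integrable \<mu> \<psi>"
      by (rule integrable_const_bound[of _ 1]) (use \<psi>(2,3) \<psi>m in auto)
    show "integrable \<mu> (indicator (far_set A S \<epsilon>) :: _ \<Rightarrow> real)"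
      using E by (simp add: emeasure_eq_measure)
  qed (use \<psi>(2,4) in \<open>auto simp: indicator_def\<close>)
  finally have "real (rat_degree f) * measure \<mu> (far_set A S \<epsilon>) \<le> (\<integral>y. push_fun f \<psi> y \<partial>\<mu>)"
    using max_entropy_integral[OF ent d \<psi>(1)] by (metis mult_left_mono of_nat_0_le_iff)
  also have "\<dots> \<le> (\<integral>y. q * indicator C y \<partial>\<mu>)"
  proof (rule integral_mono')
    show "integrable \<mu> (\<lambda>y. q * indicator C y)"
      using E by (intro integrable_mult_right) (simp add: emeasure_eq_measure)
    show "0 \<le> q * indicator C y" for y using q by simp
    show "push_fun f \<psi> y \<le> q * indicator C y" for y
    proof -
      let ?X = "{x. rat_map f x = y}"
      have fin: "finite ?X" by (rule rat_fiber(1)[OF d])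
      have "push_fun f \<psi> y = (\<Sum>x\<in>?X \<inter> far_set A S (\<epsilon> / 2). real (rat_mult f x) * \<psi> x)"
        unfolding push_fun_def using fin \<psi>(5) by (intro sum.mono_neutral_right) auto
      also have "\<dots> \<le> (\<Sum>x\<in>?X \<inter> far_set A S (\<epsilon> / 2). real (rat_mult f x))"
        by (intro sum_mono) (simp add: mult_left_le \<psi>(3))
      also have "\<dots> \<le> q * indicator C y"
      proof (cases "y \<in> C")
        case True
        then show ?thesis using cnt by simp
      next
        case False
        then have "?X \<inter> far_set A S (\<epsilon> / 2) = {}" using img by blast
        then show ?thesis by (simp only: sum.empty) (use q in simp)
      qed
      finally show ?thesis .
    qed
  qed
  also have "\<dots> = q * measure \<mu> C" using E by simp
  finally show ?thesis .
qed

text \<open>The bound says that, seen through the coordinates \<open>A\<close>, the measures \<open>M\<close> accumulate at a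
  measure whose mass outside finite sets, that is, outside its atoms, is at most \<open>c\<close>.\<close>

definition diffuse_le ::
    "nat filter \<Rightarrow> (nat \<Rightarrow> rsphere measure) \<Rightarrow> (nat \<Rightarrow> C2 \<times> C2) \<Rightarrow> real \<Rightarrow> bool" where
  "diffuse_le F M A c \<longleftrightarrow> (\<exists>S. finite S \<and> 0 \<notin> S \<and>
     (\<forall>\<epsilon>>0. \<forall>\<eta>>0. eventually (\<lambda>k. measure (M k) (far_set (A k) S \<epsilon>) \<le> c + \<eta>) F))"

text \<open>Cramer's rule for \<open>u\<close> in terms of \<open>a\<close> and \<open>b\<close>. If
  \<open>a\<close> and \<open>b\<close> are both nearly parallel to \<open>u\<close>, they are
  nearly parallel to each other.\<close>

lemma wedge_Pluecker:
  "cmod (wedge a b) * norm u \<le> cmod (wedge a u) * norm b + cmod (wedge b u) * norm a"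
proof -
  have "cscale (wedge a b) u = cscale (wedge a u) b - cscale (wedge b u) a"
    by (cases u) (simp add: wedge_def cscale_def algebra_simps)
  then have "norm (cscale (wedge a b) u) \<le> norm (cscale (wedge a u) b) + norm (cscale (wedge b u) a)"
    by (metis norm_triangle_ineq4)
  then show ?thesis by simp
qed

text \<open>One level of the tower: \<open>g k\<close> is the lift of \<open>f k\<close> read in the
  coordinates \<open>A k\<close> of the source and \<open>A' k\<close> of the target, up to the
  scalar \<open>l k\<close>. Stating the equation at \<open>lin (A k) v\<close> avoids
  inverses.\<close>

locale transport =
  fixes F :: "nat filter" and d :: nat and f :: "nat \<Rightarrow> complex poly fract"
    and M :: "nat \<Rightarrow> rsphere measure" and A A' :: "nat \<Rightarrow> C2 \<times> C2"
    and l :: "nat \<Rightarrow> complex" and g :: "nat \<Rightarrow> C2 \<Rightarrow> C2" and G :: "C2 \<Rightarrow> C2"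
  assumes F: "ultra F" and d: "d > 0" and deg: "\<And>k. rat_degree (f k) = d"
    and ent: "\<And>k. is_max_entropy_measure (f k) (M k)"
    and det: "\<And>k. mdet (A k) = 1" "\<And>k. mdet (A' k) = 1" and l: "\<And>k. l k \<noteq> 0"
    and g: "\<And>k v. g k (lin (A k) v) = cscale (l k) (lin (A' k) (rat_lift (f k) v))"
    and conv: "forms_conv d F g G" and nd: "nondeg G"
begin

lemma rat_map_far:
  assumes "far \<epsilon> S (g k (lin (A k) (sg x)))"
  shows "rat_map (f k) x \<in> far_set (A' k) S \<epsilon>"
proof -
  have "wedge (rat_lift (f k) (sg x)) (sg (rat_map (f k) x)) = 0"
    using rat_map_eq_iff by blast
  then obtain c where c: "rat_lift (f k) (sg x) = cscale c (sg (rat_map (f k) x))"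
    by (rule wedge_eq_0D) simp_all
  then have "c \<noteq> 0" using rat_lift_sg_nonzero[of "f k" x] by auto
  then show ?thesis
    using assms l[of k] unfolding g c lin_cscale far_set_def by (simp add: far_cscale)
qed

text \<open>On the compact set of unit vectors far from \<open>S\<close>, the limit \<open>G\<close>
  stays off the lines of \<open>S'\<close>, hence so does \<open>g k\<close> uniformly. A hole
  satisfies \<open>wedge (G v) s' = 0\<close> for every \<open>s'\<close>, so \<open>S\<close>
  covers the holes too as soon as \<open>S'\<close> is nonempty.\<close>

lemma eventually_maps_far:
  assumes S: "\<And>v s'. v \<noteq> 0 \<Longrightarrow> s' \<in> S' \<Longrightarrow> wedge (G v) s' = 0 \<Longrightarrow> \<exists>s\<in>S. wedge v s = 0"
    and "finite S'" "\<epsilon> > 0"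
  obtains \<epsilon>' where "\<epsilon>' > 0"
    "eventually (\<lambda>k. \<forall>x\<in>far_set (A k) S \<epsilon>. rat_map (f k) x \<in> far_set (A' k) S' \<epsilon>') F"
proof -
  define K where "K = {v. norm v = 1 \<and> far \<epsilon> S v}"
  have "K = sphere 0 1 \<inter> (\<Inter>s\<in>S. {v. \<epsilon> * norm v \<le> cmod (wedge v s)})"
    by (auto simp: K_def far_def)
  moreover have "closed {v. \<epsilon> * norm v \<le> cmod (wedge v s)}" for s
    unfolding wedge_def by (intro closed_Collect_le continuous_intros)
  ultimately have K: "compact K"
    by (simp add: compact_Int_closed closed_INT)
  obtain B where B: "B > 0" "eventually (\<lambda>k. \<forall>v. norm (g k v) \<le> B * norm v ^ d) F"
    using forms_conv_bounded[OF F conv d] by blast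
  have "\<exists>e>0. eventually (\<lambda>k. \<forall>v\<in>K. e * norm (g k v) \<le> cmod (wedge (g k v) s')) F" if s': "s' \<in> S'" for s'
  proof -
    have pos: "cmod (wedge (G v) s') > 0" if "v \<in> K" for v
    proof -
      have "v \<noteq> 0" using that by (auto simp: K_def)
      moreover have "wedge v s \<noteq> 0" if "s \<in> S" for s
        using \<open>v \<in> K\<close> that assms(3) by (force simp: K_def far_def)
      ultimately show ?thesis
        unfolding zero_less_norm_iff using S[OF _ s'] by blast
    qed
    obtain c where c: "c > 0" "\<And>v. v \<in> K \<Longrightarrow> c < cmod (wedge (G v) s')"
    proof (cases "K = {}")
      case True
      then show ?thesis using that[of 1] by simp
    next
      case False
      have "continuous_on K (\<lambda>v. cmod (wedge (G v) s'))"
        using forms_conv_continuous[OF conv] unfolding wedge_def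
        by (intro continuous_intros continuous_at_imp_continuous_on) auto
      from continuous_attains_inf[OF K False this] obtain x
        where x: "x \<in> K" "\<And>v. v \<in> K \<Longrightarrow> cmod (wedge (G x) s') \<le> cmod (wedge (G v) s')" by blast
      show ?thesis
      proof (rule that[of "cmod (wedge (G x) s') / 2"])
        show "cmod (wedge (G x) s') / 2 > 0" using pos[OF x(1)] by simp
        show "cmod (wedge (G x) s') / 2 < cmod (wedge (G v) s')" if "v \<in> K" for v
          using pos[OF x(1)] x(2)[OF that] by linarith
      qed
    qed
    have "eventually (\<lambda>k. \<forall>v\<in>K. - cmod (wedge (g k v) s') < - c) F"
    proof (rule ultra_uniform_less[OF F K, where H = "\<lambda>v. - cmod (wedge (G v) s')"])
      show "- cmod (wedge (G v) s') < - c" if "v \<in> K" for v using c(2)[OF that] by simp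
      show "((\<lambda>k. - cmod (wedge (g k (u k)) s')) \<longlongrightarrow> - cmod (wedge (G U) s')) F"
        if "(u \<longlongrightarrow> U) F" for u U
        by (intro tendsto_minus tendsto_norm tendsto_wedge tendsto_const forms_conv_tendsto[OF conv that])
    qed
    with B(2) have "eventually (\<lambda>k. \<forall>v\<in>K. c / B * norm (g k v) \<le> cmod (wedge (g k v) s')) F"
    proof eventually_elim
      case (elim k)
      show ?case
      proof
        fix v assume v: "v \<in> K"
        have "norm (g k v) \<le> B * norm v ^ d" using elim(1) by blast
        then have "norm (g k v) \<le> B" using v by (simp add: K_def)
        then have "c / B * norm (g k v) \<le> c / B * B"
          using c(1) B(1) by (intro mult_left_mono) auto
        also have "\<dots> = c" using B(1) by simp
        also have "\<dots> \<le> cmod (wedge (g k v) s')" using elim(2) v by force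
        finally show "c / B * norm (g k v) \<le> cmod (wedge (g k v) s')" .
      qed
    qed
    then show ?thesis using c(1) B(1) by (intro exI[of _ "c / B"]) simp
  qed
  then have "\<forall>s'\<in>S'. \<exists>e. e > 0 \<and> eventually (\<lambda>k. \<forall>v\<in>K. e * norm (g k v) \<le> cmod (wedge (g k v) s')) F"
    by blast
  then obtain e where e: "\<And>s'. s' \<in> S' \<Longrightarrow> e s' > 0"
    "\<And>s'. s' \<in> S' \<Longrightarrow> eventually (\<lambda>k. \<forall>v\<in>K. e s' * norm (g k v) \<le> cmod (wedge (g k v) s')) F"
    unfolding bchoice_iff by blast
  define \<epsilon>' where "\<epsilon>' = Min (insert 1 (e ` S'))"
  have \<epsilon>': "\<epsilon>' > 0" "\<And>s'. s' \<in> S' \<Longrightarrow> \<epsilon>' \<le> e s'"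
    using assms(2) e(1) by (auto simp: \<epsilon>'_def)
  have "eventually (\<lambda>k. \<forall>s'\<in>S'. \<forall>v\<in>K. e s' * norm (g k v) \<le> cmod (wedge (g k v) s')) F"
    using assms(2) e(2) by (intro eventually_ball_finite) auto
  then have "eventually (\<lambda>k. \<forall>x\<in>far_set (A k) S \<epsilon>. rat_map (f k) x \<in> far_set (A' k) S' \<epsilon>') F"
  proof eventually_elim
    case (elim k)
    show ?case
    proof
      fix x assume x: "x \<in> far_set (A k) S \<epsilon>"
      define u where "u = lin (A k) (sg x)"
      have "u \<noteq> 0" unfolding u_def using lin_eq_0_iff[OF det(1)] by simp
      then obtain v where v: "norm v = 1" "u = norm u *\<^sub>R v" by (rule unit_scaling)
      have u': "u = cscale (of_real (norm u)) v" using v(2) unfolding scaleR_eq_cscale .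
      have "far \<epsilon> S (cscale (of_real (norm u)) v)"
        using x u' unfolding far_set_def u_def by simp
      then have "v \<in> K" using v(1) \<open>u \<noteq> 0\<close> by (simp add: K_def far_cscale)
      then have "far \<epsilon>' S' (g k v)"
        unfolding far_def using elim \<epsilon>'(2)
        by (meson mult_right_mono norm_ge_zero order_trans)
      then have "far \<epsilon>' S' (g k u)"
        using \<open>u \<noteq> 0\<close> by (subst u') (simp add: forms_conv_cscale(1)[OF conv] far_cscale)
      then show "rat_map (f k) x \<in> far_set (A' k) S' \<epsilon>'"
        unfolding u_def by (rule rat_map_far)
    qed
  qed
  then show ?thesis using \<epsilon>'(1) that by blast
qed

text \<open>Near a common zero \<open>s\<close> of the limit there is a point of every fiber: otherwise the fiber
  form at \<open>s\<close> would not be small compared to its size elsewhere.\<close>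

lemma eventually_fiber_near_hole:
  assumes "s \<in> S" "G s = 0" "\<epsilon> > 0"
  shows "eventually (\<lambda>k. \<forall>y. \<exists>x. rat_map (f k) x = y \<and> rat_mult (f k) x > 0 \<and> x \<notin> far_set (A k) S \<epsilon>) F"
proof -
  obtain v w where vw: "wedge (G v) (G w) \<noteq> 0" using nd unfolding nondeg_def by blast
  \<comment> \<open>If a whole fiber were far from \<open>s\<close>, then \<open>?L\<close> would be
    bounded by \<open>?R\<close>. But \<open>?R\<close> tends to zero with \<open>g k s\<close>,
    while \<open>?L\<close> has a positive limit.\<close>
  let ?R = "\<lambda>k. (1 / \<epsilon>) ^ d * norm (g k s) * (norm v ^ d * norm (g k w) + norm w ^ d * norm (g k v))"
  let ?L = "\<lambda>k. cmod (wedge (g k v) (g k w))"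
  have gt: "((\<lambda>k. g k u) \<longlongrightarrow> G u) F" for u
    by (rule forms_conv_tendsto[OF conv tendsto_const])
  have "((\<lambda>k. ?L k - ?R k) \<longlongrightarrow> cmod (wedge (G v) (G w)) -
      (1 / \<epsilon>) ^ d * norm (G s) * (norm v ^ d * norm (G w) + norm w ^ d * norm (G v))) F"
    by (intro tendsto_intros gt)
  then have "((\<lambda>k. ?L k - ?R k) \<longlongrightarrow> cmod (wedge (G v) (G w))) F"
    by (simp add: assms(2))
  then have "eventually (\<lambda>k. 0 < ?L k - ?R k) F"
    by (rule order_tendstoD(1)) (use vw in simp)
  then show ?thesis
  proof eventually_elim
    case (elim k)
    show ?case
    proof (rule allI, rule ccontr)
      fix y
      let ?X = "{x. rat_map (f k) x = y}"
      assume "\<not> (\<exists>x. rat_map (f k) x = y \<and> rat_mult (f k) x > 0 \<and> x \<notin> far_set (A k) S \<epsilon>)"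
      then have far: "x \<in> far_set (A k) S \<epsilon>" if "x \<in> ?X" "rat_mult (f k) x > 0" for x
        using that by blast
      have dk: "rat_degree (f k) > 0" using deg d by simp
      obtain c where c: "\<And>v. wedge (rat_lift (f k) v) (sg y) = c * (\<Prod>x\<in>?X. wedge v (sg x) ^ rat_mult (f k) x)"
        using rat_fiber(3)[OF dk, of y] by blast
      define y' where "y' = lin (A' k) (sg y)"
      define u where "u x = lin (A k) (sg x)" for x
      define W where "W = (\<Prod>x\<in>?X. norm (u x) ^ rat_mult (f k) x)"
      have tot: "(\<Sum>x\<in>?X. rat_mult (f k) x) = d" using rat_fiber(2)[OF dk] deg by simp
      have form: "wedge (g k z) y' = l k * c * (\<Prod>x\<in>?X. wedge z (u x) ^ rat_mult (f k) x)" for z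
      proof -
        define z' where "z' = lin (madj (A k)) z"
        have z: "z = lin (A k) z'" unfolding z'_def by (simp add: lin_madj' det)
        have "wedge (g k z) y' = l k * wedge (rat_lift (f k) z') (sg y)"
          unfolding z g y'_def by (simp add: wedge_lin det)
        also have "\<dots> = l k * c * (\<Prod>x\<in>?X. wedge z (u x) ^ rat_mult (f k) x)"
          unfolding c z u_def by (simp add: wedge_lin det)
        finally show ?thesis .
      qed
      have pos: "W > 0"
        unfolding W_def u_def by (intro prod_pos) (simp add: lin_eq_0_iff[OF det(1)])
      have upper: "cmod (wedge (g k z) y') \<le> cmod (l k * c) * (norm z ^ d * W)" for z
      proof -
        have "(\<Prod>x\<in>?X. cmod (wedge z (u x)) ^ rat_mult (f k) x) \<le> (\<Prod>x\<in>?X. (norm z * norm (u x)) ^ rat_mult (f k) x)"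
          by (intro prod_mono) (auto intro!: power_mono norm_wedge_le)
        also have "\<dots> = norm z ^ d * W"
          by (simp add: power_mult_distrib prod.distrib W_def flip: power_sum tot)
        finally show ?thesis
          unfolding form norm_mult[of "l k * c"] prod_norm[symmetric] norm_power by (intro mult_left_mono) auto
      qed
      have lower: "cmod (l k * c) * (\<epsilon> ^ d * W) \<le> cmod (wedge (g k s) y')"
      proof -
        have "\<epsilon> ^ d * W = (\<Prod>x\<in>?X. (\<epsilon> * norm (u x)) ^ rat_mult (f k) x)"
          by (simp add: power_mult_distrib prod.distrib W_def flip: power_sum tot)
        also have "\<dots> \<le> (\<Prod>x\<in>?X. cmod (wedge s (u x)) ^ rat_mult (f k) x)"
        proof (intro prod_mono conjI)
          fix x assume x: "x \<in> ?X"
          show "0 \<le> (\<epsilon> * norm (u x)) ^ rat_mult (f k) x" using assms(3) by simp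
          show "(\<epsilon> * norm (u x)) ^ rat_mult (f k) x \<le> cmod (wedge s (u x)) ^ rat_mult (f k) x"
          proof (cases "rat_mult (f k) x = 0")
            case False
            then have "\<epsilon> * norm (u x) \<le> cmod (wedge (u x) s)"
              using far[OF x] assms(1) unfolding far_set_def far_def u_def by blast
            then have "\<epsilon> * norm (u x) \<le> cmod (wedge s (u x))"
              unfolding wedge_commute[of s] by simp
            then show ?thesis using assms(3) by (intro power_mono) auto
          qed simp
        qed
        finally show ?thesis
          unfolding form norm_mult[of "l k * c"] prod_norm[symmetric] norm_power by (intro mult_left_mono) auto
      qed
      have "y' \<noteq> 0" unfolding y'_def using lin_eq_0_iff[OF det(2)] by simp
      \<comment> \<open>Comparing \<open>upper\<close> at \<open>z\<close> with \<open>lower\<close>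
        at \<open>s\<close> eliminates both the unknown constant of the factorisation and
        \<open>W\<close>.\<close>
      have key: "cmod (wedge (g k z) y') \<le> norm z ^ d * (1 / \<epsilon>) ^ d * (norm (g k s) * norm y')" for z
      proof -
        have "cmod (wedge (g k z) y') \<le> norm z ^ d * (1 / \<epsilon>) ^ d * (cmod (l k * c) * (\<epsilon> ^ d * W))"
          using upper[of z] assms(3) by (simp add: power_divide field_simps)
        also have "\<dots> \<le> norm z ^ d * (1 / \<epsilon>) ^ d * cmod (wedge (g k s) y')"
          using assms(3) by (intro mult_left_mono lower) auto
        also have "\<dots> \<le> norm z ^ d * (1 / \<epsilon>) ^ d * (norm (g k s) * norm y')"
          using assms(3) by (intro mult_left_mono norm_wedge_le) auto
        finally show ?thesis .
      qed
      have "?L k * norm y' \<le> cmod (wedge (g k v) y') * norm (g k w) + cmod (wedge (g k w) y') * norm (g k v)"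
        by (rule wedge_Pluecker)
      also have "\<dots> \<le> norm v ^ d * (1 / \<epsilon>) ^ d * (norm (g k s) * norm y') * norm (g k w) +
          norm w ^ d * (1 / \<epsilon>) ^ d * (norm (g k s) * norm y') * norm (g k v)"
        by (intro add_mono mult_right_mono key) auto
      also have "\<dots> = ?R k * norm y'" by (simp add: algebra_simps)
      finally have "?L k \<le> ?R k" using \<open>y' \<noteq> 0\<close> by simp
      with elim show False by simp
    qed
  qed
qed

lemma zero_lines:
  assumes "finite S'" "0 \<notin> S'"
  obtains T where "finite T" "0 \<notin> T"
    "\<And>v s'. v \<noteq> 0 \<Longrightarrow> s' \<in> S' \<Longrightarrow> wedge (G v) s' = 0 \<Longrightarrow> \<exists>s\<in>T. wedge v s = 0"
proof -
  obtain P Q where G: "G = pform d P Q" using conv unfolding forms_conv_def by blast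
  have "\<forall>s'\<in>S'. \<exists>T. finite T \<and> 0 \<notin> T \<and> (\<forall>v. v \<noteq> 0 \<longrightarrow> wedge (G v) s' = 0 \<longrightarrow> (\<exists>s\<in>T. wedge v s = 0))"
  proof
    fix s' assume "s' \<in> S'"
    then have "s' \<noteq> 0" using assms(2) by auto
    obtain T where "finite T" "0 \<notin> T" "\<And>v. v \<noteq> 0 \<Longrightarrow> wedge (pform d P Q v) s' = 0 \<Longrightarrow> \<exists>t\<in>T. wedge v t = 0"
      using nondeg_zeros[OF nd[unfolded G] \<open>s' \<noteq> 0\<close>] by blast
    then show "\<exists>T. finite T \<and> 0 \<notin> T \<and> (\<forall>v. v \<noteq> 0 \<longrightarrow> wedge (G v) s' = 0 \<longrightarrow> (\<exists>s\<in>T. wedge v s = 0))"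
      unfolding G by blast
  qed
  then obtain T where T: "\<And>s'. s' \<in> S' \<Longrightarrow> finite (T s') \<and> 0 \<notin> T s' \<and>
      (\<forall>v. v \<noteq> 0 \<longrightarrow> wedge (G v) s' = 0 \<longrightarrow> (\<exists>s\<in>T s'. wedge v s = 0))"
    unfolding bchoice_iff by blast
  show ?thesis
  proof (rule that[of "\<Union>s'\<in>S'. T s'"])
    show "finite (\<Union>s'\<in>S'. T s')" using T assms(1) by blast
    show "0 \<notin> (\<Union>s'\<in>S'. T s')" using T by blast
    show "\<exists>s\<in>(\<Union>s'\<in>S'. T s'). wedge v s = 0" if "v \<noteq> 0" "s' \<in> S'" "wedge (G v) s' = 0" for v s'
      using T[OF that(2)] that by blast
  qed
qed

text \<open>Outside a neighbourhood of the preimages of the target set and of the holes, at most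
  \<open>q\<close> of the \<open>d\<close> preimages of a point remain, so the diffuse mass shrinks
  by \<open>q / d\<close>. The cases \<open>q = d\<close> and \<open>q = d - 1\<close> are used
  below.\<close>

lemma diffuse_le_transport:
  assumes D: "diffuse_le F M A' c" and q: "q \<ge> 0"
    and cnt: "\<And>S \<epsilon>. (\<And>v. v \<noteq> 0 \<Longrightarrow> G v = 0 \<Longrightarrow> \<exists>s\<in>S. wedge v s = 0) \<Longrightarrow> 0 \<notin> S \<Longrightarrow> \<epsilon> > 0 \<Longrightarrow>
      eventually (\<lambda>k. \<forall>y. (\<Sum>x\<in>{x. rat_map (f k) x = y} \<inter> far_set (A k) S \<epsilon>. real (rat_mult (f k) x)) \<le> q) F"
  shows "diffuse_le F M A (q / real d * c)"
proof -
  obtain S' where S': "finite S'" "0 \<notin> S'"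
    "\<And>\<epsilon> \<eta>. \<epsilon> > 0 \<Longrightarrow> \<eta> > 0 \<Longrightarrow> eventually (\<lambda>k. measure (M k) (far_set (A' k) S' \<epsilon>) \<le> c + \<eta>) F"
    using D unfolding diffuse_le_def by blast
  \<comment> \<open>The extra vector makes the set nonempty, so that \<open>T\<close> contains the
    holes of \<open>G\<close> even if \<open>S'\<close> is empty.\<close>
  let ?S = "insert (1, 0) S'"
  have fS: "finite ?S" "0 \<notin> ?S" using S'(1,2) by (auto simp: zero_prod_def)
  obtain T where T: "finite T" "0 \<notin> T"
    "\<And>v s'. v \<noteq> 0 \<Longrightarrow> s' \<in> ?S \<Longrightarrow> wedge (G v) s' = 0 \<Longrightarrow> \<exists>s\<in>T. wedge v s = 0"
    by (rule zero_lines[OF fS]) blast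
  have hole: "\<exists>s\<in>T. wedge v s = 0" if "v \<noteq> 0" "G v = 0" for v
    using T(3)[OF that(1), of "(1, 0)"] that(2) by simp
  show ?thesis
    unfolding diffuse_le_def
  proof (intro exI[of _ T] conjI allI impI T(1,2))
    fix \<epsilon> \<eta> :: real assume \<epsilon>: "\<epsilon> > 0" and \<eta>: "\<eta> > 0"
    have "\<epsilon> / 2 > 0" using \<epsilon> by simp
    obtain \<epsilon>' where \<epsilon>': "\<epsilon>' > 0"
      "eventually (\<lambda>k. \<forall>x\<in>far_set (A k) T (\<epsilon> / 2). rat_map (f k) x \<in> far_set (A' k) ?S \<epsilon>') F"
      by (rule eventually_maps_far[OF T(3) fS(1) \<open>\<epsilon> / 2 > 0\<close>]) blast+
    \<comment> \<open>Chosen so that the factor \<open>q / d\<close> turns it into at most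
      \<open>\<eta>\<close>; the summand 1 covers \<open>q = 0\<close>.\<close>
    define \<eta>' where "\<eta>' = \<eta> * real d / (q + 1)"
    have "\<eta>' > 0" using \<eta> d q by (simp add: \<eta>'_def)
    have cnt': "eventually (\<lambda>k. \<forall>y. (\<Sum>x\<in>{x. rat_map (f k) x = y} \<inter> far_set (A k) T (\<epsilon> / 2).
        real (rat_mult (f k) x)) \<le> q) F"
      by (rule cnt[OF _ T(2) \<open>\<epsilon> / 2 > 0\<close>]) (rule hole)
    show "eventually (\<lambda>k. measure (M k) (far_set (A k) T \<epsilon>) \<le> q / real d * c + \<eta>) F"
      using S'(3)[OF \<epsilon>'(1) \<open>\<eta>' > 0\<close>] cnt' \<epsilon>'(2)
    proof eventually_elim
      case (elim k)
      let ?C = "far_set (A' k) ?S \<epsilon>'"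
      interpret prob_space "M k" by (rule max_entropy_measureD(2)[OF ent])
      have dk: "rat_degree (f k) > 0" using deg d by simp
      have "real d * measure (M k) (far_set (A k) T \<epsilon>) \<le> q * measure (M k) ?C"
        unfolding deg[of k, symmetric]
      proof (rule max_entropy_far_set_le[OF ent dk det(1) T(1) \<epsilon> far_set_borel[OF det(2)] q])
        show "rat_map (f k) x \<in> ?C" if "x \<in> far_set (A k) T (\<epsilon> / 2)" for x
          using elim(3) that by blast
        show "(\<Sum>x\<in>{x. rat_map (f k) x = y} \<inter> far_set (A k) T (\<epsilon> / 2). real (rat_mult (f k) x)) \<le> q" for y
          using elim(2) by blast
      qed
      also have "measure (M k) ?C \<le> measure (M k) (far_set (A' k) S' \<epsilon>')"
        using far_set_borel[OF det(2)] max_entropy_measureD(1)[OF ent]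
        by (intro finite_measure_mono far_set_mono) auto
      also have "\<dots> \<le> c + \<eta>'" by (rule elim(1))
      finally have "real d * measure (M k) (far_set (A k) T \<epsilon>) \<le> q * (c + \<eta>')"
        using q by (simp add: mult_left_mono)
      then have "measure (M k) (far_set (A k) T \<epsilon>) \<le> q * (c + \<eta>') / real d"
        using d by (simp add: pos_le_divide_eq mult.commute)
      also have "\<dots> = q / real d * c + q / (q + 1) * \<eta>"
        using d by (simp add: \<eta>'_def distrib_left add_divide_distrib)
      also have "\<dots> \<le> q / real d * c + 1 * \<eta>"
        using q \<eta> by (intro add_left_mono mult_right_mono) auto
      finally show ?case by simp
    qed
  qed
qed

lemma diffuse_le_step:
  assumes "diffuse_le F M A' c"
  shows "diffuse_le F M A c"
proof -
  have "diffuse_le F M A (real d / real d * c)"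
  proof (rule diffuse_le_transport[OF assms])
    fix S \<epsilon>
    have "(\<Sum>x\<in>{x. rat_map (f k) x = y} \<inter> far_set (A k) S \<epsilon>. real (rat_mult (f k) x)) \<le> real d" for k y
    proof -
      have dk: "rat_degree (f k) > 0" using deg d by simp
      have "(\<Sum>x\<in>{x. rat_map (f k) x = y} \<inter> far_set (A k) S \<epsilon>. real (rat_mult (f k) x))
          \<le> (\<Sum>x\<in>{x. rat_map (f k) x = y}. real (rat_mult (f k) x))"
        by (rule sum_mono2) (use rat_fiber(1)[OF dk] in auto)
      also have "\<dots> = real d"
        unfolding of_nat_sum[symmetric] rat_fiber(2)[OF dk] deg ..
      finally show ?thesis .
    qed
    then show "eventually (\<lambda>k. \<forall>y. (\<Sum>x\<in>{x. rat_map (f k) x = y} \<inter> far_set (A k) S \<epsilon>. real (rat_mult (f k) x)) \<le> real d) F"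
      by simp
  qed simp
  then show ?thesis using d by simp
qed

lemma diffuse_le_step_hole:
  assumes "diffuse_le F M A' c" "\<not> nohole G"
  shows "diffuse_le F M A ((1 - 1 / real d) * c)"
proof -
  obtain h where h: "h \<noteq> 0" "G h = 0" using assms(2) unfolding nohole_def by blast
  have "diffuse_le F M A ((real d - 1) / real d * c)"
  proof (rule diffuse_le_transport[OF assms(1)])
    show "0 \<le> real d - 1" using d by simp
    fix S and \<epsilon> :: real assume S: "\<And>v. v \<noteq> 0 \<Longrightarrow> G v = 0 \<Longrightarrow> \<exists>s\<in>S. wedge v s = 0" "0 \<notin> S" and \<epsilon>: "\<epsilon> > 0"
    obtain s where s: "s \<in> S" "wedge h s = 0" using S(1)[OF h] by blast
    then have "s \<noteq> 0" using S(2) by auto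
    have "wedge s h = 0" using s(2) wedge_commute[of s h] by simp
    then obtain c where "s = cscale c h" using h(1) by (rule wedge_eq_0D)
    then have "G s = 0" using h(2) by (simp add: forms_conv_cscale(2)[OF conv])
    show "eventually (\<lambda>k. \<forall>y. (\<Sum>x\<in>{x. rat_map (f k) x = y} \<inter> far_set (A k) S \<epsilon>. real (rat_mult (f k) x)) \<le> real d - 1) F"
      using eventually_fiber_near_hole[OF s(1) \<open>G s = 0\<close> \<epsilon>]
    proof eventually_elim
      case (elim k)
      show ?case
      proof
        fix y
        let ?X = "{x. rat_map (f k) x = y}"
        have dk: "rat_degree (f k) > 0" using deg d by simp
        obtain z where z: "rat_map (f k) z = y" "rat_mult (f k) z > 0" "z \<notin> far_set (A k) S \<epsilon>"
          using elim by blast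
        have "(\<Sum>x\<in>?X \<inter> far_set (A k) S \<epsilon>. real (rat_mult (f k) x)) \<le> (\<Sum>x\<in>?X - {z}. real (rat_mult (f k) x))"
          by (rule sum_mono2) (use rat_fiber(1)[OF dk] z(3) in auto)
        also have "\<dots> = (\<Sum>x\<in>?X. real (rat_mult (f k) x)) - real (rat_mult (f k) z)"
          using rat_fiber(1)[OF dk] z(1) by (simp add: sum_diff1 del: rat_mult.simps)
        also have "(\<Sum>x\<in>?X. real (rat_mult (f k) x)) = real d"
          unfolding of_nat_sum[symmetric] rat_fiber(2)[OF dk] deg ..
        finally show "(\<Sum>x\<in>?X \<inter> far_set (A k) S \<epsilon>. real (rat_mult (f k) x)) \<le> real d - 1"
          using z(2) by linarith
      qed
    qed
  qed
  then show ?thesis using d by (simp add: diff_divide_distrib)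
qed

end

section \<open>Comparison of coordinates\<close>

text \<open>For determinant one, the two coordinate systems differ by changes of coordinates in a
  compact set. The logarithm of the norm serves as a distance, up to additive constants the
  hyperbolic one divided by two.\<close>

definition bnd :: "nat filter \<Rightarrow> (nat \<Rightarrow> C2 \<times> C2) \<Rightarrow> (nat \<Rightarrow> C2 \<times> C2) \<Rightarrow> bool" where
  "bnd F A B \<longleftrightarrow> (\<exists>R. eventually (\<lambda>k. norm (mmul (A k) (madj (B k))) \<le> R) F)"

lemma norm_quotient_commute: "norm (mmul A (madj B)) = norm (mmul B (madj A))"
  using norm_madj[of "mmul A (madj B)"] by (simp add: madj_mmul)

lemma bnd_sym: "bnd F A B \<Longrightarrow> bnd F B A"
  unfolding bnd_def by (simp only: norm_quotient_commute)

lemma bnd_refl: "(\<And>k. mdet (A k) = 1) \<Longrightarrow> bnd F A A"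
  unfolding bnd_def by (intro exI[of _ "norm mone"]) (simp add: mmul_madj')

text \<open>Replacing coordinates by others at bounded distance costs only a constant factor, by
  submultiplicativity of the norm. This permits wrapping around a cycle.\<close>

lemma bnd_norm_le:
  assumes "bnd F A A'" "bnd F B B'" "\<And>k. mdet (A' k) = 1" "\<And>k. mdet (B' k) = 1"
  obtains K where "K > 0"
    "eventually (\<lambda>k. norm (mmul (A k) (madj (B k))) \<le> K * norm (mmul (A' k) (madj (B' k)))) F"
proof -
  obtain R1 R2 where R: "eventually (\<lambda>k. norm (mmul (A k) (madj (A' k))) \<le> R1) F"
    "eventually (\<lambda>k. norm (mmul (B' k) (madj (B k))) \<le> R2) F"
    using assms(1) bnd_sym[OF assms(2)] unfolding bnd_def by blast
  define K where "K = (\<bar>R1\<bar> + 1) * (\<bar>R2\<bar> + 1)"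
  have "eventually (\<lambda>k. norm (mmul (A k) (madj (B k))) \<le> K * norm (mmul (A' k) (madj (B' k)))) F"
    using R
  proof eventually_elim
    case (elim k)
    have "mmul (A k) (madj (B k)) =
        mmul (mmul (mmul (A k) (mmul (madj (A' k)) (A' k))) (mmul (madj (B' k)) (B' k))) (madj (B k))"
      by (simp add: mmul_madj assms(3,4))
    also have "\<dots> = mmul (mmul (A k) (madj (A' k))) (mmul (mmul (A' k) (madj (B' k))) (mmul (B' k) (madj (B k))))"
      by (simp only: mmul_assoc)
    finally have "norm (mmul (A k) (madj (B k))) \<le>
        norm (mmul (A k) (madj (A' k))) * norm (mmul (mmul (A' k) (madj (B' k))) (mmul (B' k) (madj (B k))))"
      by (simp only: norm_mmul_le)
    also have "\<dots> \<le> norm (mmul (A k) (madj (A' k))) *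
        (norm (mmul (A' k) (madj (B' k))) * norm (mmul (B' k) (madj (B k))))"
      by (intro mult_left_mono norm_mmul_le) simp
    also have "\<dots> \<le> (\<bar>R1\<bar> + 1) * (norm (mmul (A' k) (madj (B' k))) * (\<bar>R2\<bar> + 1))"
      using elim by (intro mult_mono) auto
    finally show ?case by (simp add: K_def mult_ac)
  qed
  moreover have "K > 0" by (simp add: K_def add_pos_pos)
  ultimately show ?thesis using that by blast
qed

lemma not_bnd_at_top:
  assumes "ultra F" "\<not> bnd F A B"
  shows "filterlim (\<lambda>k. norm (mmul (A k) (madj (B k)))) at_top F"
  using assms unfolding bnd_def by (intro ultra_at_top) auto

lemma bnd_tendsto:
  assumes "ultra F" "bnd F A B" "\<And>k. mdet (A k) = 1" "\<And>k. mdet (B k) = 1"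
  obtains L where "((\<lambda>k. mmul (A k) (madj (B k))) \<longlongrightarrow> L) F" "mdet L = 1"
proof -
  obtain R where "eventually (\<lambda>k. norm (mmul (A k) (madj (B k))) \<le> R) F"
    using assms(2) unfolding bnd_def by blast
  then have "eventually (\<lambda>k. dist 0 (mmul (A k) (madj (B k))) \<le> R) F" by simp
  with assms(1) obtain L where L: "((\<lambda>k. mmul (A k) (madj (B k))) \<longlongrightarrow> L) F"
    by (rule ultra_bounded)
  have "((\<lambda>k. mdet (mmul (A k) (madj (B k)))) \<longlongrightarrow> mdet L) F"
    by (rule tendsto_mdet[OF L])
  then have "((\<lambda>k. 1) \<longlongrightarrow> mdet L) F"
    by (simp add: mdet_mmul assms(3,4))
  then have "mdet L = 1"
    using tendsto_unique[OF ultra_not_bot[OF assms(1)] _ tendsto_const] by blast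
  with L show ?thesis by (rule that)
qed

lemma diffuse_le_bnd:
  assumes F: "ultra F" and AB: "bnd F A B" and det: "\<And>k. mdet (A k) = 1" "\<And>k. mdet (B k) = 1"
    and M: "\<And>k. sets (M k) = sets borel" "\<And>k. finite_measure (M k)"
    and D: "diffuse_le F M B c"
  shows "diffuse_le F M A c"
proof -
  obtain L where L: "((\<lambda>k. mmul (A k) (madj (B k))) \<longlongrightarrow> L) F" "mdet L = 1"
    by (rule bnd_tendsto[OF F AB det])
  obtain R where R: "eventually (\<lambda>k. norm (mmul (A k) (madj (B k))) \<le> R) F"
    using AB unfolding bnd_def by blast
  obtain S where S: "finite S" "0 \<notin> S"
    "\<And>\<epsilon> \<eta>. \<epsilon> > 0 \<Longrightarrow> \<eta> > 0 \<Longrightarrow> eventually (\<lambda>k. measure (M k) (far_set (B k) S \<epsilon>) \<le> c + \<eta>) F"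
    using D unfolding diffuse_le_def by blast
  show ?thesis
    unfolding diffuse_le_def
  proof (intro exI[of _ "lin L ` S"] conjI allI impI)
    show "finite (lin L ` S)" using S(1) by simp
    show "0 \<notin> lin L ` S" using S(2) by (auto simp: lin_eq_0_iff[OF L(2)])
    fix \<epsilon> \<eta> :: real assume \<epsilon>: "\<epsilon> > 0" and \<eta>: "\<eta> > 0"
    have near: "eventually (\<lambda>k. norm (lin (mmul (A k) (madj (B k))) s - lin L s) < \<epsilon> / 2) F" for s
      using tendstoD[OF tendsto_lin[OF L(1) tendsto_const], of "\<epsilon> / 2" s] \<epsilon> by (simp add: dist_norm)
    have near: "eventually (\<lambda>k. \<forall>s\<in>S. norm (lin (mmul (A k) (madj (B k))) s - lin L s) < \<epsilon> / 2) F"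
      using S(1) near by (intro eventually_ball_finite) auto
    define T where "T = \<bar>R\<bar> + 1"
    have T: "T > 0" by (simp add: T_def add_nonneg_pos)
    \<comment> \<open>Half of \<epsilon> is lost when the moving matrix is replaced by its limit
      \<open>L\<close>; \<open>T\<close> bounds the distortion of norms by that matrix.\<close>
    define \<epsilon>' where "\<epsilon>' = \<epsilon> / 2 / T"
    have "\<epsilon>' > 0" using \<epsilon> T by (simp add: \<epsilon>'_def)
    show "eventually (\<lambda>k. measure (M k) (far_set (A k) (lin L ` S) \<epsilon>) \<le> c + \<eta>) F"
      using S(3)[OF \<open>\<epsilon>' > 0\<close> \<eta>] near R
    proof eventually_elim
      case (elim k)
      let ?C = "mmul (A k) (madj (B k))"
      have dC: "mdet ?C = 1" by (simp add: mdet_mmul det)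
      have "far_set (A k) (lin L ` S) \<epsilon> \<subseteq> far_set (B k) S \<epsilon>'"
      proof
        fix x assume x: "x \<in> far_set (A k) (lin L ` S) \<epsilon>"
        define v where "v = lin (A k) (sg x)"
        define w where "w = lin (B k) (sg x)"
        have v: "v = lin ?C w"
          unfolding v_def w_def lin_mmul by (simp add: lin_madj det)
        have "norm w \<le> norm ?C * norm v"
          unfolding v by (rule norm_lin_ge[OF dC])
        also have "\<dots> \<le> T * norm v"
          using elim(3) by (intro mult_right_mono) (auto simp: T_def)
        finally have "\<epsilon>' * norm w \<le> \<epsilon>' * (T * norm v)"
          using \<open>\<epsilon>' > 0\<close> by (intro mult_left_mono) auto
        also have "\<dots> = \<epsilon> / 2 * norm v" using T by (simp add: \<epsilon>'_def)
        finally have wv: "\<epsilon>' * norm w \<le> \<epsilon> / 2 * norm v" .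
        have "\<epsilon>' * norm w \<le> cmod (wedge w s)" if "s \<in> S" for s
        proof -
          have "\<epsilon> * norm v \<le> cmod (wedge v (lin L s))"
            using x that unfolding far_set_def far_def v_def by blast
          also have "wedge v (lin L s) = wedge v (lin ?C s) - wedge v (lin ?C s - lin L s)"
            by (simp add: wedge_def algebra_simps)
          also have "cmod \<dots> \<le> cmod (wedge v (lin ?C s)) + cmod (wedge v (lin ?C s - lin L s))"
            by (rule norm_triangle_ineq4)
          also have "wedge v (lin ?C s) = wedge w s"
            unfolding v wedge_lin dC by simp
          also have "cmod (wedge v (lin ?C s - lin L s)) \<le> norm v * norm (lin ?C s - lin L s)"
            by (rule norm_wedge_le)
          also have "\<dots> \<le> norm v * (\<epsilon> / 2)"
            using elim(2) that by (intro mult_left_mono) (auto intro: less_imp_le)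
          finally have "\<epsilon> / 2 * norm v \<le> cmod (wedge w s)" by (simp add: algebra_simps)
          with wv show ?thesis by (rule order_trans)
        qed
        then show "x \<in> far_set (B k) S \<epsilon>'"
          unfolding far_set_def far_def w_def by blast
      qed
      then have "measure (M k) (far_set (A k) (lin L ` S) \<epsilon>) \<le> measure (M k) (far_set (B k) S \<epsilon>')"
        by (rule finite_measure.finite_measure_mono[OF M(2)]) (simp only: M(1) far_set_borel[OF det(2)])
      with elim(1) show ?case by simp
    qed
  qed
qed

text \<open>The change of coordinates from \<open>B\<close> to \<open>A\<close> degenerates to a map
  of rank one, which collapses everything away from the line of \<open>b\<close> onto the line of
  \<open>a\<close>. So a point that \<open>B\<close> sees far from \<open>b\<close> is seen by
  \<open>A\<close> near \<open>a\<close>.\<close>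

lemma divergent_disjoint:
  assumes F: "ultra F" and AB: "\<not> bnd F A B" and det: "\<And>k. mdet (A k) = 1" "\<And>k. mdet (B k) = 1"
  shows "\<exists>a b. a \<noteq> 0 \<and> b \<noteq> 0 \<and>
    (\<forall>\<epsilon>>0. eventually (\<lambda>k. far_set (A k) {a} \<epsilon> \<inter> far_set (B k) {b} \<epsilon> = {}) F)"
proof -
  let ?C = "\<lambda>k. mmul (A k) (madj (B k))"
  have dC: "mdet (?C k) = 1" for k by (simp add: mdet_mmul det)
  obtain a b :: C2 and r :: "nat \<Rightarrow> real" where ab: "a \<noteq> 0" "b \<noteq> 0" and r: "\<And>k. r k > 0"
    and lim: "\<And>u U. (u \<longlongrightarrow> U) F \<Longrightarrow> ((\<lambda>k. r k *\<^sub>R lin (?C k) (u k)) \<longlongrightarrow> cscale (wedge U b) a) F"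
    by (rule blowup_limit[OF F dC not_bnd_at_top[OF F AB]]) blast
  have "eventually (\<lambda>k. far_set (A k) {a} \<epsilon> \<inter> far_set (B k) {b} \<epsilon> = {}) F" if \<epsilon>: "\<epsilon> > 0" for \<epsilon>
  proof -
    define K where "K = sphere 0 1 \<inter> {v. \<epsilon> \<le> cmod (wedge v b)}"
    have "closed {v. \<epsilon> \<le> cmod (wedge v b)}"
      unfolding wedge_def by (intro closed_Collect_le continuous_intros)
    then have K: "compact K" unfolding K_def by (simp add: compact_Int_closed)
    have "eventually (\<lambda>k. \<forall>v\<in>K. cmod (wedge (r k *\<^sub>R lin (?C k) v) a) -
        \<epsilon> * norm (r k *\<^sub>R lin (?C k) v) < 0) F"
    proof (rule ultra_uniform_less[OF F K, where H = "\<lambda>v. - (\<epsilon> * norm (cscale (wedge v b) a))"])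
      show "- (\<epsilon> * norm (cscale (wedge v b) a)) < 0" if "v \<in> K" for v
      proof -
        have "wedge v b \<noteq> 0" using that \<epsilon> by (auto simp: K_def)
        then show ?thesis using \<epsilon> ab(1) by simp
      qed
      fix u and U :: C2 assume u: "(u \<longlongrightarrow> U) F"
      have "((\<lambda>k. cmod (wedge (r k *\<^sub>R lin (?C k) (u k)) a) - \<epsilon> * norm (r k *\<^sub>R lin (?C k) (u k))) \<longlongrightarrow>
          cmod (wedge (cscale (wedge U b) a) a) - \<epsilon> * norm (cscale (wedge U b) a)) F"
        by (intro tendsto_intros lim u)
      then show "((\<lambda>k. cmod (wedge (r k *\<^sub>R lin (?C k) (u k)) a) - \<epsilon> * norm (r k *\<^sub>R lin (?C k) (u k))) \<longlongrightarrow>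
          - (\<epsilon> * norm (cscale (wedge U b) a))) F"
        by simp
    qed
    then show ?thesis
    proof eventually_elim
      case (elim k)
      show ?case
      proof (rule ccontr)
        assume "far_set (A k) {a} \<epsilon> \<inter> far_set (B k) {b} \<epsilon> \<noteq> {}"
        then obtain x where x: "far \<epsilon> {a} (lin (A k) (sg x))" "far \<epsilon> {b} (lin (B k) (sg x))"
          unfolding far_set_def by blast
        define w where "w = lin (B k) (sg x)"
        have Cw: "lin (A k) (sg x) = lin (?C k) w"
          unfolding w_def lin_mmul by (simp add: lin_madj det)
        have "w \<noteq> 0" unfolding w_def using lin_eq_0_iff[OF det(2)] by simp
        then obtain v where v: "norm v = 1" "w = norm w *\<^sub>R v" by (rule unit_scaling)
        have wv: "w = cscale (of_real (norm w)) v" using v(2) unfolding scaleR_eq_cscale .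
        have "far \<epsilon> {b} v"
          using x(2) \<open>w \<noteq> 0\<close> far_cscale[of "of_real (norm w)" \<epsilon> "{b}" v] wv unfolding w_def[symmetric] by simp
        then have "v \<in> K" using v(1) by (simp add: K_def far_def)
        have "lin (?C k) w = cscale (of_real (norm w)) (lin (?C k) v)"
          by (subst wv) (simp add: lin_cscale)
        then have "far \<epsilon> {a} (lin (?C k) v)"
          using x(1) \<open>w \<noteq> 0\<close> unfolding Cw by (simp add: far_cscale)
        then have "far \<epsilon> {a} (r k *\<^sub>R lin (?C k) v)"
          using r[of k] unfolding scaleR_eq_cscale by (simp add: far_cscale)
        then show False
          using elim \<open>v \<in> K\<close> unfolding far_def by force
      qed
    qed
  qed
  then show ?thesis using ab by blast
qed

lemma diffuse_pigeonhole:
  fixes A :: "nat \<Rightarrow> nat \<Rightarrow> C2 \<times> C2"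
  assumes F: "ultra F" and det: "\<And>n k. mdet (A n k) = 1"
    and M: "\<And>k. sets (M k) = sets borel" "\<And>k. prob_space (M k)"
    and div: "\<And>n m. n < N \<Longrightarrow> m < N \<Longrightarrow> n < m \<Longrightarrow> \<not> bnd F (A n) (A m)"
    and D: "\<And>n. n < N \<Longrightarrow> \<not> diffuse_le F M (A n) c"
  shows "real N * c \<le> 1"
proof -
  have "\<forall>n. \<forall>m. \<exists>a. \<exists>b. a \<noteq> 0 \<and> b \<noteq> 0 \<and> (n < m \<longrightarrow> m < N \<longrightarrow>
    (\<forall>\<epsilon>>0. eventually (\<lambda>k. far_set (A n k) {a} \<epsilon> \<inter> far_set (A m k) {b} \<epsilon> = {}) F))"
  proof (intro allI)
    fix n m
    show "\<exists>a b. a \<noteq> 0 \<and> b \<noteq> 0 \<and> (n < m \<longrightarrow> m < N \<longrightarrow>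
      (\<forall>\<epsilon>>0. eventually (\<lambda>k. far_set (A n k) {a} \<epsilon> \<inter> far_set (A m k) {b} \<epsilon> = {}) F))"
    proof (cases "n < m \<and> m < N")
      case True
      then show ?thesis using divergent_disjoint[OF F div det det, of n m] by auto
    next
      case False
      have "(1, 0) \<noteq> (0 :: C2)" by (simp add: zero_prod_def)
      then show ?thesis using False by blast
    qed
  qed
  then obtain a b where ab: "\<And>n m. a n m \<noteq> 0" "\<And>n m. b n m \<noteq> 0"
    "\<And>n m \<epsilon>. n < m \<Longrightarrow> m < N \<Longrightarrow> \<epsilon> > 0 \<Longrightarrow>
      eventually (\<lambda>k. far_set (A n k) {a n m} \<epsilon> \<inter> far_set (A m k) {b n m} \<epsilon> = {}) F"
    unfolding choice_iff by blast
  \<comment> \<open>All directions separating level \<open>n\<close> from the others, once as the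
    first and once as the second member of a pair.\<close>
  define S where "S n = a n ` {..<N} \<union> (\<lambda>m. b m n) ` {..<N}" for n
  have S: "finite (S n)" "0 \<notin> S n" for n
    using ab(1,2)[symmetric] by (auto simp: S_def)
  have "\<forall>n. \<exists>\<epsilon>>0. n < N \<longrightarrow> eventually (\<lambda>k. c < measure (M k) (far_set (A n k) (S n) \<epsilon>)) F"
  proof
    fix n
    show "\<exists>\<epsilon>>0. n < N \<longrightarrow> eventually (\<lambda>k. c < measure (M k) (far_set (A n k) (S n) \<epsilon>)) F"
    proof (cases "n < N")
      case True
      obtain \<epsilon> \<eta> where *: "\<epsilon> > 0" "\<eta> > 0"
        "\<not> eventually (\<lambda>k. measure (M k) (far_set (A n k) (S n) \<epsilon>) \<le> c + \<eta>) F"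
        using D[OF True] S[of n] unfolding diffuse_le_def by blast
      then have "eventually (\<lambda>k. \<not> measure (M k) (far_set (A n k) (S n) \<epsilon>) \<le> c + \<eta>) F"
        using ultra_not_eventually[OF F] by blast
      then have "eventually (\<lambda>k. c < measure (M k) (far_set (A n k) (S n) \<epsilon>)) F"
        using *(2) by (auto elim: eventually_mono)
      then show ?thesis using *(1) by blast
    qed (auto intro: zero_less_one)
  qed
  then obtain e where e: "\<And>n. e n > 0"
    "\<And>n. n < N \<Longrightarrow> eventually (\<lambda>k. c < measure (M k) (far_set (A n k) (S n) (e n))) F"
    unfolding choice_iff by blast
  define \<epsilon> where "\<epsilon> = Min (insert 1 (e ` {..<N}))"
  have \<epsilon>: "\<epsilon> > 0" "\<And>n. n < N \<Longrightarrow> \<epsilon> \<le> e n"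
    using e(1) by (auto simp: \<epsilon>_def)
  have "eventually (\<lambda>k. \<forall>n\<in>{..<N}. c < measure (M k) (far_set (A n k) (S n) (e n))) F"
    using e(2) by (intro eventually_ball_finite) auto
  moreover have "eventually (\<lambda>k. \<forall>m\<in>{..<N}. \<forall>n\<in>{..<m}.
      far_set (A n k) {a n m} \<epsilon> \<inter> far_set (A m k) {b n m} \<epsilon> = {}) F"
    using ab(3) \<epsilon>(1) by (intro eventually_ball_finite ballI) auto
  ultimately have "eventually (\<lambda>k. (\<forall>n\<in>{..<N}. c < measure (M k) (far_set (A n k) (S n) (e n))) \<and>
    (\<forall>m\<in>{..<N}. \<forall>n\<in>{..<m}. far_set (A n k) {a n m} \<epsilon> \<inter> far_set (A m k) {b n m} \<epsilon> = {})) F"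
    by (rule eventually_conj)
  from eventually_happens'[OF ultra_not_bot[OF F] this]
  obtain k where k: "\<And>n. n < N \<Longrightarrow> c < measure (M k) (far_set (A n k) (S n) (e n))"
    "\<And>n m. m < N \<Longrightarrow> n < m \<Longrightarrow> far_set (A n k) {a n m} \<epsilon> \<inter> far_set (A m k) {b n m} \<epsilon> = {}"
    unfolding lessThan_iff Ball_def by blast
  define E where "E n = far_set (A n k) (S n) (e n)" for n
  interpret prob_space "M k" by (rule M)
  have disj: "E n \<inter> E m = {}" if "n < m" "m < N" for n m
  proof -
    have "n < N" using that by simp
    have "E n \<subseteq> far_set (A n k) {a n m} \<epsilon>"
      unfolding E_def using that \<epsilon>(2)[OF \<open>n < N\<close>] by (intro far_set_mono) (auto simp: S_def)
    moreover have "E m \<subseteq> far_set (A m k) {b n m} \<epsilon>"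
      unfolding E_def using that \<epsilon>(2)[OF that(2)] \<open>n < N\<close> by (intro far_set_mono) (auto simp: S_def)
    ultimately show ?thesis using k(2)[OF that(2,1)] by blast
  qed
  have df: "disjoint_family_on E {..<N}"
    unfolding disjoint_family_on_def
  proof (intro ballI impI)
    fix n m assume "n \<in> {..<N}" "m \<in> {..<N}" "n \<noteq> m"
    then consider "n < m" "m < N" | "m < n" "n < N" by force
    then show "E n \<inter> E m = {}"
      using disj[of n m] disj[of m n] by cases auto
  qed
  have "real N * c = (\<Sum>n<N. c)" by simp
  also have "\<dots> \<le> (\<Sum>n<N. measure (M k) (E n))"
    using k(1) by (intro sum_mono) (auto simp: E_def intro: less_imp_le)
  also have "\<dots> = measure (M k) (\<Union>n<N. E n)"
    by (rule finite_measure_finite_Union[symmetric, OF _ _ df]) (auto simp: E_def M(1) intro: far_set_borel det)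
  also have "\<dots> \<le> 1" by (rule prob_le_1)
  finally show ?thesis .
qed

section \<open>Rescaled limits without holes\<close>

text \<open>Two rescalings of the same map differ by a change of coordinates in the source and one
  in the target; eliminating \<open>\<phi>\<close> relates them directly.\<close>

lemma rescaled_step_eq:
  assumes det: "mdet A = 1" "mdet A' = 1" and l: "l \<noteq> 0"
    and g: "\<And>v. g (lin A v) = cscale l (lin A' (\<phi> v))"
    and g': "\<And>v. g' (lin B v) = cscale l' (lin B' (\<phi> v))"
  shows "g' (lin (mmul B (madj A)) w) = cscale (l' / l) (lin (mmul B' (madj A')) (g w))"
proof -
  define v where "v = lin (madj A) w"
  have w: "w = lin A v" by (simp add: v_def lin_madj' det)
  have "lin (madj A') (g w) = cscale l (\<phi> v)"
    unfolding w g lin_cscale by (simp add: lin_madj det)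
  then have "cscale (l' / l) (lin (mmul B' (madj A')) (g w)) = cscale l' (lin B' (\<phi> v))"
    using l by (simp add: lin_mmul lin_cscale)
  also have "\<dots> = g' (lin B v)" by (simp add: g')
  also have "lin B v = lin (mmul B (madj A)) w" by (simp add: lin_mmul v_def)
  finally show ?thesis by simp
qed

text \<open>If the source coordinates drifted apart, then all generic points would have the same image
  under the limit \<open>G\<close>, because \<open>G'\<close> sees them near a single point and has no hole there.\<close>

lemma bnd_backward:
  assumes F: "ultra F" and d: "d > 0"
    and det: "\<And>k. mdet (A k) = 1" "\<And>k. mdet (A' k) = 1" "\<And>k. mdet (B k) = 1" "\<And>k. mdet (B' k) = 1"
    and l: "\<And>k. l k \<noteq> 0"
    and g: "\<And>k v. g k (lin (A k) v) = cscale (l k) (lin (A' k) (\<phi> k v))"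
    and g': "\<And>k v. g' k (lin (B k) v) = cscale (l' k) (lin (B' k) (\<phi> k v))"
    and conv: "forms_conv d F g G" and conv': "forms_conv d F g' G'"
    and nd: "nondeg G" and nh: "nohole G'" and bnd': "bnd F A' B'"
  shows "bnd F A B"
proof (rule ccontr)
  assume "\<not> bnd F A B"
  then have "\<not> bnd F B A" using bnd_sym by blast
  let ?D = "\<lambda>k. mmul (B k) (madj (A k))" and ?E = "\<lambda>k. mmul (B' k) (madj (A' k))"
  have dD: "mdet (?D k) = 1" for k by (simp add: mdet_mmul det)
  have dE: "mdet (?E k) = 1" for k by (simp add: mdet_mmul det)
  obtain a b :: C2 and r :: "nat \<Rightarrow> real" where ab: "a \<noteq> 0" "b \<noteq> 0" and r: "\<And>k. r k > 0"
    and lim: "\<And>u U. (u \<longlongrightarrow> U) F \<Longrightarrow> ((\<lambda>k. r k *\<^sub>R lin (?D k) (u k)) \<longlongrightarrow> cscale (wedge U b) a) F"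
    by (rule blowup_limit[OF F dD not_bnd_at_top[OF F \<open>\<not> bnd F B A\<close>]]) blast
  obtain R where "eventually (\<lambda>k. norm (?E k) \<le> R) F"
    using bnd_sym[OF bnd'] unfolding bnd_def by blast
  then have R: "eventually (\<lambda>k. norm (?E k) \<le> \<bar>R\<bar> + 1) F" by (auto elim: eventually_mono)
  define \<rho> where "\<rho> k = of_real (r k) ^ d * (l' k / l k)" for k
  have step: "g' k (r k *\<^sub>R lin (?D k) w) = cscale (\<rho> k) (lin (?E k) (g k w))" for k w
    unfolding scaleR_eq_cscale forms_conv_cscale(1)[OF conv'] \<rho>_def
    by (simp add: rescaled_step_eq[of "A k" "A' k" "l k" "g k" "\<phi> k" "g' k" "B k" "l' k" "B' k", OF det(1,2) l g g'])
  have glim: "((\<lambda>k. g k w) \<longlongrightarrow> G w) F" for w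
    by (rule forms_conv_tendsto[OF conv tendsto_const])
  have g'lim: "((\<lambda>k. g' k (r k *\<^sub>R lin (?D k) w)) \<longlongrightarrow> G' (cscale (wedge w b) a)) F" for w
    by (rule forms_conv_tendsto[OF conv' lim[OF tendsto_const]])
  have generic: "wedge (G v) (G w) = 0" if v: "wedge v b \<noteq> 0" and w: "wedge w b \<noteq> 0" for v w
  proof -
    define c where "c = norm (G' (cscale (wedge v b) a)) / 2"
    have c: "c > 0" using nh v ab(1) by (simp add: c_def nohole_def)
    \<comment> \<open>Since \<open>a\<close> is not a hole of \<open>G'\<close>, the left side of
      \<open>step\<close> at \<open>v\<close> stays above \<open>c\<close>; as the matrices
      \<open>?E\<close> and the values \<open>g k v\<close> are bounded, \<open>\<rho>\<close> stays
      away from zero.\<close>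
    define c0 where "c0 = c / ((\<bar>R\<bar> + 1) * (norm (G v) + 1))"
    have pos: "(\<bar>R\<bar> + 1) * (norm (G v) + 1) > 0" by (intro mult_pos_pos add_nonneg_pos) auto
    have c0: "c0 > 0" unfolding c0_def using c pos by (rule divide_pos_pos)
    have "eventually (\<lambda>k. c < norm (g' k (r k *\<^sub>R lin (?D k) v))) F"
      by (rule order_tendstoD(1)[OF tendsto_norm[OF g'lim]]) (use c in \<open>simp add: c_def\<close>)
    moreover have "eventually (\<lambda>k. norm (g k v) < norm (G v) + 1) F"
      by (rule order_tendstoD(2)[OF tendsto_norm[OF glim]]) simp
    ultimately have \<rho>: "eventually (\<lambda>k. c0 \<le> cmod (\<rho> k)) F"
      using R
    proof eventually_elim
      case (elim k)
      have "c \<le> norm (g' k (r k *\<^sub>R lin (?D k) v))" using elim(1) by simp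
      also have "\<dots> = cmod (\<rho> k) * norm (lin (?E k) (g k v))" unfolding step by simp
      also have "\<dots> \<le> cmod (\<rho> k) * (norm (?E k) * norm (g k v))"
        by (intro mult_left_mono norm_lin_le) simp
      also have "\<dots> \<le> cmod (\<rho> k) * ((\<bar>R\<bar> + 1) * (norm (G v) + 1))"
        using elim by (intro mult_left_mono mult_mono) auto
      finally show ?case unfolding c0_def using pos by (simp add: pos_divide_le_eq)
    qed
    have "((\<lambda>k. cmod (wedge (g' k (r k *\<^sub>R lin (?D k) v)) (g' k (r k *\<^sub>R lin (?D k) w)))) \<longlongrightarrow>
        cmod (wedge (G' (cscale (wedge v b) a)) (G' (cscale (wedge w b) a)))) F"
      by (intro tendsto_norm tendsto_wedge g'lim)
    then have z: "((\<lambda>k. cmod (wedge (g' k (r k *\<^sub>R lin (?D k) v)) (g' k (r k *\<^sub>R lin (?D k) w)))) \<longlongrightarrow> 0) F"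
      by (simp add: forms_conv_cscale(2)[OF conv'])
    \<comment> \<open>By \<open>step\<close> and determinant one, the wedge of the \<open>g'\<close>
      values is \<open>\<rho>\<^sup>2\<close> times that of the \<open>g\<close> values. It tends to
      zero because both arguments approach multiples of \<open>a\<close>.\<close>
    have "cmod (wedge (G v) (G w)) * c0\<^sup>2 \<le> 0"
    proof (rule tendsto_le[OF ultra_not_bot[OF F] z])
      show "((\<lambda>k. cmod (wedge (g k v) (g k w)) * c0\<^sup>2) \<longlongrightarrow> cmod (wedge (G v) (G w)) * c0\<^sup>2) F"
        by (intro tendsto_intros glim)
      show "eventually (\<lambda>k. cmod (wedge (g k v) (g k w)) * c0\<^sup>2 \<le>
          cmod (wedge (g' k (r k *\<^sub>R lin (?D k) v)) (g' k (r k *\<^sub>R lin (?D k) w)))) F"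
        using \<rho>
      proof eventually_elim
        case (elim k)
        have "cmod (wedge (g' k (r k *\<^sub>R lin (?D k) v)) (g' k (r k *\<^sub>R lin (?D k) w))) =
            cmod (wedge (g k v) (g k w)) * (cmod (\<rho> k))\<^sup>2"
          unfolding step wedge_cscale wedge_lin dE by (simp add: norm_mult power2_eq_square)
        moreover have "c0\<^sup>2 \<le> (cmod (\<rho> k))\<^sup>2" using elim c0 by (intro power_mono) auto
        ultimately show ?case by (simp add: mult_left_mono)
      qed
    qed
    then show ?thesis using c0 by (simp add: mult_le_0_iff not_le)
  qed
  obtain b0 where b0: "wedge b0 b \<noteq> 0"
  proof -
    have "fst b \<noteq> 0 \<or> snd b \<noteq> 0" using ab(2) by (auto simp: prod_eq_iff)
    then have "wedge (1, 0) b \<noteq> 0 \<or> wedge (0, 1) b \<noteq> 0" by (auto simp: wedge_def)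
    then show ?thesis using that by blast
  qed
  \<comment> \<open>Only the line of \<open>b\<close> is excluded in \<open>generic\<close>;
    shifting along \<open>b0\<close> leaves it, and continuity of \<open>G\<close> gives the
    rest.\<close>
  have "wedge (G v) (G w) = 0" for v w
  proof -
    have ev: "eventually (\<lambda>t. wedge (v + cscale t b0) b \<noteq> 0) (at 0)" for v
    proof (cases "wedge v b = 0")
      case True
      then have "wedge (v + cscale t b0) b = t * wedge b0 b" for t
        by (simp add: wedge_def cscale_def algebra_simps)
      then show ?thesis using b0 by (auto simp: eventually_at_filter)
    next
      case False
      have "((\<lambda>t. wedge (v + cscale t b0) b) \<longlongrightarrow> wedge (v + cscale 0 b0) b) (at 0)"
        by (intro tendsto_intros)
      moreover have "v + cscale 0 b0 = v" by (simp add: cscale_def zero_prod_def[symmetric])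
      ultimately show ?thesis using False by (auto intro: tendsto_imp_eventually_ne)
    qed
    have Gl: "((\<lambda>t. G (v + cscale t b0)) \<longlongrightarrow> G v) (at 0)" for v
    proof -
      have "((\<lambda>t. v + cscale t b0) \<longlongrightarrow> v + cscale 0 b0) (at 0)" by (intro tendsto_intros)
      moreover have "v + cscale 0 b0 = v" by (simp add: cscale_def zero_prod_def[symmetric])
      ultimately show ?thesis
        using isCont_tendsto_compose[OF forms_conv_continuous[OF conv]] by metis
    qed
    have "((\<lambda>t. wedge (G (v + cscale t b0)) (G (w + cscale t b0))) \<longlongrightarrow> wedge (G v) (G w)) (at 0)"
      by (intro tendsto_wedge Gl)
    moreover have "eventually (\<lambda>t. wedge (G (v + cscale t b0)) (G (w + cscale t b0)) = 0) (at 0)"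
      using ev[of v] ev[of w] by eventually_elim (rule generic)
    ultimately have "((\<lambda>t::complex. 0) \<longlongrightarrow> wedge (G v) (G w)) (at 0)"
      by (rule Lim_transform_eventually)
    then show ?thesis using tendsto_unique[OF _ _ tendsto_const] by (metis at_neq_bot)
  qed
  then show False using nd unfolding nondeg_def by blast
qed

text \<open>A map with totally invariant coordinates expands the distance between them by the factor \<open>d\<close>
  on the logarithmic scale.\<close>

lemma norm_power_le:
  assumes F: "ultra F" and d: "d > 0"
    and det: "\<And>k. mdet (A k) = 1" "\<And>k. mdet (A' k) = 1" "\<And>k. mdet (B k) = 1" "\<And>k. mdet (B' k) = 1"
    and l: "\<And>k. l k \<noteq> 0"
    and g: "\<And>k v. g k (lin (A k) v) = cscale (l k) (lin (A' k) (\<phi> k v))"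
    and g': "\<And>k v. g' k (lin (B k) v) = cscale (l' k) (lin (B' k) (\<phi> k v))"
    and conv: "forms_conv d F g G" and conv': "forms_conv d F g' G'"
    and nh: "nohole G" "nohole G'"
  obtains K where "K > 0"
    "eventually (\<lambda>k. norm (mmul (B k) (madj (A k))) ^ d \<le> K * norm (mmul (B' k) (madj (A' k)))) F"
proof -
  obtain K1 where K1: "K1 > 0" "eventually (\<lambda>k. \<forall>v. norm (g k v) \<le> K1 * norm v ^ d) F"
    by (rule forms_conv_bounded[OF F conv d])
  obtain K2 where K2: "K2 > 0" "eventually (\<lambda>k. \<forall>v. K2 * norm v ^ d \<le> norm (g k v)) F"
    by (rule forms_conv_bounded_below[OF F conv nh(1) d])
  obtain K3 where K3: "K3 > 0" "eventually (\<lambda>k. \<forall>v. norm (g' k v) \<le> K3 * norm v ^ d) F"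
    by (rule forms_conv_bounded[OF F conv' d])
  obtain K4 where K4: "K4 > 0" "eventually (\<lambda>k. \<forall>v. K4 * norm v ^ d \<le> norm (g' k v)) F"
    by (rule forms_conv_bounded_below[OF F conv' nh(2) d])
  define c where "c = min K2 K4"
  define K where "K = max K1 K3"
  have cK: "c > 0" "K > 0" using K1 K2 K3 K4 by (auto simp: c_def K_def)
  have "eventually (\<lambda>k. norm (mmul (B k) (madj (A k))) ^ d \<le>
      2 ^ d * K / c * norm (mmul (B' k) (madj (A' k)))) F"
    using K1(2) K2(2) K3(2) K4(2)
  proof eventually_elim
    case (elim k)
    let ?D = "mmul (B k) (madj (A k))" and ?E = "mmul (B' k) (madj (A' k))"
    define \<tau> where "\<tau> = cmod (l' k / l k)"
    define X where "X = c * (norm ?D / 2) ^ d"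
    have "K1 * norm v ^ d \<le> K * norm v ^ d" "K3 * norm v ^ d \<le> K * norm v ^ d" for v :: C2
      by (auto simp: K_def intro!: mult_right_mono)
    then have up: "norm (g k v) \<le> K * norm v ^ d" "norm (g' k v) \<le> K * norm v ^ d" for v
      using elim(1,3) by (meson order_trans)+
    have "c * norm v ^ d \<le> K2 * norm v ^ d" "c * norm v ^ d \<le> K4 * norm v ^ d" for v :: C2
      by (auto simp: c_def intro!: mult_right_mono)
    then have lo: "c * norm v ^ d \<le> norm (g k v)" "c * norm v ^ d \<le> norm (g' k v)" for v
      using elim(2,4) by (meson order_trans)+
    have dD: "mdet ?D = 1" and dE: "mdet ?E = 1" by (simp_all add: mdet_mmul det)
    have step: "norm (g' k (lin ?D w)) = \<tau> * norm (lin ?E (g k w))" for w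
      using rescaled_step_eq[of "A k" "A' k" "l k" "g k" "\<phi> k" "g' k" "B k" "l' k" "B' k", OF det(1,2) l g g', of w]
      by (simp add: \<tau>_def)
    have X1: "X \<le> \<tau> * norm ?E * K"
    proof -
      obtain e where e: "norm e = 1" "norm ?D \<le> 2 * norm (lin ?D e)" by (rule unit_vector_norm_lin_ge)
      have "X \<le> c * norm (lin ?D e) ^ d"
        unfolding X_def using e(2) cK(1) by (intro mult_left_mono power_mono) auto
      also have "\<dots> \<le> norm (g' k (lin ?D e))" by (rule lo)
      also have "\<dots> = \<tau> * norm (lin ?E (g k e))" by (rule step)
      also have "\<dots> \<le> \<tau> * (norm ?E * norm (g k e))"
        by (intro mult_left_mono norm_lin_le) (simp add: \<tau>_def)
      also have "\<dots> \<le> \<tau> * (norm ?E * K)"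
        using up(1)[of e] e(1) by (intro mult_left_mono) (auto simp: \<tau>_def)
      finally show ?thesis by (simp add: mult.assoc)
    qed
    \<comment> \<open>The same estimate in the opposite direction: the inverse of \<open>?D\<close>
      has the same norm, so some long vector \<open>w\<close> is mapped to a unit vector.\<close>
    have X2: "\<tau> * X \<le> K * norm ?E"
    proof -
      obtain e where e: "norm e = 1" "norm (madj ?D) \<le> 2 * norm (lin (madj ?D) e)"
        by (rule unit_vector_norm_lin_ge)
      define w where "w = lin (madj ?D) e"
      have w: "lin ?D w = e" unfolding w_def by (rule lin_madj'[OF dD])
      have "X \<le> c * norm w ^ d"
        unfolding X_def w_def using e(2) cK(1) by (intro mult_left_mono power_mono) auto
      also have "\<dots> \<le> norm (g k w)" by (rule lo)
      also have "\<dots> \<le> norm ?E * norm (lin ?E (g k w))" by (rule norm_lin_ge[OF dE])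
      finally have "\<tau> * X \<le> \<tau> * (norm ?E * norm (lin ?E (g k w)))"
        by (intro mult_left_mono) (auto simp: \<tau>_def)
      also have "\<dots> = norm ?E * norm (g' k (lin ?D w))" unfolding step by simp
      also have "\<dots> \<le> norm ?E * K"
        using up(2)[of e] e(1) unfolding w by (intro mult_left_mono) auto
      finally show ?thesis by (simp add: mult.commute)
    qed
    have "X \<ge> 0" using cK(1) by (simp add: X_def)
    \<comment> \<open>Multiplying \<open>X1\<close> and \<open>X2\<close> cancels
      \<open>\<tau>\<close>, the uncontrolled ratio of the normalising scalars.\<close>
    have "X * X \<le> (\<tau> * norm ?E * K) * X" using X1 \<open>X \<ge> 0\<close> by (rule mult_right_mono)
    also have "\<dots> = norm ?E * K * (\<tau> * X)" by (simp add: mult_ac)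
    also have "\<dots> \<le> norm ?E * K * (K * norm ?E)"
      using X2 cK(2) by (intro mult_left_mono) auto
    finally have "X\<^sup>2 \<le> (K * norm ?E)\<^sup>2" by (simp add: power2_eq_square mult_ac)
    then have "X \<le> K * norm ?E"
      by (rule power2_le_imp_le) (use cK(2) in simp)
    then show ?case
      using cK(1) by (simp add: X_def power_divide field_simps)
  qed
  then show ?thesis using that[of "2 ^ d * K / c"] cK by simp
qed

section \<open>The tower of rescaled limits\<close>

lemma tower_step:
  assumes F: "ultra F" and deg: "\<And>k. rat_degree (f k) = d" and d: "d > 0"
    and det: "\<And>k. mdet (A k) = 1"
  shows "\<exists>A' l g G. (\<forall>k. mdet (A' k) = 1) \<and> (\<forall>k. l k \<noteq> 0) \<and>
    (\<forall>k v. g k (lin (A k) v) = cscale (l k) (lin (A' k) (rat_lift (f k) v))) \<and>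
    forms_conv d F g G \<and> nondeg G"
proof -
  define h where "h k v = rat_lift (f k) (lin (madj (A k)) v)" for k v
  have nd: "nondeg (h k)" for k
  proof -
    obtain v w where "wedge (rat_lift (f k) v) (rat_lift (f k) w) \<noteq> 0"
      using nondeg_rat_lift[of "f k"] deg d unfolding nondeg_def by auto
    then have "wedge (h k (lin (A k) v)) (h k (lin (A k) w)) \<noteq> 0"
      by (simp add: h_def lin_madj det)
    then show ?thesis unfolding nondeg_def by blast
  qed
  have pf: "\<exists>p q. h k = pform d p q" for k
  proof -
    obtain p q where "\<And>v. pform d (coeff (rat_num (f k))) (coeff (rat_den (f k))) (lin (madj (A k)) v) = pform d p q v"
      by (rule pform_lin) blast
    then have "h k = pform d p q"
      by (simp add: h_def rat_lift_def deg fun_eq_iff)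
    then show ?thesis by blast
  qed
  obtain B l G where *: "\<And>k. mdet (B k) = 1" "\<And>k. l k \<noteq> 0"
    "forms_conv d F (\<lambda>k v. cscale (l k) (lin (B k) (h k v))) G" "nondeg G"
    by (rule forms_conv_extract[of F h d, OF F nd pf]) blast
  have "(\<forall>k. mdet (B k) = 1) \<and> (\<forall>k. l k \<noteq> 0) \<and>
    (\<forall>k v. cscale (l k) (lin (B k) (h k (lin (A k) v))) = cscale (l k) (lin (B k) (rat_lift (f k) v))) \<and>
    forms_conv d F (\<lambda>k v. cscale (l k) (lin (B k) (h k v))) G \<and> nondeg G"
    using * by (simp add: h_def lin_madj det)
  then show ?thesis
    by (intro exI[of _ B] exI[of _ l] exI[of _ "\<lambda>k v. cscale (l k) (lin (B k) (h k v))"] exI[of _ G])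
qed

locale rescaling_tower =
  fixes F :: "nat filter" and d :: nat and f :: "nat \<Rightarrow> complex poly fract"
    and M :: "nat \<Rightarrow> rsphere measure" and A :: "nat \<Rightarrow> nat \<Rightarrow> C2 \<times> C2"
    and l :: "nat \<Rightarrow> nat \<Rightarrow> complex" and g :: "nat \<Rightarrow> nat \<Rightarrow> C2 \<Rightarrow> C2" and G :: "nat \<Rightarrow> C2 \<Rightarrow> C2"
  assumes F: "ultra F" and d: "d \<ge> 2" and deg: "\<And>k. rat_degree (f k) = d"
    and ent: "\<And>k. is_max_entropy_measure (f k) (M k)"
    and det: "\<And>n k. mdet (A n k) = 1" and A0: "\<And>k. A 0 k = mone" and l: "\<And>n k. l n k \<noteq> 0"
    and g: "\<And>n k v. g n k (lin (A n k) v) = cscale (l n k) (lin (A (Suc n) k) (rat_lift (f k) v))"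
    and conv: "\<And>n. forms_conv d F (g n) (G n)" and nd: "\<And>n. nondeg (G n)"

lemma rescaling_tower_exists:
  assumes F: "ultra F" and d: "d \<ge> 2" and deg: "\<And>k. rat_degree (f k) = d"
    and ent: "\<And>k. is_max_entropy_measure (f k) (M k)"
  obtains A l g G where "rescaling_tower F d f M A l g G"
proof -
  \<comment> \<open>Only the matrices are chosen recursively; scalars, forms and limits stay
    existential and are picked afterwards for all levels.\<close>
  let ?Q = "\<lambda>A A'. \<exists>l g G. (\<forall>k. l k \<noteq> 0) \<and>
      (\<forall>k v. g k (lin (A k) v) = cscale (l k) (lin (A' k) (rat_lift (f k) v))) \<and>
      forms_conv d F g G \<and> nondeg G"
  have "\<exists>A. \<forall>n. ((\<forall>k. mdet (A n k) = 1) \<and> (n = 0 \<longrightarrow> A n = (\<lambda>k. mone))) \<and> ?Q (A n) (A (Suc n))"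
  proof (rule dependent_nat_choice)
    show "\<exists>A. (\<forall>k. mdet (A k) = 1) \<and> (0 = 0 \<longrightarrow> A = (\<lambda>k. mone))"
      by (intro exI[of _ "\<lambda>k. mone"]) simp
    fix A :: "nat \<Rightarrow> C2 \<times> C2" and n :: nat
    assume "(\<forall>k. mdet (A k) = 1) \<and> (n = 0 \<longrightarrow> A = (\<lambda>k. mone))"
    then have det: "\<And>k. mdet (A k) = 1" by blast
    have "d > 0" using d by simp
    obtain A' where "\<And>k. mdet (A' k) = 1" "?Q A A'"
      using tower_step[of F f d A, OF F deg \<open>d > 0\<close> det] by blast
    then show "\<exists>A'. ((\<forall>k. mdet (A' k) = 1) \<and> (Suc n = 0 \<longrightarrow> A' = (\<lambda>k. mone))) \<and> ?Q A A'"
      by (intro exI[of _ A']) simp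
  qed
  then obtain A where A: "\<forall>n. ((\<forall>k. mdet (A n k) = 1) \<and> (n = 0 \<longrightarrow> A n = (\<lambda>k. mone))) \<and> ?Q (A n) (A (Suc n))"
    by (rule exE)
  have A1: "mdet (A n k) = 1" for n k using spec[OF A, of n] by blast
  have A2: "A 0 = (\<lambda>k. mone)" using spec[OF A, of 0] by blast
  have "\<forall>n. ?Q (A n) (A (Suc n))" using A by (simp only: simp_thms)
  then have "\<exists>l g G. \<forall>n. (\<forall>k. l n k \<noteq> 0) \<and>
      (\<forall>k v. g n k (lin (A n k) v) = cscale (l n k) (lin (A (Suc n) k) (rat_lift (f k) v))) \<and>
      forms_conv d F (g n) (G n) \<and> nondeg (G n)"
    unfolding choice_iff .
  then obtain l g G where lg: "\<forall>n. (\<forall>k. l n k \<noteq> 0) \<and>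
      (\<forall>k v. g n k (lin (A n k) v) = cscale (l n k) (lin (A (Suc n) k) (rat_lift (f k) v))) \<and>
      forms_conv d F (g n) (G n) \<and> nondeg (G n)"
    by (elim exE)
  have "rescaling_tower F d f M A l g G"
  proof
    show "l n k \<noteq> 0" "g n k (lin (A n k) v) = cscale (l n k) (lin (A (Suc n) k) (rat_lift (f k) v))"
      "forms_conv d F (g n) (G n)" "nondeg (G n)" for n k v
      using spec[OF lg, of n] by simp_all
  qed (simp_all add: assms A1 A2)
  then show ?thesis by (rule that)
qed

context rescaling_tower
begin

lemma transport: "transport F d f M (A n) (A (Suc n)) (l n) (g n) (G n)"
  by unfold_locales (use F d deg ent det l g conv nd in auto)

lemma sets_M: "sets (M k) = sets borel" and prob_M: "prob_space (M k)"
  using max_entropy_measureD[OF ent] by blast+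

section \<open>Diffuse mass along the tower\<close>

definition \<delta> :: "nat \<Rightarrow> real" where
  "\<delta> n = Inf {c. c \<ge> 0 \<and> diffuse_le F M (A n) c}"

lemma diffuse_le_1: "diffuse_le F M (A n) 1"
  unfolding diffuse_le_def
proof (intro exI[of _ "{}"] conjI allI impI)
  fix \<epsilon> \<eta> :: real assume "\<eta> > 0"
  then have "measure (M k) (far_set (A n k) {} \<epsilon>) \<le> 1 + \<eta>" for k
    using prob_space.prob_le_1[OF prob_M, of k] by (meson add_increasing2 less_imp_le order_trans)
  then show "eventually (\<lambda>k. measure (M k) (far_set (A n k) {} \<epsilon>) \<le> 1 + \<eta>) F" by simp
qed auto

lemma \<delta>_le: "c \<ge> 0 \<Longrightarrow> diffuse_le F M (A n) c \<Longrightarrow> \<delta> n \<le> c"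
  unfolding \<delta>_def by (intro cInf_lower) (auto simp: bdd_below_def)

lemma \<delta>_greatest:
  assumes "\<And>c. c \<ge> 0 \<Longrightarrow> diffuse_le F M (A n) c \<Longrightarrow> b \<le> c"
  shows "b \<le> \<delta> n"
  unfolding \<delta>_def
proof (rule cInf_greatest)
  have "1 \<in> {c. c \<ge> 0 \<and> diffuse_le F M (A n) c}" using diffuse_le_1 by simp
  then show "{c. c \<ge> 0 \<and> diffuse_le F M (A n) c} \<noteq> {}" by blast
qed (use assms in simp)

lemma \<delta>_step: "\<delta> n \<le> \<delta> (Suc n)"
proof (intro \<delta>_greatest \<delta>_le)
  fix c assume "diffuse_le F M (A (Suc n)) c"
  then show "diffuse_le F M (A n) c" by (rule transport.diffuse_le_step[OF transport])
qed

lemma \<delta>_step_hole: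
  assumes "\<not> nohole (G n)"
  shows "\<delta> n \<le> (1 - 1 / real d) * \<delta> (Suc n)"
proof -
  have q: "1 - 1 / real d > 0" using d by simp
  \<comment> \<open>Division moves the factor, positive by \<open>d \<ge> 2\<close>, to the side
    where the infimum can be bounded term by term.\<close>
  have "\<delta> n / (1 - 1 / real d) \<le> \<delta> (Suc n)"
  proof (rule \<delta>_greatest)
    fix c assume c: "c \<ge> 0" "diffuse_le F M (A (Suc n)) c"
    have "\<delta> n \<le> (1 - 1 / real d) * c"
      by (rule \<delta>_le) (use q c(1) transport.diffuse_le_step_hole[OF transport c(2) assms] in auto)
    then show "\<delta> n / (1 - 1 / real d) \<le> c" using q by (simp add: pos_divide_le_eq mult.commute)
  qed
  then show ?thesis using q by (simp add: pos_divide_le_eq mult.commute)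
qed

lemma \<delta>_mono: "n \<le> m \<Longrightarrow> \<delta> n \<le> \<delta> m"
  using \<delta>_step by (rule lift_Suc_mono_le)

lemma \<delta>_bnd:
  assumes "bnd F (A n) (A m)"
  shows "\<delta> n \<le> \<delta> m"
proof (intro \<delta>_greatest \<delta>_le)
  fix c assume "diffuse_le F M (A m) c"
  then show "diffuse_le F M (A n) c"
    by (rule diffuse_le_bnd[OF F assms det det sets_M prob_space.finite_measure[OF prob_M]])
qed

section \<open>Recurrence of the coordinates\<close>

lemma recurrence:
  assumes "\<delta> 0 > 0"
  obtains n m where "n < m" "bnd F (A n) (A m)"
proof -
  \<comment> \<open>Half of \<open>\<delta> 0\<close> lies strictly below every
    \<open>\<delta> n\<close>, so each level violates this bound, and \<open>N\<close> disjoint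
    parts would exceed total mass one.\<close>
  obtain N where N: "1 < real N * (\<delta> 0 / 2)"
    using ex_less_of_nat_mult[of "\<delta> 0 / 2" 1] assms by auto
  have "\<exists>n m. n < m \<and> bnd F (A n) (A m)"
  proof (rule ccontr)
    assume *: "\<not> ?thesis"
    have "real N * (\<delta> 0 / 2) \<le> 1"
    proof (rule diffuse_pigeonhole[OF F det sets_M prob_M])
      show "\<not> bnd F (A n) (A m)" if "n < m" for n m using * that by blast
      show "\<not> diffuse_le F M (A n) (\<delta> 0 / 2)" for n
      proof
        assume "diffuse_le F M (A n) (\<delta> 0 / 2)"
        then have "\<delta> n \<le> \<delta> 0 / 2" using assms by (intro \<delta>_le) auto
        then show False using \<delta>_mono[of 0 n] assms by simp
      qed
    qed
    with N show False by simp
  qed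
  then show ?thesis using that by blast
qed

text \<open>\<open>\<delta>\<close> increases along the levels and is equal at the two ends of a
  return, hence constant in between; being positive, it leaves no room for the contraction that a
  hole would cause.\<close>

lemma nohole_recurrence:
  assumes pos: "\<delta> 0 > 0" and nm: "bnd F (A n) (A m)" and i: "n \<le> i" "i < m"
  shows "nohole (G i)"
proof (rule ccontr)
  assume "\<not> nohole (G i)"
  then have "\<delta> i \<le> (1 - 1 / real d) * \<delta> (Suc i)" by (rule \<delta>_step_hole)
  also have "\<dots> \<le> (1 - 1 / real d) * \<delta> i"
  proof (rule mult_left_mono)
    have "\<delta> (Suc i) \<le> \<delta> m" using i by (intro \<delta>_mono) auto
    also have "\<dots> \<le> \<delta> n" by (rule \<delta>_bnd[OF bnd_sym[OF nm]])
    also have "\<dots> \<le> \<delta> i" by (rule \<delta>_mono[OF i(1)])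
    finally show "\<delta> (Suc i) \<le> \<delta> i" .
  qed (use d in simp)
  finally have "\<delta> i / real d \<le> 0" by (simp add: algebra_simps)
  moreover have "\<delta> i > 0" using pos \<delta>_mono[of 0 i] by simp
  ultimately show False using d by (simp add: divide_le_0_iff)
qed

text \<open>Minimality: a return from \<open>n + 1\<close> to \<open>m\<close> pulls back, through
  the hole-free step before \<open>m\<close>, to a return from \<open>n\<close> to
  \<open>m - 1\<close>.\<close>

lemma recurrence_0:
  assumes pos: "\<delta> 0 > 0"
  obtains p where "p > 0" "bnd F (A 0) (A p)"
proof -
  define P where "P n \<longleftrightarrow> (\<exists>m>n. bnd F (A n) (A m))" for n
  have "\<exists>n. P n" using recurrence[OF pos] unfolding P_def by blast
  then have P: "P (LEAST n. P n)" by (rule LeastI_ex)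
  have L0: "(LEAST n. P n) = 0"
  proof (rule ccontr)
    assume "(LEAST n. P n) \<noteq> 0"
    then obtain n where n: "(LEAST n. P n) = Suc n" using not0_implies_Suc by blast
    have "P (Suc n)" using P unfolding n .
    then obtain m where m: "m > Suc n" "bnd F (A (Suc n)) (A m)" unfolding P_def by blast
    then obtain m' where m': "m = Suc m'" by (cases m) auto
    have nh: "nohole (G m')"
      by (rule nohole_recurrence[OF pos m(2)]) (use m(1) m' in auto)
    have "d > 0" using d by simp
    have "bnd F (A n) (A m')"
      by (rule bnd_backward[where A = "A n" and A' = "A (Suc n)" and B = "A m'" and B' = "A (Suc m')"
          and l = "l n" and l' = "l m'" and \<phi> = "\<lambda>k. rat_lift (f k)"
          and g = "g n" and g' = "g m'" and G = "G n" and G' = "G m'", OF F \<open>d > 0\<close> det det det det l g g conv conv nd nh])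
         (use m(2) m' in simp)
    then have "P n" using m(1) m' unfolding P_def by auto
    then have "(LEAST n. P n) \<le> n" by (rule Least_le)
    then show False using n by simp
  qed
  have "P 0" using P unfolding L0 .
  then show ?thesis using that unfolding P_def by blast
qed

text \<open>All pairs of levels of the cycle are estimated together. One step raises the norm of a
  quotient to the power \<open>d\<close> up to constants, and stepping past \<open>p\<close> returns
  to the cycle at bounded cost; so the largest norm controls its own \<open>d\<close>-th
  power.\<close>

lemma bnd_1_0:
  assumes pos: "\<delta> 0 > 0"
  shows "bnd F (A 1) (A 0)" "nohole (G 0)"
proof -
  obtain p where p: "p > 0" "bnd F (A 0) (A p)" by (rule recurrence_0[OF pos])
  have nh: "nohole (G i)" if "i < p" for i
    by (rule nohole_recurrence[OF pos p(2)]) (use that in auto)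
  then show "nohole (G 0)" using p(1) by simp
  have d0: "d > 0" using d by simp
  define w where "w i = (if i = p then 0 else i)" for i
  have w: "bnd F (A i) (A (w i))" for i
    using bnd_sym[OF p(2)] bnd_refl[of "A i" F] det by (auto simp: w_def)
  let ?D = "\<lambda>i j k. norm (mmul (A i k) (madj (A j k)))"
  define I where "I = {..<p} \<times> {..<p}"
  have "\<exists>K>0. eventually (\<lambda>k. ?D i j k ^ d \<le> K * ?D (w (Suc i)) (w (Suc j)) k) F"
    if ij: "i < p" "j < p" for i j
  proof -
    obtain K1 where K1: "K1 > 0" "eventually (\<lambda>k. ?D i j k ^ d \<le> K1 * ?D (Suc i) (Suc j) k) F"
      by (rule norm_power_le[where A = "A j" and A' = "A (Suc j)" and B = "A i" and B' = "A (Suc i)"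
          and l = "l j" and l' = "l i" and \<phi> = "\<lambda>k. rat_lift (f k)"
          and g = "g j" and g' = "g i" and G = "G j" and G' = "G i", OF F d0 det det det det l g g conv conv nh[OF ij(2)] nh[OF ij(1)]])
    obtain K2 where K2: "K2 > 0"
      "eventually (\<lambda>k. ?D (Suc i) (Suc j) k \<le> K2 * ?D (w (Suc i)) (w (Suc j)) k) F"
      by (rule bnd_norm_le[OF w w det det])
    have "eventually (\<lambda>k. ?D i j k ^ d \<le> K1 * K2 * ?D (w (Suc i)) (w (Suc j)) k) F"
      using K1(2) K2(2)
    proof eventually_elim
      case (elim k)
      note elim(1)
      also have "K1 * ?D (Suc i) (Suc j) k \<le> K1 * (K2 * ?D (w (Suc i)) (w (Suc j)) k)"
        using elim(2) K1(1) by (intro mult_left_mono) auto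
      finally show ?case by (simp add: mult.assoc)
    qed
    then show ?thesis using K1(1) K2(1) by (intro exI[of _ "K1 * K2"]) simp
  qed
  then have "\<forall>x\<in>I. \<exists>K. K > 0 \<and>
      eventually (\<lambda>k. ?D (fst x) (snd x) k ^ d \<le> K * ?D (w (Suc (fst x))) (w (Suc (snd x))) k) F"
    unfolding I_def by auto
  then obtain K where K: "\<And>x. x \<in> I \<Longrightarrow> K x > 0" "\<And>x. x \<in> I \<Longrightarrow>
      eventually (\<lambda>k. ?D (fst x) (snd x) k ^ d \<le> K x * ?D (w (Suc (fst x))) (w (Suc (snd x))) k) F"
    unfolding bchoice_iff by blast
  have fI: "finite I" by (simp add: I_def)
  \<comment> \<open>Including 1 ensures that \<open>t > L\<close> gives
    \<open>t * t \<le> t ^ d\<close>.\<close>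
  define L where "L = Max (insert 1 (K ` I))"
  have L: "L \<ge> 1" "\<And>x. x \<in> I \<Longrightarrow> K x \<le> L" using fI by (auto simp: L_def)
  have "eventually (\<lambda>k. \<forall>x\<in>I. ?D (fst x) (snd x) k ^ d \<le> K x * ?D (w (Suc (fst x))) (w (Suc (snd x))) k) F"
    using fI K(2) by (intro eventually_ball_finite) auto
  then have bound: "eventually (\<lambda>k. \<forall>x\<in>I. ?D (fst x) (snd x) k \<le> L) F"
  proof eventually_elim
    case (elim k)
    let ?n = "\<lambda>x. ?D (fst x) (snd x) k"
    define t where "t = Max (?n ` I)"
    have ne: "?n ` I \<noteq> {}" using p(1) by (auto simp: I_def)
    have t: "?n x \<le> t" if "x \<in> I" for x unfolding t_def using fI that by (intro Max_ge) auto
    have "t \<in> ?n ` I" unfolding t_def by (rule Max_in) (use fI ne in auto)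
    then obtain x where x: "x \<in> I" "t = ?n x" by blast
    have "(w (Suc (fst x)), w (Suc (snd x))) \<in> I" using x(1) p(1) by (auto simp: I_def w_def)
    from t[OF this] have t': "?D (w (Suc (fst x))) (w (Suc (snd x))) k \<le> t" unfolding fst_conv snd_conv .
    have "t ^ d \<le> K x * ?D (w (Suc (fst x))) (w (Suc (snd x))) k"
      unfolding x(2) using elim x(1) by blast
    also have "\<dots> \<le> K x * t"
      using t' K(1)[OF x(1)] by (intro mult_left_mono) auto
    finally have "t ^ d \<le> K x * t" .
    have "mmul (A (fst x) k) (madj (A (snd x) k)) \<noteq> 0"
    proof
      assume "mmul (A (fst x) k) (madj (A (snd x) k)) = 0"
      then have "mdet (mmul (A (fst x) k) (madj (A (snd x) k))) = 0" by (simp only: mdet_def) simp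
      then show False by (simp add: mdet_mmul det)
    qed
    then have t0: "t > 0" by (simp add: x(2))
    have "t \<le> L"
    proof (rule ccontr)
      assume "\<not> t \<le> L"
      then have tL: "t > L" by simp
      have "t * t \<le> t ^ d"
        using power_increasing[of 2 d t] d tL L(1) by (simp add: power2_eq_square)
      also have "\<dots> \<le> K x * t" by fact
      also have "\<dots> \<le> L * t" using L(2)[OF x(1)] t0 by simp
      finally show False using tL t0 by simp
    qed
    then show ?case using t by (meson order_trans)
  qed
  show "bnd F (A 1) (A 0)"
  proof (cases "p = 1")
    case True
    then show ?thesis using bnd_sym[OF p(2)] by simp
  next
    case False
    then have "(1, 0) \<in> I" using p(1) by (auto simp: I_def)
    then show ?thesis
      unfolding bnd_def using bound by (intro exI[of _ L]) (auto elim!: eventually_mono)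
  qed
qed

end

section \<open>Convergence in the space of rational maps\<close>

lemma hform_inject:
  assumes "\<And>v. hform d p v = hform d q v" "i \<le> d"
  shows "p i = q i"
proof -
  have "hform d (\<lambda>i. 1 * p i + (- 1) * q i) v = 0" for v
    unfolding hform_linear using assms(1) by simp
  then have "1 * p i + (- 1) * q i = 0"
    using hform_eq_0_iff[of d "\<lambda>i. 1 * p i + (- 1) * q i"] assms(2) by blast
  then show ?thesis by simp
qed

text \<open>Absence of common zeros amounts to coprimality at finite points and to exact degree
  \<open>d\<close> at infinity. The factor \<open>c\<close> makes the denominator monic, as the
  normalised representative requires.\<close>

lemma rat_of_forms:
  assumes d: "d > 0" and nh: "nohole (pform d P Q)"
  obtains \<phi> c where "\<phi> \<in> Rat_set d" "c \<noteq> 0"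
    "\<And>i. i \<le> d \<Longrightarrow> coeff (rat_num \<phi>) i = c * P i" "\<And>i. i \<le> d \<Longrightarrow> coeff (rat_den \<phi>) i = c * Q i"
proof -
  define poly_of where "poly_of R = (\<Sum>i\<le>d. monom (R i) i)" for R :: "nat \<Rightarrow> complex"
  have co: "coeff (poly_of R) i = (if i \<le> d then R i else 0)" for R i
    by (simp add: poly_of_def coeff_sum)
  have deg: "degree (poly_of R) \<le> d" for R
    by (rule degree_le) (simp add: co)
  have po: "poly (poly_of R) z = hform d R (z, 1)" for R z
    unfolding hform_coeff[OF deg, symmetric] by (simp add: hform_def co)
  have zero: False if "v \<noteq> 0" "hform d P v = 0" "hform d Q v = 0" for v
    using nh that unfolding nohole_def pform_def by (auto simp: zero_prod_def)
  have e1: "(z, 1) \<noteq> (0 :: C2)" and e2: "(1, 0) \<noteq> (0 :: C2)" for z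
    by (auto simp: zero_prod_def)
  have top: "P d \<noteq> 0 \<or> Q d \<noteq> 0"
    using zero[OF e2] by (auto simp: hform_infty)
  \<comment> \<open>Otherwise \<open>P\<close> would be a polynomial of positive degree
    \<open>d\<close>, and any of its roots a common zero.\<close>
  have Q0: "poly_of Q \<noteq> 0"
  proof
    assume Q: "poly_of Q = 0"
    then have Qd: "Q i = 0" if "i \<le> d" for i using co[of Q i] that by simp
    then have Qz: "hform d Q v = 0" for v by (simp add: hform_def)
    have "P d \<noteq> 0" using top Qd[of d] by simp
    then have "degree (poly_of P) = d"
      using le_degree[of "poly_of P" d] deg[of P] by (simp add: co)
    then have "\<not> constant (poly (poly_of P))" using d by (simp add: constant_degree)
    then obtain z where "poly (poly_of P) z = 0" using fundamental_theorem_of_algebra by blast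
    then show False using zero[OF e1, of z] Qz by (simp add: po)
  qed
  define c where "c = 1 / lead_coeff (poly_of Q)"
  have c0: "c \<noteq> 0" using Q0 by (simp add: c_def)
  define num where "num = smult c (poly_of P)"
  define den where "den = smult c (poly_of Q)"
  have pnum: "poly num z = c * hform d P (z, 1)" and pden: "poly den z = c * hform d Q (z, 1)" for z
    by (simp_all add: num_def den_def po)
  have "coprime num den"
  proof (rule coprimeI)
    fix h assume h: "h dvd num" "h dvd den"
    show "is_unit h"
    proof (rule ccontr)
      assume nu: "\<not> is_unit h"
      have "h \<noteq> 0" using h(2) Q0 c0 by (auto simp: den_def)
      then have "degree h \<noteq> 0" using nu by (simp add: is_unit_iff_degree)
      then have "\<not> constant (poly h)" by (simp add: constant_degree)
      then obtain z where "poly h z = 0" using fundamental_theorem_of_algebra by blast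
      then have "poly num z = 0" "poly den z = 0"
        using h by (auto elim!: dvdE)
      then show False using zero[OF e1, of z] c0 by (simp add: pnum pden)
    qed
  qed
  moreover have "lead_coeff den = 1" using Q0 by (simp add: den_def c_def)
  then have "unit_factor den = 1" by (simp add: unit_factor_poly_def one_pCons)
  ultimately have "(num, den) \<in> normalized_fracts" by (simp add: normalized_fracts_def)
  then have q: "quot_of_fract (quot_to_fract (num, den)) = (num, den)"
    by (rule quot_of_fract_quot_to_fract')
  define \<phi> where "\<phi> = quot_to_fract (num, den)"
  have nd: "rat_num \<phi> = num" "rat_den \<phi> = den" by (simp_all add: rat_num_def rat_den_def \<phi>_def q)
  show ?thesis
  proof (rule that[of \<phi> c])
    have "degree num \<le> d" "degree den \<le> d" using deg c0 by (simp_all add: num_def den_def)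
    moreover have "degree num \<ge> d \<or> degree den \<ge> d"
      using top c0 by (auto simp: num_def den_def co intro!: le_degree)
    ultimately show "\<phi> \<in> Rat_set d"
      by (auto simp: Rat_set_def rat_degree_def nd)
    show "c \<noteq> 0" by (rule c0)
    show "coeff (rat_num \<phi>) i = c * P i" "coeff (rat_den \<phi>) i = c * Q i" if "i \<le> d" for i
      unfolding nd num_def den_def using that by (simp_all add: co)
  qed
qed

lemma rat_coeffs_nonzero:
  assumes "f \<in> Rat_set d"
  shows "rat_coeffs d f \<in> nonzero_vecs (2 * d + 1)"
proof -
  have dd: "degree (rat_den f) \<le> d" using assms rat_degree_ge(2)[of f] by (simp add: Rat_set_def)
  have "rat_coeffs d f (2 * d + 1 - degree (rat_den f)) \<noteq> 0"
    using dd by (simp add: rat_coeffs_def)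
  then have "\<exists>i\<le>2 * d + 1. rat_coeffs d f i \<noteq> 0" by (intro exI[of _ "2 * d + 1 - degree (rat_den f)"]) simp
  then show ?thesis by (simp add: nonzero_vecs_def rat_coeffs_def)
qed

lemma proj_point_cmult:
  assumes "c \<noteq> 0"
  shows "proj_point (\<lambda>i. c * v i) = proj_point v"
proof -
  have 1: "(\<lambda>i. a * (c * v i)) \<in> proj_point v" if "a \<noteq> 0" for a
    unfolding proj_point_def mem_Collect_eq using that assms
    by (intro exI[of _ "a * c"]) (simp add: mult.assoc)
  have 2: "(\<lambda>i. a * v i) \<in> proj_point (\<lambda>i. c * v i)" if "a \<noteq> 0" for a
    unfolding proj_point_def mem_Collect_eq using that assms
    by (intro exI[of _ "a / c"]) simp
  show ?thesis
  proof
    show "proj_point (\<lambda>i. c * v i) \<subseteq> proj_point v"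
      using 1 by (subst proj_point_def) (simp add: subset_iff, metis)
    show "proj_point v \<subseteq> proj_point (\<lambda>i. c * v i)"
      using 2 by (subst proj_point_def) (simp add: subset_iff, metis)
  qed
qed

text \<open>Rescaling a coefficient vector does not change its projective point, so coordinatewise
  convergence after rescaling suffices: open sets of the projective space are tested on
  vectors.\<close>

lemma limitin_Rat_topology:
  assumes f: "\<And>j. f j \<in> Rat_set d" and \<phi>: "\<phi> \<in> Rat_set d" and c: "\<And>j. c j \<noteq> 0"
    and lim: "\<And>i. i \<le> 2 * d + 1 \<Longrightarrow> (\<lambda>j. c j * rat_coeffs d (f j) i) \<longlonglongrightarrow> rat_coeffs d \<phi> i"
  shows "limitin (Rat_topology d) f \<phi> sequentially"
proof -
  let ?V = "nonzero_vecs (2 * d + 1)"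
  define w where "w j = (\<lambda>i. c j * rat_coeffs d (f j) i)" for j
  have "(\<lambda>j. w j i) \<longlonglongrightarrow> rat_coeffs d \<phi> i" for i
  proof (cases "i \<le> 2 * d + 1")
    case False
    then show ?thesis by (simp add: w_def rat_coeffs_def)
  qed (simp add: w_def lim)
  then have "limitin (product_topology (\<lambda>_. euclidean) UNIV) w (rat_coeffs d \<phi>) sequentially"
    unfolding limitin_componentwise by simp
  then have wlim: "w \<longlonglongrightarrow> rat_coeffs d \<phi>"
    unfolding euclidean_product_topology by simp
  have pw: "proj_point (w j) = proj_point (rat_coeffs d (f j))" for j
    unfolding w_def by (rule proj_point_cmult[OF c])
  have wV: "w j \<in> ?V" for j
    using rat_coeffs_nonzero[OF f[of j]] c[of j] by (auto simp: w_def nonzero_vecs_def)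
  have V\<phi>: "rat_coeffs d \<phi> \<in> ?V" by (rule rat_coeffs_nonzero[OF \<phi>])
  show ?thesis
    unfolding limitin_def
  proof (intro conjI allI impI)
    show "\<phi> \<in> topspace (Rat_topology d)"
      unfolding Rat_topology_def topspace_pullback_topology topspace_proj_space using V\<phi> \<phi> by blast
    fix U assume U: "openin (Rat_topology d) U \<and> \<phi> \<in> U"
    then obtain W where W: "openin (proj_space (2 * d + 1)) W"
      "U = (\<lambda>f. proj_point (rat_coeffs d f)) -` W \<inter> Rat_set d"
      unfolding Rat_topology_def openin_pullback_topology by blast
    then have "openin (top_of_set ?V) {v \<in> ?V. proj_point v \<in> W}"
      unfolding openin_proj_space by blast
    then obtain T where T: "open T" "{v \<in> ?V. proj_point v \<in> W} = ?V \<inter> T"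
      unfolding openin_open by blast
    have "rat_coeffs d \<phi> \<in> T" using T(2) V\<phi> U W(2) by blast
    then have "eventually (\<lambda>j. w j \<in> T) sequentially"
      using topological_tendstoD[OF wlim T(1)] by blast
    then show "eventually (\<lambda>j. f j \<in> U) sequentially"
    proof eventually_elim
      case (elim j)
      then have "proj_point (w j) \<in> W" using T(2) wV by blast
      then show ?case unfolding W(2) using pw f by simp
    qed
  qed
qed

text \<open>The ultrafilter limit is realised by indices \<open>r j \<ge> j\<close> with errors
  below \<open>1 / (j + 1)\<close>. The selected maps together with their limit form a compact set
  that the original sequence meets at arbitrarily large indices.\<close>

lemma not_diverges_in_Rat:
  assumes F: "F \<noteq> bot" "F \<le> sequentially"
    and f: "\<And>k. f k \<in> Rat_set d" and \<phi>: "\<phi> \<in> Rat_set d" and c: "\<And>k. c k \<noteq> 0"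
    and lim: "\<And>i. i \<le> 2 * d + 1 \<Longrightarrow> ((\<lambda>k. c k * rat_coeffs d (f k) i) \<longlongrightarrow> rat_coeffs d \<phi> i) F"
  shows "\<not> diverges_in_Rat d f"
proof
  assume div: "diverges_in_Rat d f"
  have "\<exists>k\<ge>j. \<forall>i\<in>{..2 * d + 1}. dist (c k * rat_coeffs d (f k) i) (rat_coeffs d \<phi> i) < inverse (real (Suc j))" for j
  proof -
    have "eventually (\<lambda>k. \<forall>i\<in>{..2 * d + 1}. dist (c k * rat_coeffs d (f k) i) (rat_coeffs d \<phi> i) < inverse (real (Suc j))) F"
      using lim by (intro eventually_ball_finite ballI) (auto intro!: tendstoD)
    moreover have "eventually (\<lambda>k. k \<ge> j) F"
      using F(2) eventually_ge_at_top filter_leD by blast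
    ultimately have "eventually (\<lambda>k. k \<ge> j \<and> (\<forall>i\<in>{..2 * d + 1}. dist (c k * rat_coeffs d (f k) i) (rat_coeffs d \<phi> i) < inverse (real (Suc j)))) F"
      by eventually_elim blast
    from eventually_happens'[OF F(1) this] show ?thesis .
  qed
  then have "\<forall>j. \<exists>k. k \<ge> j \<and> (\<forall>i\<in>{..2 * d + 1}. dist (c k * rat_coeffs d (f k) i) (rat_coeffs d \<phi> i) < inverse (real (Suc j)))"
    by blast
  then have "\<exists>r. \<forall>j. r j \<ge> j \<and> (\<forall>i\<in>{..2 * d + 1}. dist (c (r j) * rat_coeffs d (f (r j)) i) (rat_coeffs d \<phi> i) < inverse (real (Suc j)))"
    unfolding choice_iff .
  then obtain r where "\<forall>j. r j \<ge> j \<and> (\<forall>i\<in>{..2 * d + 1}. dist (c (r j) * rat_coeffs d (f (r j)) i) (rat_coeffs d \<phi> i) < inverse (real (Suc j)))"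
    by (rule exE)
  then have r: "r j \<ge> j"
    "i \<le> 2 * d + 1 \<Longrightarrow> dist (c (r j) * rat_coeffs d (f (r j)) i) (rat_coeffs d \<phi> i) < inverse (real (Suc j))" for i j
    by simp_all
  have lim': "limitin (Rat_topology d) (\<lambda>j. f (r j)) \<phi> sequentially"
  proof (rule limitin_Rat_topology[OF f \<phi> c])
    fix i assume i: "i \<le> 2 * d + 1"
    show "(\<lambda>j. c (r j) * rat_coeffs d (f (r j)) i) \<longlonglongrightarrow> rat_coeffs d \<phi> i"
      unfolding tendsto_dist_iff[of _ "rat_coeffs d \<phi> i"]
      by (rule tendsto_sandwich[OF _ _ tendsto_const LIMSEQ_inverse_real_of_nat])
         (use r(2)[OF i] in \<open>auto intro!: always_eventually less_imp_le\<close>)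
  qed
  have "f (r j) \<in> topspace (Rat_topology d)" for j
    unfolding Rat_topology_def topspace_pullback_topology topspace_proj_space
    using rat_coeffs_nonzero[OF f] f by blast
  then have "compactin (Rat_topology d) (insert \<phi> (range (\<lambda>j. f (r j))))"
    by (intro compactin_sequence_with_limit[OF lim']) auto
  then have "eventually (\<lambda>k. f k \<notin> insert \<phi> (range (\<lambda>j. f (r j)))) sequentially"
    using div unfolding diverges_in_Rat_def by blast
  then obtain N where N: "\<And>k. k \<ge> N \<Longrightarrow> f k \<notin> insert \<phi> (range (\<lambda>j. f (r j)))"
    unfolding eventually_sequentially by blast
  from N[OF r(1)] show False by blast
qed

text \<open>Bounded \<open>A k\<close> have convergent inverses. Applying these to
  \<open>g k\<close> shows that the rescaled coefficients of \<open>f k\<close> converge to a pair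
  that still has no hole, hence to an element of \<open>Rat_set d\<close>.\<close>

lemma nohole_not_diverges:
  assumes F: "ultra F" "F \<le> sequentially" and d: "d > 0" and f: "\<And>k. f k \<in> Rat_set d"
    and det: "\<And>k. mdet (A k) = 1" and bnd: "bnd F A (\<lambda>k. mone)" and l: "\<And>k. l k \<noteq> 0"
    and g: "\<And>k v. g k v = cscale (l k) (lin (A k) (rat_lift (f k) v))"
    and conv: "forms_conv d F g G" and nh: "nohole G"
  shows "\<not> diverges_in_Rat d f"
proof -
  obtain L where L: "((\<lambda>k. mmul (A k) (madj mone)) \<longlongrightarrow> L) F" "mdet L = 1"
    by (rule bnd_tendsto[OF F(1) bnd det]) simp_all
  then have AL: "(A \<longlongrightarrow> L) F" by simp
  obtain p q P Q where pq: "\<And>k v. g k v = pform d (p k) (q k) v" "G = pform d P Q"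
     "\<And>i. i \<le> d \<Longrightarrow> ((\<lambda>k. p k i) \<longlongrightarrow> P i) F" "\<And>i. i \<le> d \<Longrightarrow> ((\<lambda>k. q k i) \<longlongrightarrow> Q i) F"
    using conv unfolding forms_conv_def by blast
  define num where "num M p q = (\<lambda>i. fst (fst M) * p i + fst (snd M) * q i)" for M :: "C2 \<times> C2" and p q :: "nat \<Rightarrow> complex"
  define den where "den M p q = (\<lambda>i. snd (fst M) * p i + snd (snd M) * q i)" for M :: "C2 \<times> C2" and p q :: "nat \<Rightarrow> complex"
  have linp: "lin M (pform d p q v) = pform d (num M p q) (den M p q) v" for M p q v
    unfolding num_def den_def by (rule lin_pform)
  let ?M = "\<lambda>k. madj (A k)"
  have adj_lim: "(?M \<longlongrightarrow> madj L) F" by (rule tendsto_madj[OF AL])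
  have degk: "rat_degree (f k) = d" for k using f by (simp add: Rat_set_def)
  have eq: "cscale (l k) (rat_lift (f k) v) = pform d (num (?M k) (p k) (q k)) (den (?M k) (p k) (q k)) v" for k v
    unfolding linp[symmetric] pq(1)[symmetric] g lin_cscale by (simp add: lin_madj det)
  have coef: "l k * coeff (rat_num (f k)) i = num (?M k) (p k) (q k) i"
    "l k * coeff (rat_den (f k)) i = den (?M k) (p k) (q k) i" if "i \<le> d" for k i
  proof -
    have h: "hform d (\<lambda>i. l k * coeff R i) v = l k * hform d (coeff R) v" for R v
      by (simp add: hform_def sum_distrib_left mult.assoc)
    have hh: "hform d (\<lambda>i. l k * coeff (rat_num (f k)) i) v = hform d (num (?M k) (p k) (q k)) v"
      "hform d (\<lambda>i. l k * coeff (rat_den (f k)) i) v = hform d (den (?M k) (p k) (q k)) v" for v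
      using eq[of k v] unfolding h by (simp_all add: rat_lift_def pform_def cscale_def degk)
    show "l k * coeff (rat_num (f k)) i = num (?M k) (p k) (q k) i"
      by (rule hform_inject[OF hh(1) that])
    show "l k * coeff (rat_den (f k)) i = den (?M k) (p k) (q k) i"
      by (rule hform_inject[OF hh(2) that])
  qed
  have lim: "((\<lambda>k. l k * coeff (rat_num (f k)) i) \<longlongrightarrow> num (madj L) P Q i) F"
    "((\<lambda>k. l k * coeff (rat_den (f k)) i) \<longlongrightarrow> den (madj L) P Q i) F" if "i \<le> d" for i
    unfolding coef[OF that] num_def den_def by (intro tendsto_intros adj_lim pq that)+
  have "nohole (pform d (num (madj L) P Q) (den (madj L) P Q))"
    unfolding nohole_def linp[symmetric] pq(2)[symmetric]
    using nh lin_eq_0_iff[of "madj L"] L(2) by (simp add: nohole_def)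
  then obtain \<phi> c where \<phi>: "\<phi> \<in> Rat_set d" "c \<noteq> 0"
    "\<And>i. i \<le> d \<Longrightarrow> coeff (rat_num \<phi>) i = c * num (madj L) P Q i"
    "\<And>i. i \<le> d \<Longrightarrow> coeff (rat_den \<phi>) i = c * den (madj L) P Q i"
    using rat_of_forms[OF d] by blast
  show ?thesis
  proof (rule not_diverges_in_Rat[OF ultra_not_bot[OF F(1)] F(2) f \<phi>(1), where c = "\<lambda>k. c * l k"])
    show "c * l k \<noteq> 0" for k using \<phi>(2) l by simp
    fix i assume i: "i \<le> 2 * d + 1"
    show "((\<lambda>k. c * l k * rat_coeffs d (f k) i) \<longlongrightarrow> rat_coeffs d \<phi> i) F"
    proof (cases "i \<le> d")
      case True
      then show ?thesis
        using tendsto_mult[OF tendsto_const lim(1)[of "d - i"], of c]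
        by (simp add: rat_coeffs_def \<phi>(3) mult.assoc)
    next
      case False
      then have "2 * d + 1 - i \<le> d" by simp
      then show ?thesis
        using tendsto_mult[OF tendsto_const lim(2)[of "2 * d + 1 - i"], of c] False i
        by (simp add: rat_coeffs_def \<phi>(4) mult.assoc)
    qed
  qed
qed

section \<open>Atomic limits\<close>

lemma far_set_exhaust:
  assumes "finite S"
  shows "{x. \<forall>s\<in>S. wedge (sg x) s \<noteq> 0} = (\<Union>m. far_set mone S (inverse (real (Suc m))))"
proof (intro set_eqI iffI)
  fix x assume x: "x \<in> {x. \<forall>s\<in>S. wedge (sg x) s \<noteq> 0}"
  define e where "e = Min (insert 1 ((\<lambda>s. cmod (wedge (sg x) s)) ` S))"
  have e: "e > 0" "\<And>s. s \<in> S \<Longrightarrow> e \<le> cmod (wedge (sg x) s)"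
    using x assms by (auto simp: e_def)
  have n: "norm (sg x) > 0" by simp
  then obtain m where m: "inverse (real (Suc m)) < e / norm (sg x)"
    using reals_Archimedean[of "e / norm (sg x)"] e(1) by auto
  have "inverse (real (Suc m)) * norm (sg x) \<le> e"
    using m n by (simp add: less_divide_eq less_imp_le)
  then have "x \<in> far_set mone S (inverse (real (Suc m)))"
    unfolding far_set_def far_def lin_mone using e(2) by (blast intro: order_trans)
  then show "x \<in> (\<Union>m. far_set mone S (inverse (real (Suc m))))" by blast
next
  fix x assume "x \<in> (\<Union>m. far_set mone S (inverse (real (Suc m))))"
  then obtain m where m: "x \<in> far_set mone S (inverse (real (Suc m)))" by blast
  have "wedge (sg x) s \<noteq> 0" if "s \<in> S" for s
  proof -
    have "0 < inverse (real (Suc m)) * norm (sg x)" by simp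
    also have "\<dots> \<le> cmod (wedge (sg x) s)"
      using m that unfolding far_set_def far_def lin_mone by blast
    finally show ?thesis by simp
  qed
  then show "x \<in> {x. \<forall>s\<in>S. wedge (sg x) s \<noteq> 0}" by blast
qed

lemma borel_singleton_rsphere: "{x :: rsphere} \<in> sets borel"
proof -
  have "{x} = UNIV - {y. \<forall>s\<in>{sg x}. wedge (sg y) s \<noteq> 0}"
    by (auto simp: wedge_sg_eq_0_iff)
  also have "{y. \<forall>s\<in>{sg x}. wedge (sg y) s \<noteq> 0} = (\<Union>m. far_set mone {sg x} (inverse (real (Suc m))))"
    by (rule far_set_exhaust) simp
  also have "UNIV - \<dots> \<in> sets borel"
    by (intro sets.Diff sets.countable_UN) (auto intro: far_set_borel)
  finally show ?thesis .
qed

text \<open>For every \<open>b\<close> a finite set carries all but \<open>b\<close> of the limit: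
  cutoffs transfer the bound through weak convergence, and far sets exhaust the complement of the
  finite set. The union of such sets for \<open>b = 1 / (j + 1)\<close> is the countable
  carrier.\<close>

lemma weak_limit_concentrated:
  assumes F: "F \<noteq> bot" "F \<le> sequentially" and M: "\<And>k. sets (M k) = sets borel" "\<And>k. prob_space (M k)"
    and \<mu>: "sets \<mu> = sets borel" "prob_space \<mu>" and w: "weakly_converges M \<mu>"
    and D: "\<And>b. b > 0 \<Longrightarrow> \<exists>c<b. diffuse_le F M (\<lambda>k. mone) c"
  obtains T where "countable T" "emeasure \<mu> (UNIV - T) = 0"
proof -
  interpret \<mu>: prob_space \<mu> by (rule \<mu>(2))
  have "\<exists>T. finite T \<and> measure \<mu> (UNIV - T) \<le> b" if b: "b > 0" for b
  proof -
    obtain c where c: "c < b" "diffuse_le F M (\<lambda>k. mone) c" using D[OF b] by blast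
    obtain S where S: "finite S" "0 \<notin> S"
      "\<And>\<epsilon> \<eta>. \<epsilon> > 0 \<Longrightarrow> \<eta> > 0 \<Longrightarrow> eventually (\<lambda>k. measure (M k) (far_set mone S \<epsilon>) \<le> c + \<eta>) F"
      using c(2) unfolding diffuse_le_def by blast
    have small: "measure \<mu> (far_set mone S \<epsilon>) \<le> b" if \<epsilon>: "\<epsilon> > 0" for \<epsilon>
    proof -
      obtain \<psi> :: "rsphere \<Rightarrow> real" where \<psi>: "continuous_on UNIV \<psi>" "\<And>x. 0 \<le> \<psi> x" "\<And>x. \<psi> x \<le> 1"
        "\<And>x. x \<in> far_set mone S \<epsilon> \<Longrightarrow> \<psi> x = 1" "\<And>x. x \<notin> far_set mone S (\<epsilon> / 2) \<Longrightarrow> \<psi> x = 0"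
        by (rule cutoff_function[OF mdet_mone S(1) \<epsilon>]) blast
      have int: "integrable N \<psi>" and ind: "integrable N (indicator (far_set mone S e) :: _ \<Rightarrow> real)"
        and me: "(\<integral>x. indicator (far_set mone S e) x \<partial>N) = measure N (far_set mone S e)"
        if N: "sets N = sets borel" "prob_space N" for N e
      proof -
        interpret N: prob_space N by (rule N(2))
        have "\<psi> \<in> borel_measurable N"
          unfolding measurable_cong_sets[OF N(1) refl] by (rule borel_measurable_continuous_onI[OF \<psi>(1)])
        then show "integrable N \<psi>"
          by (intro N.integrable_const_bound[of _ 1]) (use \<psi>(2,3) in auto)
        have E: "far_set mone S e \<in> sets N" using far_set_borel[OF mdet_mone] by (simp add: N(1))
        then show "integrable N (indicator (far_set mone S e) :: _ \<Rightarrow> real)"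
          by (simp add: N.emeasure_eq_measure)
        show "(\<integral>x. indicator (far_set mone S e) x \<partial>N) = measure N (far_set mone S e)"
          using E by simp
      qed
      have "measure \<mu> (far_set mone S \<epsilon>) \<le> (\<integral>x. \<psi> x \<partial>\<mu>)"
        unfolding me[OF \<mu>, symmetric]
        by (rule integral_mono[OF ind[OF \<mu>] int[OF \<mu>]]) (use \<psi>(2,4) in \<open>auto simp: indicator_def\<close>)
      \<comment> \<open>The admissible error \<open>\<eta>\<close> is taken to be
        \<open>b - c\<close>, positive because \<open>c < b\<close>.\<close>
      also have "\<dots> \<le> c + (b - c)"
      proof (rule tendsto_upperbound[OF _ _ F(1)])
        show "((\<lambda>k. \<integral>x. \<psi> x \<partial>M k) \<longlongrightarrow> (\<integral>x. \<psi> x \<partial>\<mu>)) F"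
          using w \<psi>(1) F(2) unfolding weakly_converges_def by (blast intro: tendsto_mono)
        have "eventually (\<lambda>k. measure (M k) (far_set mone S (\<epsilon> / 2)) \<le> c + (b - c)) F"
          using \<epsilon> c(1) by (intro S(3)) auto
        then show "eventually (\<lambda>k. (\<integral>x. \<psi> x \<partial>M k) \<le> c + (b - c)) F"
        proof eventually_elim
          case (elim k)
          have "(\<integral>x. \<psi> x \<partial>M k) \<le> measure (M k) (far_set mone S (\<epsilon> / 2))"
            unfolding me[OF M, symmetric]
            by (rule integral_mono[OF int[OF M] ind[OF M]]) (use \<psi>(3,5) in \<open>auto simp: indicator_def\<close>)
          with elim show ?case by simp
        qed
      qed
      finally show ?thesis by simp
    qed
    let ?E = "\<lambda>m. far_set mone S (inverse (real (Suc m)))"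
    have "(\<lambda>m. measure \<mu> (?E m)) \<longlonglongrightarrow> measure \<mu> (\<Union>m. ?E m)"
    proof (rule \<mu>.finite_Lim_measure_incseq)
      show "range ?E \<subseteq> sets \<mu>" using far_set_borel[OF mdet_mone] by (auto simp: \<mu>(1))
      show "incseq ?E"
        by (intro incseq_SucI far_set_mono) (auto simp: field_simps)
    qed
    then have le: "measure \<mu> (\<Union>m. ?E m) \<le> b"
      by (rule LIMSEQ_le_const2) (use small in auto)
    define T where "T = {x. \<exists>s\<in>S. wedge (sg x) s = 0}"
    have "UNIV - T = (\<Union>m. ?E m)"
      unfolding far_set_exhaust[OF S(1), symmetric] by (auto simp: T_def)
    moreover have "finite T"
    proof -
      have "finite {x. wedge (sg x) s = 0}" if "s \<in> S" for s
      proof (cases "\<exists>y. wedge (sg y) s = 0")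
        case True
        then obtain y where y: "wedge (sg y) s = 0" by blast
        have "s \<noteq> 0" using that S(2) by auto
        have "x = y" if "wedge (sg x) s = 0" for x
          using wedge_parallel[OF that y \<open>s \<noteq> 0\<close>] by (simp add: wedge_sg_eq_0_iff)
        then have "{x. wedge (sg x) s = 0} \<subseteq> {y}" by blast
        then show ?thesis by (rule finite_subset) simp
      qed simp
      then show ?thesis unfolding T_def using S(1) by (simp add: Collect_bex_eq)
    qed
    ultimately show ?thesis using le by auto
  qed
  then have "\<forall>j. \<exists>T. finite T \<and> measure \<mu> (UNIV - T) \<le> inverse (real (Suc j))" by simp
  then obtain T where T: "\<And>j. finite (T j)" "\<And>j. measure \<mu> (UNIV - T j) \<le> inverse (real (Suc j))"
    unfolding choice_iff by blast
  have fin: "X \<in> sets \<mu>" if "countable X" for X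
    unfolding \<mu>(1) by (rule sets.countable[OF borel_singleton_rsphere that])
  have le: "measure \<mu> (UNIV - (\<Union>j. T j)) \<le> inverse (real (Suc j))" for j
  proof -
    have "space \<mu> = UNIV" using sets_eq_imp_space_eq[OF \<mu>(1)] by simp
    then have "UNIV - T j \<in> sets \<mu>"
      using sets.compl_sets[OF fin[of "T j"]] T(1)[of j] by (simp add: countable_finite)
    then have "measure \<mu> (UNIV - (\<Union>j. T j)) \<le> measure \<mu> (UNIV - T j)"
      by (intro \<mu>.finite_measure_mono) auto
    also have "\<dots> \<le> inverse (real (Suc j))" by (rule T(2))
    finally show ?thesis .
  qed
  have "measure \<mu> (UNIV - (\<Union>j. T j)) \<le> 0"
    by (rule LIMSEQ_le_const[OF LIMSEQ_inverse_real_of_nat]) (use le in auto)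
  then have "emeasure \<mu> (UNIV - (\<Union>j. T j)) = 0"
    by (simp add: \<mu>.emeasure_eq_measure measure_le_0_iff)
  moreover have "countable (\<Union>j. T j)" using T(1) by (auto intro: countable_finite)
  ultimately show ?thesis using that by blast
qed

lemma sum_of_atoms:
  assumes \<mu>: "sets \<mu> = sets borel" "prob_space \<mu>" and T: "countable T" "emeasure \<mu> (UNIV - T) = 0"
  shows "\<exists>(S :: rsphere set) (c :: rsphere \<Rightarrow> real). countable S \<and> (\<forall>x\<in>S. c x > 0) \<and>
           (\<forall>A\<in>sets borel. emeasure \<mu> A = (\<Sum>\<^sub>\<infinity>x\<in>S. ennreal (c x) * emeasure (return borel x) A))"
proof -
  interpret \<mu>: prob_space \<mu> by (rule \<mu>(2))
  \<comment> \<open>Points of \<open>T\<close> without mass are dropped to make all weights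
    positive; as \<open>T\<close> is countable, they form a null set.\<close>
  define S where "S = {x \<in> T. measure \<mu> {x} > 0}"
  have S: "countable S" "S \<subseteq> T" using T(1) by (auto simp: S_def intro: countable_subset)
  have sing: "{x} \<in> sets \<mu>" for x unfolding \<mu>(1) by (rule borel_singleton_rsphere)
  have cnt: "X \<in> sets \<mu>" if "countable X" for X
    by (rule sets.countable[OF sing that])
  have sp: "space \<mu> = UNIV" using sets_eq_imp_space_eq[OF \<mu>(1)] by simp
  have nT: "UNIV - T \<in> null_sets \<mu>"
    using T(2) sets.compl_sets[OF cnt[OF T(1)]] by (simp add: null_sets_def sp)
  have "(\<Union>x\<in>T - S. {x}) \<in> null_sets \<mu>"
  proof (rule null_sets_UN')
    show "countable (T - S)" using T(1) by (rule countable_Diff)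
    show "{x} \<in> null_sets \<mu>" if "x \<in> T - S" for x
      using that sing by (auto simp: null_sets_def S_def \<mu>.emeasure_eq_measure zero_less_measure_iff)
  qed
  with nT have "(UNIV - T) \<union> (\<Union>x\<in>T - S. {x}) \<in> null_sets \<mu>" by (rule null_sets.Un)
  moreover have "(UNIV - T) \<union> (\<Union>x\<in>T - S. {x}) = UNIV - S" using S(2) by auto
  ultimately have nS: "UNIV - S \<in> null_sets \<mu>" by simp
  have sumeq: "(\<Sum>x\<in>B. ennreal (measure \<mu> {x}) * emeasure (return borel x) A) = emeasure \<mu> (B \<inter> A)"
    if "finite B" "A \<in> sets borel" for A B
  proof -
    have "emeasure \<mu> (B \<inter> A) = (\<Sum>x\<in>B \<inter> A. emeasure \<mu> {x})"
      using that(1) sing by (intro emeasure_eq_sum_singleton) auto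
    also have "\<dots> = (\<Sum>x\<in>B. ennreal (measure \<mu> {x}) * emeasure (return borel x) A)"
      using that by (intro sum.mono_neutral_cong_left) (auto simp: \<mu>.emeasure_eq_measure indicator_def)
    finally show ?thesis ..
  qed
  have "emeasure \<mu> A = (\<Sum>\<^sub>\<infinity>x\<in>S. ennreal (measure \<mu> {x}) * emeasure (return borel x) A)"
    if A: "A \<in> sets borel" for A
  proof -
    let ?h = "\<lambda>x. ennreal (measure \<mu> {x}) * emeasure (return borel x) A"
    have inf: "infsum ?h S = (SUP B\<in>{B. finite B \<and> B \<subseteq> S}. sum ?h B)"
      by (rule nonneg_infsum_complete) simp
    have A': "A \<in> sets \<mu>" using A by (simp add: \<mu>(1))
    have "emeasure \<mu> A = emeasure \<mu> (A - (UNIV - S))"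
      by (rule emeasure_Diff_null_set[OF nS A', symmetric])
    also have "A - (UNIV - S) = S \<inter> A" by blast
    finally have AS: "emeasure \<mu> A = emeasure \<mu> (S \<inter> A)" .
    show ?thesis
      unfolding inf
    proof (rule antisym)
      show "(SUP B\<in>{B. finite B \<and> B \<subseteq> S}. sum ?h B) \<le> emeasure \<mu> A"
        by (rule SUP_least) (use sumeq[OF _ A] A' in \<open>auto intro: emeasure_mono\<close>)
      show "emeasure \<mu> A \<le> (SUP B\<in>{B. finite B \<and> B \<subseteq> S}. sum ?h B)"
      proof (cases "S = {}")
        case True
        then show ?thesis unfolding AS by simp
      next
        case False
        \<comment> \<open>Initial pieces of an enumeration of \<open>S\<close> turn continuity from
          below into a comparison with the supremum over finite subsets.\<close>
        define B where "B n = from_nat_into S ` {..n}" for n :: nat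
        have B: "finite (B n)" "B n \<subseteq> S" for n
          using from_nat_into[OF False] by (auto simp: B_def)
        have "S = (\<Union>n. B n)"
        proof
          show "S \<subseteq> (\<Union>n. B n)"
          proof
            fix x assume "x \<in> S"
            then obtain n where "x = from_nat_into S n"
              using range_from_nat_into[OF False S(1)] by blast
            then have "x \<in> B n" by (simp add: B_def)
            then show "x \<in> (\<Union>n. B n)" by blast
          qed
        qed (use B(2) in blast)
        then have "S \<inter> A = (\<Union>n. B n \<inter> A)" by blast
        also have "emeasure \<mu> \<dots> = (SUP n. emeasure \<mu> (B n \<inter> A))"
        proof (rule SUP_emeasure_incseq[symmetric])
          show "range (\<lambda>n. B n \<inter> A) \<subseteq> sets \<mu>"
            using cnt[OF countable_finite[OF B(1)]] A' by blast
          show "incseq (\<lambda>n. B n \<inter> A)" by (auto simp: incseq_def B_def)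
        qed
        also have "\<dots> \<le> (SUP B\<in>{B. finite B \<and> B \<subseteq> S}. sum ?h B)"
          by (rule SUP_least, rule SUP_upper2[of "B _"]) (use B sumeq[OF B(1) A] in auto)
        finally show ?thesis unfolding AS .
      qed
    qed
  qed
  then show ?thesis
    by (intro exI[of _ S] exI[of _ "\<lambda>x. measure \<mu> {x}"]) (use S(1) in \<open>auto simp: S_def\<close>)
qed

theorem theoremA:
  fixes d :: nat
    and f :: "nat \<Rightarrow> complex poly fract"
    and M :: "nat \<Rightarrow> rsphere measure"
    and \<mu> :: "rsphere measure"
  assumes "d \<ge> 2"
    and "\<And>k. f k \<in> Rat_set d"
    and "diverges_in_Rat d f"
    and "\<And>k. is_max_entropy_measure (f k) (M k)"
    and "sets \<mu> = sets borel" and "prob_space \<mu>"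
    and "weakly_converges M \<mu>"
  shows "\<exists>(S :: rsphere set) (c :: rsphere \<Rightarrow> real).
           countable S \<and> (\<forall>x\<in>S. c x > 0) \<and>
           (\<forall>A\<in>sets borel.
              emeasure \<mu> A = (\<Sum>\<^sub>\<infinity>x\<in>S. ennreal (c x) * emeasure (return borel x) A))"
proof -
  obtain F :: "nat filter" where ultra_F: "ultra F" "F \<le> sequentially"
    using ultrafilter_exists[OF sequentially_bot] by blast
  have deg: "rat_degree (f k) = d" for k using assms(2) by (simp add: Rat_set_def)
  obtain A l g G where "rescaling_tower F d f M A l g G"
    by (rule rescaling_tower_exists[OF ultra_F(1) assms(1) deg assms(4)])
  then interpret rescaling_tower F d f M A l g G .
  have A0': "A 0 = (\<lambda>k. mone)" using A0 by auto
  have "\<not> \<delta> 0 > 0"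
  proof
    assume pos: "\<delta> 0 > 0"
    have "d > 0" using d by simp
    have "bnd F (A 1) (\<lambda>k. mone)" using bnd_1_0(1)[OF pos] unfolding A0' .
    moreover have "g 0 k v = cscale (l 0 k) (lin (A 1 k) (rat_lift (f k) v))" for k v
      using g[of 0 k v] by (simp add: A0')
    ultimately have "\<not> diverges_in_Rat d f"
      by (rule nohole_not_diverges[where A = "A 1" and l = "l 0" and g = "g 0" and G = "G 0",
          OF ultra_F \<open>d > 0\<close> assms(2) det _ l _ conv bnd_1_0(2)[OF pos]])
    then show False using assms(3) by blast
  qed
  \<comment> \<open>Since the infimum \<open>\<delta> 0\<close> is not positive, it admits bounds
    below every positive \<open>b\<close>.\<close>
  have D: "\<exists>c<b. diffuse_le F M (\<lambda>k. mone) c" if "b > 0" for b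
  proof (rule ccontr)
    assume "\<not> ?thesis"
    then have "b \<le> \<delta> 0" unfolding A0'[symmetric] by (intro \<delta>_greatest) (auto simp: not_less)
    with that \<open>\<not> \<delta> 0 > 0\<close> show False by simp
  qed
  obtain T where "countable T" "emeasure \<mu> (UNIV - T) = 0"
    by (rule weak_limit_concentrated[OF ultra_not_bot[OF ultra_F(1)] ultra_F(2) sets_M prob_M assms(5-7) D])
  with assms(5,6) show ?thesis by (rule sum_of_atoms)
qed

end
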